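(* Suppose that the kernel $\kappa$ satisfies Assumption A and Assumption B (see context), let $u$ be the solution of the hyperbolic Anderson model driven by the Lévy colored noise $X$ (see context), and let $F_R(t)=\int_{-R}^{R}(u(t,x)-1)dx$. Put $$\beta:=\begin{cases}1&\text{if }\kappa\in L^1(\mathbb{R}),\\ \alpha+1&\text{if }\kappa=R_{1,\alpha/2}\text{ for some }\alpha\in(0,1).\end{cases}$$ Then for any $t,s>0$ the limit $$\lim_{R\to\infty}\frac{1}{R^{\beta}}\mathbb{E}[F_R(t)F_R(s)]=:K(t,s)$$ exists and is finite. In particular, $R^{-\beta}\sigma_R^2(t)\to K(t,t)$ as $R\to\infty$ for any $t>0$, where $\sigma_R^2(t)=\mathrm{Var}(F_R(t))$.
   Context: **Noise.** $\mathbb{R}_0=\mathbb{R}\setminus\{0\}$ with distance $d(x,y)=|x^{-1}-y^{-1}|$ (so bounded sets are those bounded away from $0$). $\nu$ is a measure on $\mathbb{R}_0$ with $m_2:=\int_{\mathbb{R}_0}|z|^2\nu(dz)<\infty$. $N$ is a Poisson random measure on $\mathbf{Z}=\mathbb{R}_+\times\mathbb{R}\times\mathbb{R}_0$ with intensity $\mathfrak{m}(dt,dx,dz)=dt\,dx\,\nu(dz)$ on a complete probability space $(\Omega,\mathcal{F},\mathbb{P})$, and $\widehat N=N-\mathfrak{m}$. $\mathcal{F}_t$ is the $\sigma$-field generated by $N([0,s]\times A\times B)$, $s\le t$, $A\subset\mathbb{R}$ and $B\subset\mathbb{R}_0$ bounded Borel, and the $\mathbb{P}$-null sets. A process indexed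 by $\mathbb{R}_+\times\mathbb{R}$ is predictable if it is measurable with respect to the $\sigma$-field generated by the elementary processes $Y1_{(a,b]}(t)1_A(x)$, $0\le a<b$, $A$ bounded Borel, $Y$ $\mathcal{F}_a$-measurable. The Lévy white noise is $L(\varphi)=\int_{\mathbf{Z}}\varphi(t,x)z\,\widehat N(dt,dx,dz)$, $\varphi\in L^2(\mathbb{R}_+\times\mathbb{R})$, with $L_t(\varphi)=L(1_{[0,t]}\varphi)$. The Lévy colored noise is $X_t(\varphi)=L_t(\varphi*\kappa)$, $\varphi\in\mathcal{S}(\mathbb{R})$. **Assumption A.** $\kappa:\mathbb{R}\to[0,\infty]$ is continuous, symmetric and tempered (a measurable function $g$ is tempered if $\int|g(x)|(1+|x|^2)^{-k}dx<\infty$ for some $k>0$), and: (a) its Fourier transform in $\mathcal{S}'(\mathbb{R})$ is a tempered non-negative function $h$, with $h^2$ tempered; (b) $f=\kappa*\tilde\kappa$, $\tilde\kappa(x)=\kappa(-x)$, is a continuous, symmetric, tempered function (with Fourier transform $h^2$); (c) $\kappa(x)<\infty$ and $f(x)<\infty$ for all $x\ne0$. **Assumption B.** Either (i) $\kappa\in L^1(\mathbb{R})$; or (ii) $\kappa=R_{1,\alpha/2}$ for some $\alpha\in(0,1)$, where for $a\in(0,1)$, $R_{1,a}(x)=C_{1,a}|x|^{-(1-a)}$ is the Riesz kernel, $C_{1,a}=\pi^{-1/2}2^{-a}\Gamma(\frac{1-a}{2})/\Gamma(\frac a2)$. **Integral with respect to $X$.** $\int\int g\,dX$ is Walsh's integral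 with respect to the martingale measure induced by $X$; for predictable $g$ with $\mathbb{E}\int_0^T\int_{\mathbb{R}^2}|g(s,x)g(s,y)|f(x-y)\,dx\,dy\,ds<\infty$ and $t\le T$, $\int_0^t\int_{\mathbb{R}}g(s,x)X(ds,dx)=\int_0^t\int_{\mathbb{R}}\int_{\mathbb{R}_0}(g(s,\cdot)*\kappa)(x)\,z\,\widehat N(ds,dx,dz)$. **Equation.** The hyperbolic Anderson model is $\partial_t^2u=\partial_x^2u+u\dot X$, $t>0$, $x\in\mathbb{R}$, $u(0,x)=1$, $\partial_tu(0,x)=0$. With $G_t(x)=\frac12 1_{\{|x|<t\}}$, a (mild) solution is a predictable process $u$ satisfying $u(t,x)=1+\int_0^t\int_{\mathbb{R}}G_{t-s}(x-y)u(s,y)X(ds,dy)$. It is known that there is a unique solution $u$; it satisfies $\sup_{[0,T]\times\mathbb{R}}\mathbb{E}|u(t,x)|^2<\infty$ for all $T>0$, and $\{u(t,x)\}_{x\in\mathbb{R}}$ is strictly stationary for each $t>0$. *)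

theory Defs
  imports "HOL-Probability.Probability"
begin

section \<open>Poisson random measures and the compensated integral\<close>

definition poisson_random_measure ::
    "'w measure \<Rightarrow> ('w \<Rightarrow> 'z measure) \<Rightarrow> 'z measure \<Rightarrow> bool" where
  "poisson_random_measure P N m \<longleftrightarrow>
     (\<forall>\<omega>\<in>space P. sets (N \<omega>) = sets m) \<and>
     (\<forall>B\<in>sets m. (\<lambda>\<omega>. emeasure (N \<omega>) B) \<in> borel_measurable P) \<and>
     (\<forall>B\<in>sets m. emeasure m B < \<infinity> \<longrightarrow>
        (\<forall>k::nat. measure P {\<omega>\<in>space P. emeasure (N \<omega>) B = of_nat k}
                 = exp (- measure m B) * measure m B ^ k / fact k)) \<and>
     (\<forall>B\<in>sets m. emeasure m B = \<infinity> \<longrightarrow> (AE \<omega> in P. emeasure (N \<omega>) B = \<infinity>)) \<and>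
     (\<forall>(I::nat set) B. finite I \<and> (\<forall>i\<in>I. B i \<in> sets m) \<and> disjoint_family_on B I \<longrightarrow>
        prob_space.indep_vars P (\<lambda>_. borel) (\<lambda>i \<omega>. emeasure (N \<omega>) (B i)) I)"

text \<open>\<open>I\<close> is a version of \<open>\<integral> H d(N - m)\<close> for a deterministic square-integrable \<open>H\<close>: the
  isometric extension to \<open>L\<^sup>2(m)\<close> of the pathwise integral of simple functions supported on
  sets of finite \<open>m\<close>-measure (on which \<open>N\<close> is almost surely finite).\<close>

definition has_compensated_integral ::
    "'w measure \<Rightarrow> ('w \<Rightarrow> 'z measure) \<Rightarrow> 'z measure \<Rightarrow> ('z \<Rightarrow> real) \<Rightarrow> ('w \<Rightarrow> real) \<Rightarrow> bool" where
  "has_compensated_integral P N m H I \<longleftrightarrow>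
     H \<in> borel_measurable m \<and> (\<integral>\<^sup>+z. ennreal ((H z)\<^sup>2) \<partial>m) < \<infinity> \<and> I \<in> borel_measurable P \<and>
     (\<exists>S :: nat \<Rightarrow> 'z \<Rightarrow> real.
        (\<forall>n. simple_function m (S n) \<and> emeasure m {z\<in>space m. S n z \<noteq> 0} < \<infinity>) \<and>
        (\<lambda>n. \<integral>\<^sup>+z. ennreal ((S n z - H z)\<^sup>2) \<partial>m) \<longlonglongrightarrow> 0 \<and>
        (\<lambda>n. \<integral>\<^sup>+\<omega>. ennreal (((LINT z|N \<omega>. S n z) - (LINT z|m. S n z) - I \<omega>)\<^sup>2) \<partial>P)
          \<longlonglongrightarrow> 0)"


section \<open>The jump measure, the filtration and predictability\<close>

abbreviation nonzero_reals :: "real set" where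
  "nonzero_reals \<equiv> - {0}"

text \<open>The Borel sets of \<open>nonzero_reals\<close> for the distance \<open>d(x,y) = \<bar>1/x - 1/y\<bar>\<close> are the usual ones,
  but a subset is bounded for \<open>d\<close> iff its image under \<open>inverse\<close> is bounded in the usual sense.\<close>

definition jump_measure :: "real measure \<Rightarrow> bool" where
  "jump_measure \<nu> \<longleftrightarrow>
     sets \<nu> = sets (restrict_space borel nonzero_reals) \<and>
     (\<integral>\<^sup>+z. ennreal (\<bar>z\<bar>\<^sup>2) \<partial>\<nu>) < \<infinity>"

definition intensity :: "real measure \<Rightarrow> (real \<times> real \<times> real) measure" where
  "intensity \<nu> = restrict_space lborel {0..} \<Otimes>\<^sub>M (lborel \<Otimes>\<^sub>M \<nu>)"

definition noise_filtration ::
    "'w measure \<Rightarrow> ('w \<Rightarrow> (real \<times> real \<times> real) measure) \<Rightarrow> real \<Rightarrow> 'w measure" where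
  "noise_filtration P N t = sigma (space P)
     ({(\<lambda>\<omega>. emeasure (N \<omega>) ({0..s} \<times> A \<times> B)) -` C \<inter> space P | s A B C.
         0 \<le> s \<and> s \<le> t \<and> A \<in> sets borel \<and> bounded A \<and>
         B \<in> sets borel \<and> B \<subseteq> nonzero_reals \<and> bounded (inverse ` B) \<and> C \<in> sets borel}
      \<union> null_sets P)"

text \<open>A quadruple \<open>(Y, a, b, A)\<close> represents the elementary process \<open>Y 1\<^bsub>(a,b]\<^esub>(t) 1\<^bsub>A\<^esub>(x)\<close>.\<close>

type_synonym 'w elementary = "('w \<Rightarrow> real) \<times> real \<times> real \<times> real set"

definition elementaries :: "(real \<Rightarrow> 'w measure) \<Rightarrow> 'w elementary set" where
  "elementaries \<F> = {(Y, a, b, A). 0 \<le> a \<and> a < b \<and> A \<in> sets borel \<and> bounded A \<and>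
                                   Y \<in> borel_measurable (\<F> a)}"

definition elementary_process :: "'w elementary \<Rightarrow> real \<Rightarrow> real \<Rightarrow> 'w \<Rightarrow> real" where
  "elementary_process = (\<lambda>(Y, a, b, A) t x \<omega>. Y \<omega> * indicator {a<..b} t * indicator A x)"

definition predictable_sigma ::
    "'w measure \<Rightarrow> (real \<Rightarrow> 'w measure) \<Rightarrow> ('w \<times> real \<times> real) measure" where
  "predictable_sigma P \<F> = sigma (space P \<times> {0..} \<times> UNIV)
     {(\<lambda>(\<omega>, t, x). elementary_process E t x \<omega>) -` C \<inter> (space P \<times> {0..} \<times> UNIV) | E C.
        E \<in> elementaries \<F> \<and> C \<in> sets borel}"

definition predictable ::
    "'w measure \<Rightarrow> (real \<Rightarrow> 'w measure) \<Rightarrow> (real \<Rightarrow> real \<Rightarrow> 'w \<Rightarrow> real) \<Rightarrow> bool" where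
  "predictable P \<F> g \<longleftrightarrow>
     (\<lambda>(\<omega>, t, x). g t x \<omega>) \<in> borel_measurable (predictable_sigma P \<F>)"


section \<open>Schwartz functions, tempered functions and Fourier transforms\<close>

definition schwartz :: "(real \<Rightarrow> 'a::real_normed_vector) \<Rightarrow> bool" where
  "schwartz \<phi> \<longleftrightarrow> (\<exists>D :: nat \<Rightarrow> real \<Rightarrow> 'a. D 0 = \<phi> \<and>
     (\<forall>n x. (D n has_vector_derivative D (Suc n) x) (at x)) \<and>
     (\<forall>m n. bounded (range (\<lambda>x. x ^ m *\<^sub>R D n x))))"

definition fourier :: "(real \<Rightarrow> complex) \<Rightarrow> real \<Rightarrow> complex" where
  "fourier \<phi> \<xi> = (LINT x|lborel. exp (- \<i> * complex_of_real (\<xi> * x)) * \<phi> x)"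

definition tempered :: "(real \<Rightarrow> ennreal) \<Rightarrow> bool" where
  "tempered g \<longleftrightarrow> g \<in> borel_measurable borel \<and>
     (\<exists>k::real. k > 0 \<and> (\<integral>\<^sup>+x. g x * ennreal ((1 + \<bar>x\<bar>\<^sup>2) powr (- k)) \<partial>lborel) < \<infinity>)"

text \<open>The Fourier transform in the sense of tempered distributions of a tempered function with values
  in \<open>[0,\<infinity>]\<close> (such a function is finite almost everywhere, so \<open>enn2real\<close> loses nothing) is the
  tempered function \<open>h\<close>.\<close>

definition has_fourier_transform :: "(real \<Rightarrow> ennreal) \<Rightarrow> (real \<Rightarrow> real) \<Rightarrow> bool" where
  "has_fourier_transform g h \<longleftrightarrow> (\<forall>\<phi> :: real \<Rightarrow> complex. schwartz \<phi> \<longrightarrow>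
     (LINT x|lborel. enn2real (g x) *\<^sub>R fourier \<phi> x) = (LINT \<xi>|lborel. h \<xi> *\<^sub>R \<phi> \<xi>))"


section \<open>Assumptions on the kernel\<close>

definition autocorrelation :: "(real \<Rightarrow> ennreal) \<Rightarrow> real \<Rightarrow> ennreal" where
  "autocorrelation \<kappa> x = (let \<kappa>' = (\<lambda>y. \<kappa> (- y)) in \<integral>\<^sup>+y. \<kappa> (x - y) * \<kappa>' y \<partial>lborel)"

definition assumption_A :: "(real \<Rightarrow> ennreal) \<Rightarrow> bool" where
  "assumption_A \<kappa> \<longleftrightarrow>
     continuous_on UNIV \<kappa> \<and> (\<forall>x. \<kappa> (- x) = \<kappa> x) \<and> tempered \<kappa> \<and>
     (\<exists>h :: real \<Rightarrow> real.
        (\<forall>\<xi>. 0 \<le> h \<xi>) \<and> tempered (\<lambda>\<xi>. ennreal (h \<xi>)) \<and> tempered (\<lambda>\<xi>. ennreal ((h \<xi>)\<^sup>2)) \<and>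
        has_fourier_transform \<kappa> h \<and>
        continuous_on UNIV (autocorrelation \<kappa>) \<and>
        (\<forall>x. autocorrelation \<kappa> (- x) = autocorrelation \<kappa> x) \<and>
        tempered (autocorrelation \<kappa>) \<and>
        has_fourier_transform (autocorrelation \<kappa>) (\<lambda>\<xi>. (h \<xi>)\<^sup>2)) \<and>
     (\<forall>x. x \<noteq> 0 \<longrightarrow> \<kappa> x < \<infinity> \<and> autocorrelation \<kappa> x < \<infinity>)"

definition integrable_kernel :: "(real \<Rightarrow> ennreal) \<Rightarrow> bool" where
  "integrable_kernel \<kappa> \<longleftrightarrow> \<kappa> \<in> borel_measurable borel \<and> (\<integral>\<^sup>+x. \<kappa> x \<partial>lborel) < \<infinity>"

definition riesz_const :: "real \<Rightarrow> real" where
  "riesz_const a = pi powr (- 1 / 2) * 2 powr (- a) * Gamma ((1 - a) / 2) / Gamma (a / 2)"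

definition riesz_kernel :: "real \<Rightarrow> real \<Rightarrow> ennreal" where
  "riesz_kernel a x =
     (if x = 0 then \<infinity> else ennreal (riesz_const a * \<bar>x\<bar> powr (- (1 - a))))"

definition assumption_B :: "(real \<Rightarrow> ennreal) \<Rightarrow> bool" where
  "assumption_B \<kappa> \<longleftrightarrow>
     integrable_kernel \<kappa> \<or> (\<exists>\<alpha>. 0 < \<alpha> \<and> \<alpha> < 1 \<and> \<kappa> = riesz_kernel (\<alpha> / 2))"


section \<open>White noise and colored noise\<close>

definition is_white_noise_integral ::
    "'w measure \<Rightarrow> ('w \<Rightarrow> (real \<times> real \<times> real) measure) \<Rightarrow> real measure \<Rightarrow>
     (real \<Rightarrow> real \<Rightarrow> real) \<Rightarrow> ('w \<Rightarrow> real) \<Rightarrow> bool" where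
  "is_white_noise_integral P N \<nu> \<phi> I \<longleftrightarrow>
     has_compensated_integral P N (intensity \<nu>) (\<lambda>(t, x, z). \<phi> t x * z) I"

definition smoothed :: "(real \<Rightarrow> ennreal) \<Rightarrow> (real \<Rightarrow> real) \<Rightarrow> real \<Rightarrow> real" where
  "smoothed \<kappa> \<phi> x = (LINT y|lborel. \<phi> y * enn2real (\<kappa> (x - y)))"

text \<open>\<open>X t \<phi>\<close> is a version of \<open>X\<^sub>t(\<phi>) = L\<^sub>t(\<phi> * \<kappa>)\<close> for Schwartz \<open>\<phi>\<close>. The martingale measure
  induced by \<open>X\<close> is \<open>X\<^sub>t(A) = X\<^sub>t(1\<^sub>A)\<close> for bounded Borel \<open>A\<close>, given by the same formula.\<close>

definition levy_colored_noise ::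
    "'w measure \<Rightarrow> ('w \<Rightarrow> (real \<times> real \<times> real) measure) \<Rightarrow> real measure \<Rightarrow>
     (real \<Rightarrow> ennreal) \<Rightarrow> (real \<Rightarrow> (real \<Rightarrow> real) \<Rightarrow> 'w \<Rightarrow> real) \<Rightarrow> bool" where
  "levy_colored_noise P N \<nu> \<kappa> X \<longleftrightarrow>
     (\<forall>t\<ge>0. \<forall>\<phi>. schwartz \<phi> \<or> (\<exists>A\<in>sets borel. bounded A \<and> \<phi> = indicator A) \<longrightarrow>
        is_white_noise_integral P N \<nu> (\<lambda>s x. indicator {0..t} s * smoothed \<kappa> \<phi> x) (X t \<phi>))"


section \<open>Walsh's integral with respect to the colored noise\<close>

definition walsh_norm_sq ::
    "'w measure \<Rightarrow> (real \<Rightarrow> ennreal) \<Rightarrow> real \<Rightarrow> (real \<Rightarrow> real \<Rightarrow> 'w \<Rightarrow> real) \<Rightarrow> ennreal" where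
  "walsh_norm_sq P f t g =
     (\<integral>\<^sup>+\<omega>. (\<integral>\<^sup>+s\<in>{0..t}. (\<integral>\<^sup>+x. (\<integral>\<^sup>+y. ennreal \<bar>g s x \<omega> * g s y \<omega>\<bar> * f (x - y)
        \<partial>lborel) \<partial>lborel) \<partial>lborel) \<partial>P)"

definition elementary_integral ::
    "(real \<Rightarrow> (real \<Rightarrow> real) \<Rightarrow> 'w \<Rightarrow> real) \<Rightarrow> real \<Rightarrow> 'w elementary \<Rightarrow> 'w \<Rightarrow> real" where
  "elementary_integral X t =
     (\<lambda>(Y, a, b, A) \<omega>. Y \<omega> * (X (min t b) (indicator A) \<omega> - X (min t a) (indicator A) \<omega>))"

text \<open>\<open>I\<close> is a version of \<open>\<integral>\<^sub>0\<^sup>t \<integral> g(s,x) X(ds,dx)\<close>: the extension to predictable \<open>g\<close> of finite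
  norm of the integral of sums of bounded elementary processes. The time interval is \<open>(0,t]\<close>: a
  predictable process is constant on \<open>{s = 0}\<close>, so without this restriction deterministic integrands
  such as \<open>G\<^bsub>t-s\<^esub>(x-y)\<close> would fail to be predictable merely because of their values at \<open>s = 0\<close>.\<close>

definition has_walsh_integral ::
    "'w measure \<Rightarrow> (real \<Rightarrow> 'w measure) \<Rightarrow> (real \<Rightarrow> ennreal) \<Rightarrow>
     (real \<Rightarrow> (real \<Rightarrow> real) \<Rightarrow> 'w \<Rightarrow> real) \<Rightarrow>
     (real \<Rightarrow> real \<Rightarrow> 'w \<Rightarrow> real) \<Rightarrow> real \<Rightarrow> ('w \<Rightarrow> real) \<Rightarrow> bool" where
  "has_walsh_integral P \<F> f X g t I \<longleftrightarrow>
     predictable P \<F> (\<lambda>s x \<omega>. indicator {0<..t} s * g s x \<omega>) \<and>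
     walsh_norm_sq P f t g < \<infinity> \<and> I \<in> borel_measurable P \<and>
     (\<exists>E :: nat \<Rightarrow> 'w elementary list.
        (\<forall>n. \<forall>e\<in>set (E n). e \<in> elementaries \<F> \<and> bounded (fst e ` space P)) \<and>
        (\<lambda>n. walsh_norm_sq P f t
               (\<lambda>s x \<omega>. (\<Sum>e\<leftarrow>E n. elementary_process e s x \<omega>) - g s x \<omega>)) \<longlonglongrightarrow> 0 \<and>
        (\<lambda>n. \<integral>\<^sup>+\<omega>. ennreal (((\<Sum>e\<leftarrow>E n. elementary_integral X t e \<omega>) - I \<omega>)\<^sup>2) \<partial>P)
          \<longlonglongrightarrow> 0)"


section \<open>The hyperbolic Anderson model\<close>

definition wave_kernel :: "real \<Rightarrow> real \<Rightarrow> real" where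
  "wave_kernel t x = 1 / 2 * indicator {x. \<bar>x\<bar> < t} x"

definition mild_solution ::
    "'w measure \<Rightarrow> ('w \<Rightarrow> (real \<times> real \<times> real) measure) \<Rightarrow> (real \<Rightarrow> ennreal) \<Rightarrow>
     (real \<Rightarrow> (real \<Rightarrow> real) \<Rightarrow> 'w \<Rightarrow> real) \<Rightarrow> (real \<Rightarrow> real \<Rightarrow> 'w \<Rightarrow> real) \<Rightarrow> bool" where
  "mild_solution P N \<kappa> X u \<longleftrightarrow>
     predictable P (noise_filtration P N) u \<and>
     (\<forall>t\<ge>0. \<forall>x. \<exists>I.
        has_walsh_integral P (noise_filtration P N) (autocorrelation \<kappa>) X
          (\<lambda>s y \<omega>. wave_kernel (t - s) (x - y) * u s y \<omega>) t I \<and>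
        (AE \<omega> in P. u t x \<omega> = 1 + I \<omega>))"

definition spatial_integral ::
    "(real \<Rightarrow> real \<Rightarrow> 'w \<Rightarrow> real) \<Rightarrow> real \<Rightarrow> real \<Rightarrow> 'w \<Rightarrow> real" where
  "spatial_integral u R t \<omega> = (LINT x:{- R..R}|lborel. u t x \<omega> - 1)"

end

theory Submission
  imports Defs
begin

text \<open>Counts of a Poisson random measure over disjoint regions are independent, which makes the Walsh
  integral an isometry for the energy form of \<open>f = \<kappa> * \<kappa>\<close>. The mild equation therefore becomes a closed
  linear equation for \<open>E[u(t,x) u(t,x')]\<close>. The finite norm of the integrand at \<open>(T,x)\<close> dominates the
  second moments in the whole backward light cone of that point; starting from this local bound, an
  exponential weight in time makes the equation a contraction, which gives a bound uniform in space and
  the translation invariance of the second moments.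

  Consequently \<open>E[F\<^sub>R(t) F\<^sub>R(s)]\<close> is the double integral of \<open>C(x - x')\<close> over \<open>[-R,R]\<^sup>2\<close>, where \<open>C\<close> is the
  covariance at times \<open>t\<close> and \<open>s\<close>. For an integrable kernel \<open>C\<close> is integrable, so the growth is linear.
  For the Riesz kernel \<open>f\<close> is homogeneous of degree \<open>\<alpha> - 1\<close>; since \<open>E[u(r,y) u(r,y')] \<rightarrow> 1\<close> at large
  distance, \<open>|z|\<^bsup>1-\<alpha>\<^esup> C(z)\<close> has a limit, and rescaling space by \<open>R\<close> yields the power \<open>\<alpha> + 1\<close>.\<close>

section \<open>Independence over disjoint regions\<close>

text \<open>\<open>mild_solution\<close> supplies predictability, finite Walsh norms and the
  equation; every statement about moments has to be extracted from these three. A contraction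
  argument can absorb a supremum only if that supremum is known to be finite. Finite speed of
  propagation settles this: the equation at a point of a backward cone involves only points of the
  same cone, so the supremum may be taken over one cone, where the energy at the vertex keeps it
  finite. The bound obtained in the end no longer depends on the vertex.

  The correlation may be infinite at the origin. The mixed energy of two cones is therefore
  controlled through positive definiteness, by the energies of the single cones, whatever their
  distance. Translation invariance follows because the difference of the second moments and their
  translates solves the equation without its constant term.

  For the Riesz kernel the covariance is used twice: a crude power bound comes first, and only this
  bound yields the convergence of \<open>E[u u]\<close> to 1 that identifies the exact
  constant.\<close>

locale poisson_noise = prob_space P for P :: "'w measure" +
  fixes N :: "'w \<Rightarrow> 'z measure" and m :: "'z measure"
  assumes prm: "poisson_random_measure P N m"
begin

abbreviation count_preimages :: "'z set \<Rightarrow> 'w set set" where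
  "count_preimages B \<equiv> {(\<lambda>\<omega>. emeasure (N \<omega>) B) -` U \<inter> space P | U. U \<in> sets borel}"

definition count_events :: "'z set set \<Rightarrow> 'w set set" where
  "count_events \<C> = sigma_sets (space P) (\<Union>C\<in>\<C>. count_preimages C)"

definition history :: "'z set \<Rightarrow> 'w measure" where
  "history L = sigma (space P) ((\<Union>B\<in>{B\<in>sets m. B \<subseteq> L}. count_preimages B) \<union> null_sets P)"

lemma sets_N: "\<omega> \<in> space P \<Longrightarrow> sets (N \<omega>) = sets m"
  using prm by (auto simp: poisson_random_measure_def)

lemma space_N: "\<omega> \<in> space P \<Longrightarrow> space (N \<omega>) = space m"
  using sets_N sets_eq_imp_space_eq by blast

lemma measurable_count [measurable]:
  "B \<in> sets m \<Longrightarrow> (\<lambda>\<omega>. emeasure (N \<omega>) B) \<in> borel_measurable P"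
  using prm by (auto simp: poisson_random_measure_def)

lemma count_preimages_sets: "B \<in> sets m \<Longrightarrow> count_preimages B \<subseteq> sets P"
  by (auto intro!: measurable_sets[OF measurable_count])

lemma space_history [simp]: "space (history L) = space P"
  by (simp add: history_def space_measure_of_conv)

lemma sets_history:
  "sets (history L) = sigma_sets (space P) ((\<Union>B\<in>{B\<in>sets m. B \<subseteq> L}. count_preimages B) \<union> null_sets P)"
  unfolding history_def
  by (rule sets_measure_of, intro Un_least UN_least)
     (use sets.sets_into_space in blast)+

lemma sets_history_subset: "sets (history L) \<subseteq> sets P"
  unfolding sets_history
  by (rule sets.sigma_sets_subset, intro Un_least UN_least) (use count_preimages_sets in auto)

lemma measurable_historyD: "f \<in> measurable (history L) M' \<Longrightarrow> f \<in> measurable P M'"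
  using measurable_mono[OF order_refl refl sets_history_subset] by auto

lemma history_mono:
  assumes "L \<subseteq> L'"
  shows "sets (history L) \<subseteq> sets (history L')"
  unfolding sets_history
  by (rule sigma_sets_mono') (use assms in blast)

lemma measurable_history_mono:
  "L \<subseteq> L' \<Longrightarrow> f \<in> measurable (history L) M' \<Longrightarrow> f \<in> measurable (history L') M'"
  using measurable_mono[OF order_refl refl history_mono, of L L' M'] by auto

lemma measurable_count_history:
  "B \<in> sets m \<Longrightarrow> B \<subseteq> L \<Longrightarrow> (\<lambda>\<omega>. emeasure (N \<omega>) B) \<in> borel_measurable (history L)"
proof (rule measurableI)
  fix U :: "ennreal set" assume "U \<in> sets borel" "B \<in> sets m" "B \<subseteq> L"
  then show "(\<lambda>\<omega>. emeasure (N \<omega>) B) -` U \<inter> space (history L) \<in> sets (history L)"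
    unfolding sets_history space_history by (intro sigma_sets.Basic) blast
qed simp

text \<open>The definition of a Poisson random measure speaks of families indexed by natural
  numbers. An enumeration of \<open>\<D>\<close> transports independence to a family indexed by its
  own members, the shape in which collections of cells are joined later.\<close>

lemma indep_counts:
  assumes "finite \<D>" "\<D> \<subseteq> sets m" "disjoint \<D>"
  shows "indep_sets count_preimages \<D>"
proof -
  obtain h where h: "bij_betw h {..<card \<D>} \<D>"
    using ex_bij_betw_nat_finite[OF assms(1)] by (auto simp: atLeast0LessThan)
  have "disjoint_family_on h {..<card \<D>}"
    unfolding disjoint_family_on_def
  proof (intro ballI impI)
    fix i j assume "i \<in> {..<card \<D>}" "j \<in> {..<card \<D>}" "i \<noteq> j"
    then have "h i \<in> \<D>" "h j \<in> \<D>" "h i \<noteq> h j"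
      using h by (auto simp: bij_betw_def dest: inj_onD)
    then show "h i \<inter> h j = {}" using assms(3) by (auto dest: disjointD)
  qed
  moreover have "\<forall>i\<in>{..<card \<D>}. h i \<in> sets m"
    using h assms(2) by (auto simp: bij_betw_def)
  ultimately have "indep_vars (\<lambda>_. borel) (\<lambda>i \<omega>. emeasure (N \<omega>) (h i)) {..<card \<D>}"
    using prm by (auto simp: poisson_random_measure_def)
  then have ind: "indep_sets (\<lambda>i. count_preimages (h i)) {..<card \<D>}"
    by (simp add: indep_vars_def2)
  show ?thesis
  proof (rule indep_setsI)
    fix D assume "D \<in> \<D>" then show "count_preimages D \<subseteq> events"
      using assms(2) count_preimages_sets by blast
  next
    fix A J assume J: "J \<noteq> {}" "J \<subseteq> \<D>" "finite J" "\<forall>j\<in>J. A j \<in> count_preimages j"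
    let ?g = "the_inv_into {..<card \<D>} h"
    have g: "h (?g j) = j" "?g j \<in> {..<card \<D>}" if "j \<in> J" for j
      using h that J f_the_inv_into_f_bij_betw[OF h] the_inv_into_into[of h _ j "{..<card \<D>}"]
      by (auto simp: bij_betw_def)
    have "inj_on ?g J" by (metis g(1) inj_onI)
    have hg: "?g (h i) = i" if "i \<in> ?g ` J" for i
      using that g by auto
    have "prob (\<Inter>i\<in>?g ` J. A (h i)) = (\<Prod>i\<in>?g ` J. prob (A (h i)))"
      using J g by (intro indep_setsD[OF ind]) auto
    then show "prob (\<Inter>j\<in>J. A j) = (\<Prod>j\<in>J. prob (A j))"
      using g by (simp add: prod.reindex[OF \<open>inj_on ?g J\<close>])
  qed
qed

section \<open>Reduction of overlapping sets to the disjoint cells of their Venn diagram\<close>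

lemma sigma_algebra_count_events: "sigma_algebra (space P) (count_events \<C>)"
  unfolding count_events_def by (rule sigma_algebra_sigma_sets) auto

lemma count_events_subset: "\<C> \<subseteq> sets m \<Longrightarrow> count_events \<C> \<subseteq> sets P"
  unfolding count_events_def
  by (rule sets.sigma_sets_subset) (use count_preimages_sets in blast)

lemma count_events_mono: "\<C> \<subseteq> \<C>' \<Longrightarrow> count_events \<C> \<subseteq> count_events \<C>'"
  unfolding count_events_def by (rule sigma_sets_mono') blast

definition atom :: "'z set set \<Rightarrow> 'z set set \<Rightarrow> 'z set" where
  "atom \<C> J = \<Inter>J - \<Union>(\<C> - J)"

text \<open>The pattern \<open>J = {}\<close> is left out because \<open>\<Inter>{}\<close> is the
  whole type, so its cell would leave \<open>\<Union>\<C>\<close>. The empty cell is removed so that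
  two families with disjoint unions have no cell in common.\<close>

definition atoms :: "'z set set \<Rightarrow> 'z set set" where
  "atoms \<C> = atom \<C> ` (Pow \<C> - {{}}) - {{}}"

lemma finite_atoms: "finite \<C> \<Longrightarrow> finite (atoms \<C>)"
  by (simp add: atoms_def)

lemma atoms_sets: 
  assumes "finite \<C>" "\<C> \<subseteq> sets m" shows "atoms \<C> \<subseteq> sets m"
proof
  fix D assume "D \<in> atoms \<C>"
  then obtain J where J: "J \<subseteq> \<C>" "J \<noteq> {}" "D = \<Inter>J - \<Union>(\<C> - J)"
    by (auto simp: atoms_def atom_def)
  then have "finite J" using assms(1) finite_subset by blast
  then have "\<Inter>J \<in> sets m"
    using J assms \<open>finite J\<close> by (intro sets.finite_INT[of J "\<lambda>x. x", simplified]) auto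
  moreover have "\<Union>(\<C> - J) \<in> sets m"
    using assms by (intro sets.finite_Union) auto
  ultimately show "D \<in> sets m" using J by auto
qed

lemma mem_atom: "J \<subseteq> \<C> \<Longrightarrow> J \<noteq> {} \<Longrightarrow> x \<in> atom \<C> J \<longleftrightarrow> J = {C\<in>\<C>. x \<in> C}"
  by (auto simp: atom_def)

lemma disjoint_atoms: "disjoint (atoms \<C>)"
  unfolding disjoint_def atoms_def by (blast dest: iffD1[OF mem_atom, rotated 2])

lemma Union_atoms: "\<Union>(atoms \<C>) \<subseteq> \<Union>\<C>"
  by (auto simp: atoms_def atom_def)

lemma atoms_cover:
  assumes "C \<in> \<C>" shows "C = \<Union>{D\<in>atoms \<C>. D \<subseteq> C}"
proof
  show "C \<subseteq> \<Union>{D\<in>atoms \<C>. D \<subseteq> C}"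
  proof
    fix x assume x: "x \<in> C"
    let ?J = "{C\<in>\<C>. x \<in> C}"
    have "x \<in> atom \<C> ?J" "?J \<in> Pow \<C> - {{}}"
      using x assms by (auto simp: atom_def)
    moreover have "atom \<C> ?J \<subseteq> C"
      using x assms by (auto simp: atom_def)
    ultimately show "x \<in> \<Union>{D\<in>atoms \<C>. D \<subseteq> C}"
      unfolding atoms_def by blast
  qed
qed auto

text \<open>Each member of \<open>\<C>\<close> is a finite disjoint union of cells, so its count is
  a sum of counts of cells.\<close>

lemma count_events_atoms:
  assumes "finite \<C>" "\<C> \<subseteq> sets m"
  shows "count_events \<C> \<subseteq> count_events (atoms \<C>)"
proof -
  let ?A = "atoms \<C>"
  let ?M = "sigma (space P) (count_events ?A)"
  interpret sigma_algebra "space P" "count_events ?A" by (rule sigma_algebra_count_events)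
  have sets_M: "sets ?M = count_events ?A" "space ?M = space P"
    using sigma_sets_eq space_closed by (auto simp: sets_measure_of_conv space_measure_of_conv)
  have m: "(\<lambda>\<omega>. emeasure (N \<omega>) D) \<in> borel_measurable ?M" if "D \<in> ?A" for D
  proof (rule measurableI)
    fix U :: "ennreal set" assume "U \<in> sets borel"
    then show "(\<lambda>\<omega>. emeasure (N \<omega>) D) -` U \<inter> space ?M \<in> sets ?M"
      unfolding sets_M unfolding count_events_def using that by (intro sigma_sets.Basic) blast
  qed simp
  have "count_preimages C \<subseteq> count_events ?A" if C: "C \<in> \<C>" for C
  proof -
    let ?K = "{D\<in>?A. D \<subseteq> C}"
    have "emeasure (N \<omega>) C = (\<Sum>D\<in>?K. emeasure (N \<omega>) D)" if "\<omega> \<in> space P" for \<omega>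
    proof -
      have "emeasure (N \<omega>) (\<Union>D\<in>?K. D) = (\<Sum>D\<in>?K. emeasure (N \<omega>) D)"
        using atoms_sets[OF assms] finite_atoms[OF assms(1)] disjoint_atoms[of \<C>] sets_N[OF that]
        by (intro sum_emeasure[symmetric]) (auto simp: disjoint_family_on_def disjoint_def)
      with atoms_cover[OF C] show ?thesis by simp
    qed
    moreover have "(\<lambda>\<omega>. \<Sum>D\<in>?K. emeasure (N \<omega>) D) \<in> borel_measurable ?M"
      using m by (intro borel_measurable_sum) auto
    ultimately have "(\<lambda>\<omega>. emeasure (N \<omega>) C) \<in> borel_measurable ?M"
      by (subst measurable_cong) (auto simp: sets_M)
    then show ?thesis
      using measurable_sets[of "\<lambda>\<omega>. emeasure (N \<omega>) C" ?M borel] by (auto simp: sets_M)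
  qed
  then show ?thesis
    unfolding count_events_def[of \<C>] by (intro sigma_sets_subset) auto
qed

text \<open>The cells of both families together form a single disjoint collection, so their counts
  are independent; grouping them into two blocks preserves independence of the generated
  fields.\<close>

lemma indep_count_events:
  assumes "finite \<C>" "\<C> \<subseteq> sets m" "finite \<C>'" "\<C>' \<subseteq> sets m" "\<Union>\<C> \<inter> \<Union>\<C>' = {}"
  shows "indep_set (count_events \<C>) (count_events \<C>')"
proof -
  let ?A = "atoms \<C>" and ?A' = "atoms \<C>'"
  have disj: "D \<inter> D' = {}" if "D \<in> ?A" "D' \<in> ?A'" for D D'
    using that Union_atoms[of \<C>] Union_atoms[of \<C>'] assms(5) by blast
  have "disjoint (?A \<union> ?A')"
    using disj disjoint_atoms[of \<C>] disjoint_atoms[of \<C>'] by (intro disjoint_union) blast+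
  then have "indep_sets count_preimages (?A \<union> ?A')"
    using assms by (intro indep_counts) (auto simp: finite_atoms dest: atoms_sets)
  then have *: "indep_sets count_preimages (\<Union>j\<in>UNIV. case_bool ?A ?A' j)"
    by (simp add: UNIV_bool Un_commute)
  \<comment> \<open>Once no cell is empty, disjointness of the cells as sets makes the two index
    sets disjoint, which grouping requires.\<close>
  have "{} \<notin> ?A" by (simp add: atoms_def)
  then have "?A \<inter> ?A' = {}"
    using disj by (metis Int_absorb disjoint_iff)
  then have dis: "disjoint_family_on (case_bool ?A ?A') UNIV"
    by (auto simp: disjoint_family_on_def split: bool.split)
  have st: "Int_stable (count_preimages D)" for D
  proof (rule Int_stableI)
    fix a b assume "a \<in> count_preimages D" "b \<in> count_preimages D"
    then obtain U V where "a = (\<lambda>\<omega>. emeasure (N \<omega>) D) -` U \<inter> space P" "U \<in> sets borel"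
       "b = (\<lambda>\<omega>. emeasure (N \<omega>) D) -` V \<inter> space P" "V \<in> sets borel" by blast
    then have "a \<inter> b = (\<lambda>\<omega>. emeasure (N \<omega>) D) -` (U \<inter> V) \<inter> space P" "U \<inter> V \<in> sets borel"
      by auto
    then show "a \<inter> b \<in> count_preimages D" by blast
  qed
  have "indep_sets (\<lambda>j. sigma_sets (space P) (\<Union>i\<in>case_bool ?A ?A' j. count_preimages i)) UNIV"
    by (rule indep_sets_collect_sigma[OF * _ dis]) (rule st)
  then have "indep_set (count_events ?A) (count_events ?A')"
    unfolding indep_set_def count_events_def
    by (rule indep_sets_mono_sets) (auto split: bool.split)
  then show ?thesis
    unfolding indep_sets2_eq using count_events_atoms[OF assms(1,2)] count_events_atoms[OF assms(3,4)]
    by blast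
qed

text \<open>\<open>G L\<close> collects the events that agree almost surely with an event decided by
  finitely many counts inside \<open>L\<close>. This is closed under intersection and contains the
  generators of \<open>history L\<close>, null sets included (they agree with the empty event).
  Independence therefore only has to be checked for finitely many counts.\<close>

lemma indep_history:
  assumes "L \<inter> L' = {}"
  shows "indep_set (sets (history L)) (sets (history L'))"
proof -
  define G where "G L = {A\<in>sets P. \<exists>\<C> A'. finite \<C> \<and> \<C> \<subseteq> sets m \<and> \<Union>\<C> \<subseteq> L \<and>
    A' \<in> count_events \<C> \<and> (AE \<omega> in P. \<omega> \<in> A \<longleftrightarrow> \<omega> \<in> A')}" for L
  have st: "Int_stable (G L)" for L
  proof (rule Int_stableI)
    fix A B assume "A \<in> G L" "B \<in> G L"
    then obtain \<C> A' \<D> B' where *: "A \<in> sets P" "B \<in> sets P" "finite (\<C> \<union> \<D>)" "\<C> \<union> \<D> \<subseteq> sets m"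
      "\<Union>(\<C> \<union> \<D>) \<subseteq> L" "A' \<in> count_events \<C>" "B' \<in> count_events \<D>"
      and ae: "AE \<omega> in P. \<omega> \<in> A \<longleftrightarrow> \<omega> \<in> A'" "AE \<omega> in P. \<omega> \<in> B \<longleftrightarrow> \<omega> \<in> B'"
      unfolding G_def by auto
    interpret sigma_algebra "space P" "count_events (\<C> \<union> \<D>)" by (rule sigma_algebra_count_events)
    have "A' \<inter> B' \<in> count_events (\<C> \<union> \<D>)"
      using * count_events_mono[of \<C> "\<C> \<union> \<D>"] count_events_mono[of \<D> "\<C> \<union> \<D>"] by blast
    moreover have "AE \<omega> in P. \<omega> \<in> A \<inter> B \<longleftrightarrow> \<omega> \<in> A' \<inter> B'"
      using ae by eventually_elim auto
    ultimately show "A \<inter> B \<in> G L"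
      unfolding G_def using * by blast
  qed
  have sub: "sets (history L) \<subseteq> sigma_sets (space P) (G L)" for L
    unfolding sets_history
  proof (rule sigma_sets_mono', rule Un_least)
    show "(\<Union>B\<in>{B\<in>sets m. B \<subseteq> L}. count_preimages B) \<subseteq> G L"
    proof (intro UN_least subsetI)
      fix B E assume B: "B \<in> {B\<in>sets m. B \<subseteq> L}" "E \<in> count_preimages B"
      have "E \<in> count_events {B}"
        unfolding count_events_def by (rule sigma_sets.Basic) (use B in blast)
      moreover have "E \<in> sets P"
        using count_preimages_sets[of B] B by blast
      moreover have "finite {B}" "{B} \<subseteq> sets m" "\<Union>{B} \<subseteq> L" using B by auto
      ultimately show "E \<in> G L" unfolding G_def mem_Collect_eq
        by (intro conjI exI[of _ "{B}"] exI[of _ E]) simp_all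
    qed
    show "null_sets P \<subseteq> G L"
    proof
      fix E assume E: "E \<in> null_sets P"
      then have "AE \<omega> in P. \<omega> \<in> E \<longleftrightarrow> \<omega> \<in> {}"
        by (auto dest: AE_not_in)
      moreover have "{} \<in> count_events {}" unfolding count_events_def by (rule sigma_sets.Empty)
      moreover have "E \<in> sets P" using E by auto
      ultimately show "E \<in> G L" unfolding G_def mem_Collect_eq
        by (intro conjI exI[of _ "{}"]) auto
    qed
  qed
  have "indep_set (G L) (G L')"
    unfolding indep_sets2_eq
  proof (intro conjI ballI)
    fix A B assume "A \<in> G L" "B \<in> G L'"
    then obtain \<C> A' \<D> B' where *: "A \<in> sets P" "B \<in> sets P" "finite \<C>" "\<C> \<subseteq> sets m"
      "\<Union>\<C> \<subseteq> L" "A' \<in> count_events \<C>" "finite \<D>" "\<D> \<subseteq> sets m" "\<Union>\<D> \<subseteq> L'" "B' \<in> count_events \<D>"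
      and ae: "AE \<omega> in P. \<omega> \<in> A \<longleftrightarrow> \<omega> \<in> A'" "AE \<omega> in P. \<omega> \<in> B \<longleftrightarrow> \<omega> \<in> B'"
      unfolding G_def by auto
    have A': "A' \<in> sets P" "B' \<in> sets P" using * count_events_subset by blast+
    have "prob (A' \<inter> B') = prob A' * prob B'"
    proof (rule indep_setD[OF indep_count_events])
      show "\<Union>\<C> \<inter> \<Union>\<D> = {}" using * assms by blast
    qed (use * in auto)
    moreover have "prob A = prob A'" using ae * A' by (intro finite_measure_eq_AE) auto
    moreover have "prob B = prob B'" using ae * A' by (intro finite_measure_eq_AE) auto
    moreover have "prob (A \<inter> B) = prob (A' \<inter> B')"
      using ae * A' by (intro finite_measure_eq_AE) auto
    ultimately show "prob (A \<inter> B) = prob A * prob B" by simp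
  qed (auto simp: G_def)
  from indep_set_sigma_sets[OF this st st] show ?thesis
    unfolding indep_sets2_eq using sub sets_history_subset by blast
qed

lemma expectation_mult_history:
  fixes U V :: "'w \<Rightarrow> real"
  assumes "L \<inter> L' = {}" "U \<in> borel_measurable (history L)" "V \<in> borel_measurable (history L')"
    and "integrable P U" "integrable P V"
  shows "expectation (\<lambda>\<omega>. U \<omega> * V \<omega>) = expectation U * expectation V"
    and "integrable P (\<lambda>\<omega>. U \<omega> * V \<omega>)"
proof -
  have sub: "sigma_sets (space P) {W -` A \<inter> space P |A. A \<in> sets borel} \<subseteq> sets (history L)"
    if "W \<in> borel_measurable (history L)" for W :: "'w \<Rightarrow> real" and L
  proof -
    have "{W -` A \<inter> space P |A. A \<in> sets borel} \<subseteq> sets (history L)"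
      using measurable_sets[OF that] by auto
    from sets.sigma_sets_subset[OF this] show ?thesis by simp
  qed
  have "indep_set (sigma_sets (space P) {U -` A \<inter> space P |A. A \<in> sets borel})
    (sigma_sets (space P) {V -` A \<inter> space P |A. A \<in> sets borel})"
    using indep_history[OF assms(1)] sub[OF assms(2)] sub[OF assms(3)]
    unfolding indep_sets2_eq by (meson subset_eq)
  then have "indep_var borel U borel V"
    unfolding indep_var_eq using assms(2,3)[THEN measurable_historyD] by blast
  from indep_var_lebesgue_integral[OF this assms(4,5)] indep_var_integrable[OF this assms(4,5)]
  show "expectation (\<lambda>\<omega>. U \<omega> * V \<omega>) = expectation U * expectation V"
    and "integrable P (\<lambda>\<omega>. U \<omega> * V \<omega>)" .
qed

end

section \<open>Square-integrable functions\<close>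

definition square_integrable :: "'a measure \<Rightarrow> ('a \<Rightarrow> real) \<Rightarrow> bool" where
  "square_integrable M f \<longleftrightarrow> f \<in> borel_measurable M \<and> integrable M (\<lambda>x. (f x)\<^sup>2)"

text \<open>Membership in the space is part of the notion: the Bochner integral of a non-integrable
  square is 0 and would make convergence meaningless.\<close>

definition tendsto_L2 :: "'a measure \<Rightarrow> (nat \<Rightarrow> 'a \<Rightarrow> real) \<Rightarrow> ('a \<Rightarrow> real) \<Rightarrow> bool" where
  "tendsto_L2 M fs f \<longleftrightarrow> (\<forall>n. square_integrable M (fs n)) \<and> square_integrable M f \<and>
     (\<lambda>n. LINT x|M. (fs n x - f x)\<^sup>2) \<longlonglongrightarrow> 0"

lemma square_integrable_iff_nn:
  "square_integrable M f \<longleftrightarrow> f \<in> borel_measurable M \<and> (\<integral>\<^sup>+x. ennreal ((f x)\<^sup>2) \<partial>M) < \<infinity>"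
  by (auto simp: square_integrable_def integrable_iff_bounded)

lemma square_integrable_mult:
  assumes "square_integrable M f" "square_integrable M g"
  shows "integrable M (\<lambda>x. f x * g x)"
proof (rule Bochner_Integration.integrable_bound)
  show "integrable M (\<lambda>x. (f x)\<^sup>2 + (g x)\<^sup>2)" using assms by (auto simp: square_integrable_def)
  show "(\<lambda>x. f x * g x) \<in> borel_measurable M" using assms by (auto simp: square_integrable_def)
  have "\<bar>f x * g x\<bar> \<le> (f x)\<^sup>2 + (g x)\<^sup>2" for x
  proof -
    have "2 * \<bar>f x\<bar> * \<bar>g x\<bar> \<le> (f x)\<^sup>2 + (g x)\<^sup>2"
      using sum_squares_bound[of "\<bar>f x\<bar>" "\<bar>g x\<bar>"] by simp
    moreover have "0 \<le> \<bar>f x\<bar> * \<bar>g x\<bar>" by simp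
    ultimately show ?thesis unfolding abs_mult by linarith
  qed
  then show "AE x in M. norm (f x * g x) \<le> norm ((f x)\<^sup>2 + (g x)\<^sup>2)"
    by simp
qed

lemma square_integrable_cmult: "square_integrable M f \<Longrightarrow> square_integrable M (\<lambda>x. c * f x)"
  by (auto simp: square_integrable_def power_mult_distrib)

lemma square_integrable_add:
  assumes "square_integrable M f" "square_integrable M g"
  shows "square_integrable M (\<lambda>x. f x + g x)"
proof -
  have "integrable M (\<lambda>x. (f x)\<^sup>2 + (g x)\<^sup>2 + 2 * (f x * g x))"
    using assms square_integrable_mult[OF assms]
    by (intro Bochner_Integration.integrable_add) (auto simp: square_integrable_def)
  then show ?thesis using assms by (auto simp: square_integrable_def power2_sum mult.assoc)
qed

lemma square_integrable_diff:
  assumes "square_integrable M f" "square_integrable M g"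
  shows "square_integrable M (\<lambda>x. f x - g x)"
  using square_integrable_add[OF assms(1) square_integrable_cmult[OF assms(2), of "-1"]] by simp

lemma square_integrable_sum:
  "(\<And>i. i \<in> I \<Longrightarrow> square_integrable M (f i)) \<Longrightarrow> square_integrable M (\<lambda>x. \<Sum>i\<in>I. f i x)"
proof (induction I rule: infinite_finite_induct)
  case (insert i I)
  then show ?case using square_integrable_add[of M "f i" "\<lambda>x. \<Sum>i\<in>I. f i x"] by simp
qed (auto simp: square_integrable_def)

lemma square_integrable_bounded_mult:
  assumes "square_integrable M f" "Z \<in> borel_measurable M" "\<And>x. x \<in> space M \<Longrightarrow> \<bar>Z x\<bar> \<le> c"
  shows "square_integrable M (\<lambda>x. Z x * f x)"
  unfolding square_integrable_def
proof
  show "(\<lambda>x. Z x * f x) \<in> borel_measurable M" using assms by (auto simp: square_integrable_def)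
  show "integrable M (\<lambda>x. (Z x * f x)\<^sup>2)"
  proof (rule Bochner_Integration.integrable_bound)
    show "integrable M (\<lambda>x. c\<^sup>2 * (f x)\<^sup>2)" using assms by (auto simp: square_integrable_def)
    show "(\<lambda>x. (Z x * f x)\<^sup>2) \<in> borel_measurable M" using assms by (auto simp: square_integrable_def)
    show "AE x in M. norm ((Z x * f x)\<^sup>2) \<le> norm (c\<^sup>2 * (f x)\<^sup>2)"
      using order_trans[OF assms(3) abs_ge_self]
      by (intro AE_I2) (auto simp: power_mult_distrib abs_le_square_iff[symmetric] intro!: mult_right_mono)
  qed
qed

lemma Cauchy_Schwarz_square_integrable:
  assumes "square_integrable M f" "square_integrable M g"
  shows "(LINT x|M. \<bar>f x * g x\<bar>) \<le> sqrt (LINT x|M. (f x)\<^sup>2) * sqrt (LINT x|M. (g x)\<^sup>2)"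
proof -
  have [measurable]: "f \<in> borel_measurable M" "g \<in> borel_measurable M"
    using assms by (auto simp: square_integrable_def)
  have i: "integrable M (\<lambda>x. \<bar>f x * g x\<bar>)" using square_integrable_mult[OF assms] by simp
  have eq: "(\<integral>\<^sup>+x. ennreal \<bar>h x\<bar> ^ 2 \<partial>M) = ennreal (LINT x|M. (h x)\<^sup>2)"
    if "square_integrable M h" for h
    using that by (subst nn_integral_eq_integral[symmetric])
      (auto simp: square_integrable_def ennreal_power)
  have "ennreal (LINT x|M. \<bar>f x * g x\<bar>) = (\<integral>\<^sup>+x. ennreal \<bar>f x\<bar> * ennreal \<bar>g x\<bar> \<partial>M)"
    using i by (subst nn_integral_eq_integral[symmetric]) (auto simp: abs_mult ennreal_mult)
  then have "ennreal ((LINT x|M. \<bar>f x * g x\<bar>)\<^sup>2) = (\<integral>\<^sup>+x. ennreal \<bar>f x\<bar> * ennreal \<bar>g x\<bar> \<partial>M)\<^sup>2"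
    by (simp add: ennreal_power[symmetric])
  also have "\<dots> \<le> ennreal (LINT x|M. (f x)\<^sup>2) * ennreal (LINT x|M. (g x)\<^sup>2)"
    using Cauchy_Schwarz_nn_integral[of "\<lambda>x. ennreal \<bar>f x\<bar>" M "\<lambda>x. ennreal \<bar>g x\<bar>"] eq assms by simp
  finally have "(LINT x|M. \<bar>f x * g x\<bar>)\<^sup>2 \<le> (LINT x|M. (f x)\<^sup>2) * (LINT x|M. (g x)\<^sup>2)"
    by (simp add: ennreal_mult[symmetric] ennreal_le_iff)
  then show ?thesis
    by (simp add: real_le_rsqrt real_sqrt_mult[symmetric])
qed

text \<open>A limit inherits square integrability from any approximant at finite distance; distance
  below 1 occurs because the distances tend to 0.\<close>

lemma tendsto_L2I:
  assumes "\<And>n. square_integrable M (fs n)" "f \<in> borel_measurable M"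
    and lim: "(\<lambda>n. \<integral>\<^sup>+x. ennreal ((fs n x - f x)\<^sup>2) \<partial>M) \<longlonglongrightarrow> 0"
  shows "tendsto_L2 M fs f"
proof -
  have "eventually (\<lambda>n. (\<integral>\<^sup>+x. ennreal ((fs n x - f x)\<^sup>2) \<partial>M) < 1) sequentially"
    using lim by (rule order_tendstoD) simp
  then obtain n where "(\<integral>\<^sup>+x. ennreal ((fs n x - f x)\<^sup>2) \<partial>M) < 1"
    by (auto simp: eventually_sequentially)
  then have "(\<integral>\<^sup>+x. ennreal ((fs n x - f x)\<^sup>2) \<partial>M) < \<infinity>"
    by (auto intro: order.strict_trans)
  then have "square_integrable M (\<lambda>x. fs n x - f x)"
    using assms(1)[of n] assms(2) by (auto simp: square_integrable_iff_nn)
  from square_integrable_diff[OF assms(1)[of n] this] have sq: "square_integrable M f" by simp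
  have "ennreal (LINT x|M. (fs n x - f x)\<^sup>2) = (\<integral>\<^sup>+x. ennreal ((fs n x - f x)\<^sup>2) \<partial>M)" for n
    using square_integrable_diff[OF assms(1)[of n] sq]
    by (subst nn_integral_eq_integral) (auto simp: square_integrable_def)
  with lim have "(\<lambda>n. ennreal (LINT x|M. (fs n x - f x)\<^sup>2)) \<longlonglongrightarrow> ennreal 0" by simp
  then have "(\<lambda>n. LINT x|M. (fs n x - f x)\<^sup>2) \<longlonglongrightarrow> 0"
    by (subst (asm) tendsto_ennreal_iff) auto
  with assms sq show ?thesis by (auto simp: tendsto_L2_def)
qed

lemma tendsto_L2_sandwich:
  assumes "tendsto_L2 M fs f" "tendsto_L2 M gs g" "\<And>n. square_integrable M (hs n)" "square_integrable M h"
    and le: "\<And>n. (LINT x|M. (hs n x - h x)\<^sup>2) \<le>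
      c * (LINT x|M. (fs n x - f x)\<^sup>2) + c * (LINT x|M. (gs n x - g x)\<^sup>2)"
  shows "tendsto_L2 M hs h"
proof -
  have "(\<lambda>n. c * (LINT x|M. (fs n x - f x)\<^sup>2) + c * (LINT x|M. (gs n x - g x)\<^sup>2)) \<longlonglongrightarrow> c * 0 + c * 0"
    using assms(1,2) by (intro tendsto_intros) (auto simp: tendsto_L2_def)
  then have "(\<lambda>n. LINT x|M. (hs n x - h x)\<^sup>2) \<longlonglongrightarrow> 0"
    by (intro tendsto_sandwich[OF _ _ tendsto_const, of _ "\<lambda>n. LINT x|M. (hs n x - h x)\<^sup>2"])
       (use le in auto)
  with assms show ?thesis by (auto simp: tendsto_L2_def)
qed

lemma tendsto_L2_diff:
  assumes f: "tendsto_L2 M fs f" and g: "tendsto_L2 M gs g"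
  shows "tendsto_L2 M (\<lambda>n x. fs n x - gs n x) (\<lambda>x. f x - g x)"
proof (rule tendsto_L2_sandwich[OF f g])
  have sf: "square_integrable M (\<lambda>x. fs n x - f x)" "square_integrable M (\<lambda>x. gs n x - g x)" for n
    using f g by (auto simp: tendsto_L2_def intro: square_integrable_diff)
  show "square_integrable M (\<lambda>x. fs n x - gs n x)" for n
    using f g by (auto simp: tendsto_L2_def intro: square_integrable_diff)
  show "square_integrable M (\<lambda>x. f x - g x)"
    using f g by (auto simp: tendsto_L2_def intro: square_integrable_diff)
  show "(LINT x|M. (fs n x - gs n x - (f x - g x))\<^sup>2)
     \<le> 2 * (LINT x|M. (fs n x - f x)\<^sup>2) + 2 * (LINT x|M. (gs n x - g x)\<^sup>2)" for n
  proof -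
    have "(fs n x - gs n x - (f x - g x))\<^sup>2 \<le> 2 * (fs n x - f x)\<^sup>2 + 2 * (gs n x - g x)\<^sup>2" for x
      using sum_squares_ge_zero[of "(fs n x - f x) + (gs n x - g x)" 0]
      by (simp add: power2_eq_square algebra_simps)
    then have "(LINT x|M. (fs n x - gs n x - (f x - g x))\<^sup>2)
       \<le> (LINT x|M. 2 * (fs n x - f x)\<^sup>2 + 2 * (gs n x - g x)\<^sup>2)"
      using sf[of n] square_integrable_diff[OF sf(1)[of n] sf(2)[of n]]
      by (intro integral_mono) (auto simp: square_integrable_def algebra_simps)
    also have "\<dots> = 2 * (LINT x|M. (fs n x - f x)\<^sup>2) + 2 * (LINT x|M. (gs n x - g x)\<^sup>2)"
      using sf[of n] by (subst Bochner_Integration.integral_add) (auto simp: square_integrable_def)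
    finally show ?thesis .
  qed
qed

lemma tendsto_L2_inner:
  assumes f: "tendsto_L2 M fs f" and g: "tendsto_L2 M gs g"
  shows "(\<lambda>n. LINT x|M. fs n x * gs n x) \<longlonglongrightarrow> (LINT x|M. f x * g x)"
proof -
  let ?nf = "\<lambda>h. sqrt (LINT x|M. (h x)\<^sup>2)"
  have sq: "square_integrable M f" "square_integrable M g" "square_integrable M (fs n)" "square_integrable M (gs n)"
    "square_integrable M (\<lambda>x. fs n x - f x)" "square_integrable M (\<lambda>x. gs n x - g x)" for n
    using f g by (auto simp: tendsto_L2_def intro: square_integrable_diff)
  \<comment> \<open>Writing \<open>fs n = f + (fs n - f)\<close> and likewise for
    \<open>gs n\<close> leaves three products, each with a factor that tends to 0; \<open>?b\<close>
    bounds them by Cauchy-Schwarz.\<close>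
  let ?b = "\<lambda>n. ?nf (\<lambda>x. fs n x - f x) * ?nf (\<lambda>x. gs n x - g x) + ?nf (\<lambda>x. fs n x - f x) * ?nf g
     + ?nf f * ?nf (\<lambda>x. gs n x - g x)"
  have "?b \<longlonglongrightarrow> sqrt 0 * sqrt 0 + sqrt 0 * ?nf g + ?nf f * sqrt 0"
    using f g by (intro tendsto_intros) (auto simp: tendsto_L2_def)
  then have lim: "?b \<longlonglongrightarrow> 0" by simp
  have "norm ((LINT x|M. fs n x * gs n x) - (LINT x|M. f x * g x)) \<le> ?b n" for n
  proof -
    note i = square_integrable_mult[OF sq(5)[of n] sq(6)[of n]] square_integrable_mult[OF sq(5)[of n] sq(2)]
      square_integrable_mult[OF sq(1) sq(6)[of n]]
    have "(LINT x|M. fs n x * gs n x) - (LINT x|M. f x * g x) = (LINT x|M. fs n x * gs n x - f x * g x)"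
      by (subst Bochner_Integration.integral_diff) (use square_integrable_mult[OF sq(3,4)[of n]] square_integrable_mult[OF sq(1,2)] in auto)
    also have "\<dots> = (LINT x|M. (fs n x - f x) * (gs n x - g x) + (fs n x - f x) * g x + f x * (gs n x - g x))"
      by (simp add: algebra_simps)
    also have "\<dots> = (LINT x|M. (fs n x - f x) * (gs n x - g x)) + (LINT x|M. (fs n x - f x) * g x)
       + (LINT x|M. f x * (gs n x - g x))"
      using i by (subst Bochner_Integration.integral_add; (subst Bochner_Integration.integral_add)?) auto
    finally have "norm ((LINT x|M. fs n x * gs n x) - (LINT x|M. f x * g x)) \<le>
       (LINT x|M. \<bar>(fs n x - f x) * (gs n x - g x)\<bar>) + (LINT x|M. \<bar>(fs n x - f x) * g x\<bar>)
       + (LINT x|M. \<bar>f x * (gs n x - g x)\<bar>)"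
      using integral_abs_bound[of M "\<lambda>x. (fs n x - f x) * (gs n x - g x)"]
        integral_abs_bound[of M "\<lambda>x. (fs n x - f x) * g x"]
        integral_abs_bound[of M "\<lambda>x. f x * (gs n x - g x)"] unfolding real_norm_def by linarith
    also have "\<dots> \<le> ?b n"
      by (intro add_mono Cauchy_Schwarz_square_integrable sq)
    finally show ?thesis .
  qed
  then have "(\<lambda>n. (LINT x|M. fs n x * gs n x) - (LINT x|M. f x * g x)) \<longlonglongrightarrow> 0"
    by (intro Lim_null_comparison[OF _ lim]) auto
  then show ?thesis by (rule Lim_null[THEN iffD2])
qed

lemma tendsto_L2_bounded_mult:
  assumes f: "tendsto_L2 M fs f" and Z: "Z \<in> borel_measurable M" "\<And>x. x \<in> space M \<Longrightarrow> \<bar>Z x\<bar> \<le> c"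
  shows "tendsto_L2 M (\<lambda>n x. Z x * fs n x) (\<lambda>x. Z x * f x)"
proof (rule tendsto_L2_sandwich[OF f f])
  have sf: "square_integrable M (\<lambda>x. fs n x - f x)" for n
    using f by (auto simp: tendsto_L2_def intro: square_integrable_diff)
  show "square_integrable M (\<lambda>x. Z x * fs n x)" for n
    using f by (intro square_integrable_bounded_mult[OF _ Z]) (auto simp: tendsto_L2_def)
  show "square_integrable M (\<lambda>x. Z x * f x)"
    using f by (intro square_integrable_bounded_mult[OF _ Z]) (auto simp: tendsto_L2_def)
  show "(LINT x|M. (Z x * fs n x - Z x * f x)\<^sup>2)
     \<le> c\<^sup>2 * (LINT x|M. (fs n x - f x)\<^sup>2) + c\<^sup>2 * (LINT x|M. (fs n x - f x)\<^sup>2)" for n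
  proof -
    have "(LINT x|M. (Z x * fs n x - Z x * f x)\<^sup>2) = (LINT x|M. (Z x * (fs n x - f x))\<^sup>2)"
      by (simp add: algebra_simps)
    also have "\<dots> \<le> (LINT x|M. c\<^sup>2 * (fs n x - f x)\<^sup>2)"
      using sf[of n] square_integrable_bounded_mult[OF sf[of n] Z] Z(1) order_trans[OF Z(2) abs_ge_self]
      by (intro integral_mono) (auto simp: square_integrable_def power_mult_distrib abs_le_square_iff[symmetric]
          intro!: mult_right_mono)
    also have "\<dots> = c\<^sup>2 * (LINT x|M. (fs n x - f x)\<^sup>2)" by simp
    also have "\<dots> \<le> \<dots> + \<dots>" by simp
    finally show ?thesis .
  qed
qed

lemma (in prob_space) square_integrable_imp_integrable:
  assumes "square_integrable M f" shows "integrable M f"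
  using square_integrable_mult[OF assms, of "\<lambda>_. 1"] by (simp add: square_integrable_def)

lemma (in prob_space) square_integrable_const: "square_integrable M (\<lambda>_. c)"
  by (simp add: square_integrable_def)

lemma (in prob_space) tendsto_L2_expectation:
  assumes "tendsto_L2 M fs f"
  shows "(\<lambda>n. LINT x|M. fs n x) \<longlonglongrightarrow> (LINT x|M. f x)"
  using tendsto_L2_inner[OF assms, of "\<lambda>_ _. 1" "\<lambda>_. 1"]
  by (simp add: tendsto_L2_def square_integrable_const)

section \<open>Moments of the Poisson counts\<close>

text \<open>Total mass, mean and variance of the Poisson law, with the normalising factor
  \<open>exp (- l)\<close> moved to the right. The index shift
  \<open>k * l^k / k! = l * l^(k-1) / (k-1)!\<close> gives the first two moments.\<close>

lemma Poisson_sums: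
  fixes l :: real
  shows "(\<lambda>k. l ^ k / fact k) sums exp l"
    and "(\<lambda>k. real k * (l ^ k / fact k)) sums (l * exp l)"
    and "(\<lambda>k. (real k - l)\<^sup>2 * (l ^ k / fact k)) sums (l * exp l)"
proof -
  show 0: "(\<lambda>k. l ^ k / fact k) sums exp l"
    using exp_converges[of l] by (simp add: divide_inverse mult.commute)
  have s: "real (Suc k) * (l ^ Suc k / fact (Suc k)) = l * (l ^ k / fact k)" for k
    by (simp add: field_simps del: of_nat_Suc)
  have "(\<lambda>k. real (Suc k) * (l ^ Suc k / fact (Suc k))) sums (l * exp l)"
    unfolding s by (rule sums_mult[OF 0])
  from sums_Suc[OF this] show 1: "(\<lambda>k. real k * (l ^ k / fact k)) sums (l * exp l)" by simp
  have s': "(real (Suc k))\<^sup>2 * (l ^ Suc k / fact (Suc k)) = l * (real k * (l ^ k / fact k) + l ^ k / fact k)" for k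
  proof -
    have "(real (Suc k))\<^sup>2 * (l ^ Suc k / fact (Suc k)) = real (Suc k) * (l * (l ^ k / fact k))"
      unfolding s[symmetric] by (simp add: power2_eq_square)
    then show ?thesis by (simp only: of_nat_Suc) (simp only: distrib_left distrib_right mult_1 mult.left_commute)
  qed
  have "(\<lambda>k. (real (Suc k))\<^sup>2 * (l ^ Suc k / fact (Suc k))) sums (l * (l * exp l + exp l))"
    unfolding s' by (intro sums_mult sums_add 0 1)
  from sums_Suc[OF this] have 2: "(\<lambda>k. (real k)\<^sup>2 * (l ^ k / fact k)) sums (l * (l * exp l + exp l))" by simp
  have "(\<lambda>k. (real k)\<^sup>2 * (l ^ k / fact k) - (2 * l) * (real k * (l ^ k / fact k)) + l\<^sup>2 * (l ^ k / fact k))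
    sums (l * (l * exp l + exp l) - (2 * l) * (l * exp l) + l\<^sup>2 * exp l)"
    by (intro sums_add sums_diff sums_mult 0 1 2)
  then show "(\<lambda>k. (real k - l)\<^sup>2 * (l ^ k / fact k)) sums (l * exp l)"
    by (simp add: power2_eq_square algebra_simps)
qed

context poisson_noise
begin

definition centered_count :: "'z set \<Rightarrow> 'w \<Rightarrow> real" where
  "centered_count A \<omega> = measure (N \<omega>) A - measure m A"

context
  fixes A assumes A: "A \<in> sets m" "emeasure m A < \<infinity>"
begin

lemma prob_count:
  "prob {\<omega>\<in>space P. emeasure (N \<omega>) A = of_nat k} = exp (- measure m A) * measure m A ^ k / fact k"
  using prm A by (auto simp: poisson_random_measure_def)

text \<open>The Poisson probabilities of the natural values add up to 1, so nothing is left for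
  other values, infinity among them.\<close>

lemma AE_count_nat: "AE \<omega> in P. \<exists>k::nat. emeasure (N \<omega>) A = of_nat k"
proof -
  let ?E = "\<lambda>k. {\<omega>\<in>space P. emeasure (N \<omega>) A = of_nat k}"
  have E: "?E k \<in> sets P" for k using A by measurable
  have "(\<lambda>k. prob (?E k)) sums prob (\<Union>k. ?E k)"
    using E by (intro finite_measure_UNION) (auto simp: disjoint_family_on_def)
  moreover have "(\<lambda>k. exp (- measure m A) * (measure m A ^ k / fact k)) sums (exp (- measure m A) * exp (measure m A))"
    by (intro sums_mult Poisson_sums)
  ultimately have "prob (\<Union>k. ?E k) = exp (- measure m A) * exp (measure m A)"
    unfolding prob_count by (simp add: sums_unique2)
  then have "prob (\<Union>k. ?E k) = 1" by (simp add: exp_minus_inverse mult.commute)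
  then have "AE \<omega> in P. \<omega> \<in> (\<Union>k. ?E k)"
    using E by (subst AE_in_set_eq_1) auto
  then show ?thesis by eventually_elim auto
qed

lemma AE_count_finite: "AE \<omega> in P. emeasure (N \<omega>) A < \<infinity>"
  using AE_count_nat by eventually_elim (auto simp: ennreal_of_nat_eq_real_of_nat)

text \<open>The series carries the factor \<open>exp (measure m A)\<close> on its right side to fit
  \<open>Poisson_sums\<close>; the Poisson weight cancels it.\<close>

lemma nn_integral_count:
  fixes g :: "real \<Rightarrow> real"
  assumes [measurable]: "g \<in> borel_measurable borel" and "\<And>x. 0 \<le> g x"
    and s: "(\<lambda>k. g (real k) * (measure m A ^ k / fact k)) sums (l * exp (measure m A))"
  shows "(\<integral>\<^sup>+\<omega>. ennreal (g (measure (N \<omega>) A)) \<partial>P) = ennreal l"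
proof -
  let ?E = "\<lambda>k. {\<omega>\<in>space P. emeasure (N \<omega>) A = of_nat k}"
  have E [measurable]: "?E k \<in> sets P" for k using A by measurable
  have "(\<integral>\<^sup>+\<omega>. ennreal (g (measure (N \<omega>) A)) \<partial>P) =
    (\<integral>\<^sup>+\<omega>. (\<Sum>k. ennreal (g (real k)) * indicator (?E k) \<omega>) \<partial>P)"
  proof (rule nn_integral_cong_AE)
    show "AE \<omega> in P. ennreal (g (measure (N \<omega>) A)) = (\<Sum>k. ennreal (g (real k)) * indicator (?E k) \<omega>)"
      using AE_count_nat AE_space
    proof eventually_elim
      case (elim \<omega>)
      then obtain j where j: "emeasure (N \<omega>) A = of_nat j" by auto
      then have "measure (N \<omega>) A = real j" by (simp add: measure_def ennreal_of_nat_eq_real_of_nat)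
      moreover have "(\<Sum>k. ennreal (g (real k)) * indicator (?E k) \<omega>) =
        (\<Sum>k\<in>{j}. ennreal (g (real k)) * indicator (?E k) \<omega>)"
        using j by (intro suminf_finite) auto
      ultimately show ?case using elim j by simp
    qed
  qed
  also have "\<dots> = (\<Sum>k. ennreal (g (real k)) * emeasure P (?E k))"
    by (simp add: nn_integral_suminf nn_integral_cmult_indicator)
  also have "\<dots> = (\<Sum>k. ennreal (exp (- measure m A) * (g (real k) * (measure m A ^ k / fact k))))"
    unfolding emeasure_eq_measure prob_count
    by (intro suminf_cong) (simp add: ennreal_mult[symmetric] assms(2) mult_ac)
  also have "\<dots> = ennreal (exp (- measure m A) * (l * exp (measure m A)))"
    using sums_mult[OF s, of "exp (- measure m A)"] assms(2)
    by (intro suminf_ennreal_eq) auto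
  also have "exp (- measure m A) * (l * exp (measure m A)) = l"
    by (simp add: exp_minus field_simps)
  finally show ?thesis .
qed

lemma measurable_centered_count: "A \<subseteq> L \<Longrightarrow> centered_count A \<in> borel_measurable (history L)"
  unfolding centered_count_def measure_def
  using measurable_count_history[OF A(1)] by measurable

lemma measurable_centered_count' [measurable]: "centered_count A \<in> borel_measurable P"
  using measurable_historyD[OF measurable_centered_count[OF order_refl]] .

lemma square_integrable_centered_count: "square_integrable P (centered_count A)"
  and expectation_centered_count_sq: "expectation (\<lambda>\<omega>. (centered_count A \<omega>)\<^sup>2) = measure m A"
proof -
  have *: "(\<integral>\<^sup>+\<omega>. ennreal ((measure (N \<omega>) A - measure m A)\<^sup>2) \<partial>P) = ennreal (measure m A)"
    using Poisson_sums(3) by (intro nn_integral_count) auto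
  then show "square_integrable P (centered_count A)"
    unfolding square_integrable_iff_nn by (simp add: centered_count_def[symmetric])
  then show "expectation (\<lambda>\<omega>. (centered_count A \<omega>)\<^sup>2) = measure m A"
    using * by (subst integral_eq_nn_integral) (auto simp: centered_count_def[symmetric])
qed

lemma expectation_centered_count: "expectation (centered_count A) = 0"
proof -
  have i: "integrable P (centered_count A)"
    by (rule square_integrable_imp_integrable[OF square_integrable_centered_count])
  \<comment> \<open>The integrated function has to be non-negative on all reals, hence the
    \<open>max\<close>, which changes nothing on a measure.\<close>
  have "(\<integral>\<^sup>+\<omega>. ennreal (max 0 (measure (N \<omega>) A)) \<partial>P) = ennreal (measure m A)"
    using Poisson_sums(2) by (intro nn_integral_count) (auto simp: max_def)
  moreover have "(\<lambda>\<omega>. measure (N \<omega>) A) \<in> borel_measurable P"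
    using A unfolding measure_def by measurable
  ultimately have "expectation (\<lambda>\<omega>. measure (N \<omega>) A) = measure m A"
    by (subst integral_eq_nn_integral) auto
  moreover have "integrable P (\<lambda>\<omega>. centered_count A \<omega> + measure m A)"
    using i by simp
  ultimately show ?thesis
    unfolding centered_count_def by (subst Bochner_Integration.integral_diff) (auto simp: centered_count_def prob_space)
qed

end

lemma centered_count_Un:
  assumes "A \<in> sets m" "B \<in> sets m" "A \<inter> B = {}" "emeasure m A < \<infinity>" "emeasure m B < \<infinity>"
  shows "AE \<omega> in P. centered_count (A \<union> B) \<omega> = centered_count A \<omega> + centered_count B \<omega>"
  using AE_count_finite[OF assms(1,4)] AE_count_finite[OF assms(2,5)] AE_space
proof eventually_elim
  case (elim \<omega>)
  have "measure (N \<omega>) (A \<union> B) = measure (N \<omega>) A + measure (N \<omega>) B"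
    using elim assms sets_N by (intro measure_Union) auto
  moreover have "measure m (A \<union> B) = measure m A + measure m B"
    using assms by (intro measure_Union) auto
  ultimately show ?case by (simp add: centered_count_def)
qed

lemma expectation_centered_count_mult_disjoint:
  assumes "A \<in> sets m" "emeasure m A < \<infinity>" "B \<in> sets m" "emeasure m B < \<infinity>" "A \<inter> B = {}"
  shows "expectation (\<lambda>\<omega>. centered_count A \<omega> * centered_count B \<omega>) = 0"
  using expectation_mult_history(1)[OF assms(5) measurable_centered_count[OF assms(1,2) order_refl]
      measurable_centered_count[OF assms(3,4) order_refl]] assms
  by (simp add: expectation_centered_count square_integrable_imp_integrable square_integrable_centered_count)

text \<open>Both sets are split along \<open>A \<inter> B\<close>. Of the four products only the
  square over the intersection survives; the others pair disjoint sets and vanish by independence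
  and centring.\<close>

lemma expectation_centered_count_mult:
  assumes A: "A \<in> sets m" "emeasure m A < \<infinity>" and B: "B \<in> sets m" "emeasure m B < \<infinity>"
  shows "expectation (\<lambda>\<omega>. centered_count A \<omega> * centered_count B \<omega>) = measure m (A \<inter> B)"
proof -
  have AB: "A \<inter> B \<in> sets m" "A - B \<in> sets m" "B - A \<in> sets m" using A B by auto
  have fin: "emeasure m (A \<inter> B) < \<infinity>" "emeasure m (A - B) < \<infinity>" "emeasure m (B - A) < \<infinity>"
    using A B emeasure_mono[of "A \<inter> B" A m] emeasure_mono[of "A - B" A m] emeasure_mono[of "B - A" B m]
    by (auto simp: le_less_trans)
  let ?c = centered_count
  have "AE \<omega> in P. ?c ((A \<inter> B) \<union> (A - B)) \<omega> = ?c (A \<inter> B) \<omega> + ?c (A - B) \<omega>"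
    using AB fin by (intro centered_count_Un) auto
  moreover have "AE \<omega> in P. ?c ((A \<inter> B) \<union> (B - A)) \<omega> = ?c (A \<inter> B) \<omega> + ?c (B - A) \<omega>"
    using AB fin by (intro centered_count_Un) auto
  moreover have "(A \<inter> B) \<union> (A - B) = A" "(A \<inter> B) \<union> (B - A) = B" by auto
  ultimately have "AE \<omega> in P. ?c A \<omega> = ?c (A \<inter> B) \<omega> + ?c (A - B) \<omega>"
    "AE \<omega> in P. ?c B \<omega> = ?c (A \<inter> B) \<omega> + ?c (B - A) \<omega>" by auto
  then have ae: "AE \<omega> in P. ?c A \<omega> * ?c B \<omega> = (?c (A \<inter> B) \<omega>)\<^sup>2 + ?c (A \<inter> B) \<omega> * ?c (B - A) \<omega>
     + ?c (A - B) \<omega> * ?c (A \<inter> B) \<omega> + ?c (A - B) \<omega> * ?c (B - A) \<omega>"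
    by eventually_elim (simp add: power2_eq_square algebra_simps)
  note sq = square_integrable_centered_count[OF AB(1) fin(1)] square_integrable_centered_count[OF AB(2) fin(2)]
    square_integrable_centered_count[OF AB(3) fin(3)]
  note i = square_integrable_mult[OF sq(1,1)] square_integrable_mult[OF sq(1,3)] square_integrable_mult[OF sq(2,1)]
    square_integrable_mult[OF sq(2,3)]
  have "expectation (\<lambda>\<omega>. ?c A \<omega> * ?c B \<omega>) = expectation (\<lambda>\<omega>. (?c (A \<inter> B) \<omega>)\<^sup>2 + ?c (A \<inter> B) \<omega> * ?c (B - A) \<omega>
     + ?c (A - B) \<omega> * ?c (A \<inter> B) \<omega> + ?c (A - B) \<omega> * ?c (B - A) \<omega>)"
    using A B AB fin ae by (intro integral_cong_AE) auto
  also have "\<dots> = expectation (\<lambda>\<omega>. (?c (A \<inter> B) \<omega>)\<^sup>2) + expectation (\<lambda>\<omega>. ?c (A \<inter> B) \<omega> * ?c (B - A) \<omega>)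
     + expectation (\<lambda>\<omega>. ?c (A - B) \<omega> * ?c (A \<inter> B) \<omega>) + expectation (\<lambda>\<omega>. ?c (A - B) \<omega> * ?c (B - A) \<omega>)"
    using i by (simp add: power2_eq_square)
  also have "\<dots> = measure m (A \<inter> B)"
    using AB fin by (simp add: expectation_centered_count_sq expectation_centered_count_mult_disjoint Int_commute
        Diff_Int_distrib Diff_disjoint inf.left_commute)
  finally show ?thesis .
qed

end

section \<open>The compensated integral\<close>

definition finite_simple :: "'z measure \<Rightarrow> ('z \<Rightarrow> real) \<Rightarrow> bool" where
  "finite_simple m S \<longleftrightarrow> simple_function m S \<and> emeasure m {z\<in>space m. S z \<noteq> 0} < \<infinity>"

lemma finite_simple_diff:
  assumes "finite_simple m S" "finite_simple m T"
  shows "finite_simple m (\<lambda>z. S z - T z)"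
proof -
  have s: "simple_function m S" "simple_function m T" using assms by (auto simp: finite_simple_def)
  then have [measurable]: "S \<in> borel_measurable m" "T \<in> borel_measurable m"
    by (auto intro: borel_measurable_simple_function)
  have "emeasure m {z\<in>space m. S z - T z \<noteq> 0} \<le> emeasure m ({z\<in>space m. S z \<noteq> 0} \<union> {z\<in>space m. T z \<noteq> 0})"
    by (intro emeasure_mono) auto
  also have "\<dots> \<le> emeasure m {z\<in>space m. S z \<noteq> 0} + emeasure m {z\<in>space m. T z \<noteq> 0}"
    by (intro emeasure_subadditive) auto
  also have "\<dots> < \<infinity>" using assms by (auto simp: finite_simple_def)
  finally show ?thesis using s by (auto simp: finite_simple_def intro: simple_function_diff)
qed

lemma finite_simple_restrict:
  assumes "finite_simple m S" "L \<in> sets m"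
  shows "finite_simple m (\<lambda>z. S z * indicator L z)"
proof -
  have s: "simple_function m S" using assms by (auto simp: finite_simple_def)
  then have [measurable]: "S \<in> borel_measurable m"
    by (auto intro: borel_measurable_simple_function)
  have "emeasure m {z\<in>space m. S z * indicator L z \<noteq> 0} \<le> emeasure m {z\<in>space m. S z \<noteq> 0}"
    by (intro emeasure_mono) auto
  also have "\<dots> < \<infinity>" using assms by (auto simp: finite_simple_def)
  finally show ?thesis using s assms(2)
    by (auto simp: finite_simple_def intro: simple_function_mult simple_function_indicator)
qed

definition level :: "'z measure \<Rightarrow> ('z \<Rightarrow> real) \<Rightarrow> real \<Rightarrow> 'z set" where
  "level m S y = {z\<in>space m. S z = y}"

text \<open>Zero is excluded because the level set of 0 may have infinite measure, whereas all other
  level sets lie in the support.\<close>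

definition nz_values :: "'z measure \<Rightarrow> ('z \<Rightarrow> real) \<Rightarrow> real set" where
  "nz_values m S = S ` space m - {0}"

lemma level_sets: "finite_simple m S \<Longrightarrow> level m S y \<in> sets m"
proof -
  assume "finite_simple m S"
  then have "S -` {y} \<inter> space m \<in> sets m"
    by (intro simple_functionD(2)) (simp add: finite_simple_def)
  moreover have "S -` {y} \<inter> space m = level m S y" by (auto simp: level_def)
  ultimately show "level m S y \<in> sets m" by simp
qed

lemma level_finite:
  assumes "finite_simple m S" "y \<noteq> 0"
  shows "emeasure m (level m S y) < \<infinity>"
proof -
  have "S \<in> borel_measurable m" using assms by (auto simp: finite_simple_def intro: borel_measurable_simple_function)
  then have "emeasure m (level m S y) \<le> emeasure m {z\<in>space m. S z \<noteq> 0}"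
    using assms(2) by (intro emeasure_mono) (auto simp: level_def)
  with assms show ?thesis by (auto simp: finite_simple_def intro: le_less_trans)
qed

lemma finite_nz_values: "finite_simple m S \<Longrightarrow> finite (nz_values m S)"
  by (auto simp: nz_values_def finite_simple_def simple_function_def)

lemma finite_simple_eq_sum:
  assumes "finite_simple m S" "z \<in> space m"
  shows "S z = (\<Sum>y\<in>nz_values m S. y * indicator (level m S y) z)"
proof (cases "S z = 0")
  case True then show ?thesis
    by (auto simp: nz_values_def level_def indicator_def intro!: sum.neutral)
next
  case False
  then have "S z \<in> nz_values m S" using assms by (auto simp: nz_values_def)
  moreover have "(\<Sum>y\<in>nz_values m S. y * indicator (level m S y) z) = (\<Sum>y\<in>nz_values m S. if y = S z then y else 0)"
    using assms(2) by (intro sum.cong) (auto simp: level_def indicator_def)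
  ultimately show ?thesis using finite_nz_values[OF assms(1)] by (simp add: sum.delta)
qed

lemma finite_simple_integral:
  assumes "finite_simple m S"
  shows "(LINT z|m. S z) = (\<Sum>y\<in>nz_values m S. y * measure m (level m S y))"
proof -
  have "Bochner_Integration.simple_bochner_integrable m S"
    using assms by (auto intro!: simple_bochner_integrable.intros simp: finite_simple_def)
  then have "(LINT z|m. S z) = Bochner_Integration.simple_bochner_integral m S"
    by (rule simple_bochner_integrable_eq_integral[symmetric])
  also have "\<dots> = (\<Sum>y\<in>S ` space m. y * measure m (level m S y))"
    by (simp add: simple_bochner_integral_def level_def mult.commute)
  also have "\<dots> = (\<Sum>y\<in>nz_values m S. y * measure m (level m S y))"
    unfolding nz_values_def using assms
    by (intro sum.mono_neutral_right) (auto simp: finite_simple_def simple_function_def)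
  finally show ?thesis .
qed

lemma finite_simple_integral_mult:
  assumes S: "finite_simple m S" and T: "finite_simple m T"
  shows "(LINT z|m. S z * T z) =
    (\<Sum>y\<in>nz_values m S. \<Sum>y'\<in>nz_values m T. y * y' * measure m (level m S y \<inter> level m T y'))"
proof -
  have fin: "emeasure m (level m S y \<inter> level m T y') < \<infinity>" if "y \<in> nz_values m S" for y y'
    using level_finite[OF S, of y] emeasure_mono[of "level m S y \<inter> level m T y'" "level m S y" m]
      level_sets[OF S] that by (auto simp: nz_values_def intro: le_less_trans)
  have "(LINT z|m. S z * T z) =
    (LINT z|m. (\<Sum>y\<in>nz_values m S. \<Sum>y'\<in>nz_values m T. y * y' * indicator (level m S y \<inter> level m T y') z))"
    by (intro Bochner_Integration.integral_cong refl)
      (subst finite_simple_eq_sum[OF S], assumption, subst finite_simple_eq_sum[OF T], assumption,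
       simp add: sum_product indicator_inter_arith mult_ac)
  also have "\<dots> = (\<Sum>y\<in>nz_values m S. \<Sum>y'\<in>nz_values m T. (LINT z|m. y * y' * indicator (level m S y \<inter> level m T y') z))"
    using fin level_sets[OF S] level_sets[OF T]
    by (subst Bochner_Integration.integral_sum | intro Bochner_Integration.integrable_sum sum.cong refl
        integrable_mult_right integrable_real_indicator)+ auto
  also have "\<dots> = (\<Sum>y\<in>nz_values m S. \<Sum>y'\<in>nz_values m T. y * y' * measure m (level m S y \<inter> level m T y'))"
  proof -
    have "level m S y \<inter> level m T y' \<inter> space m = level m S y \<inter> level m T y'" for y y'
      by (auto simp: level_def)
    then show ?thesis by simp
  qed
  finally show ?thesis .
qed

lemma square_integrable_finite_simple:
  assumes "finite_simple m S" shows "square_integrable m S"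
proof -
  have ind: "(\<lambda>z. (indicator A z :: real)\<^sup>2) = indicator A" for A :: "'a set"
    by (auto simp: indicator_def)
  have "square_integrable m (\<lambda>z. \<Sum>y\<in>nz_values m S. y * indicator (level m S y) z)"
    using level_sets[OF assms] level_finite[OF assms]
    by (intro square_integrable_sum square_integrable_cmult)
      (auto simp: square_integrable_def nz_values_def ind)
  also have "?this \<longleftrightarrow> ?thesis"
    unfolding square_integrable_def
    by (intro conj_cong measurable_cong Bochner_Integration.integrable_cong refl)
       (simp_all add: finite_simple_eq_sum[OF assms, symmetric])
  finally show ?thesis .
qed

definition compensated :: "'z measure \<Rightarrow> 'z measure \<Rightarrow> ('z \<Rightarrow> real) \<Rightarrow> real" where
  "compensated n m S = (LINT z|n. S z) - (LINT z|m. S z)"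

context poisson_noise
begin

lemma compensated_finite_simple:
  assumes S: "finite_simple m S"
  shows "AE \<omega> in P. finite_simple (N \<omega>) S"
    and "AE \<omega> in P. compensated (N \<omega>) m S = (\<Sum>y\<in>nz_values m S. y * centered_count (level m S y) \<omega>)"
proof -
  have [measurable]: "S \<in> borel_measurable m"
    using S by (auto simp: finite_simple_def intro: borel_measurable_simple_function)
  have "{z\<in>space m. S z \<noteq> 0} \<in> sets m" by measurable
  then have "AE \<omega> in P. emeasure (N \<omega>) {z\<in>space m. S z \<noteq> 0} < \<infinity>"
    using S by (intro AE_count_finite) (auto simp: finite_simple_def)
  then show ae: "AE \<omega> in P. finite_simple (N \<omega>) S"
    using AE_space
  proof eventually_elim
    case (elim \<omega>)
    have "simple_function (N \<omega>) S"
      using S simple_function_cong_algebra[of "N \<omega>" m S] sets_N[OF elim(2)] space_N[OF elim(2)]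
      by (auto simp: finite_simple_def)
    then show ?case using elim space_N[OF elim(2)] by (simp add: finite_simple_def)
  qed
  show "AE \<omega> in P. compensated (N \<omega>) m S = (\<Sum>y\<in>nz_values m S. y * centered_count (level m S y) \<omega>)"
    using ae AE_space
  proof eventually_elim
    case (elim \<omega>)
    have "level (N \<omega>) S = level m S" "nz_values (N \<omega>) S = nz_values m S"
      using space_N[OF elim(2)] by (auto simp: level_def nz_values_def)
    then show ?case
      unfolding compensated_def finite_simple_integral[OF S] finite_simple_integral[OF elim(1)] centered_count_def
      by (simp add: sum_subtractf algebra_simps)
  qed
qed

text \<open>The pathwise integral need not be measurable on the null set where the count of its support
  is infinite, so its second moments are computed from this version.\<close>

definition simple_version :: "('z \<Rightarrow> real) \<Rightarrow> 'w \<Rightarrow> real" where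
  "simple_version S \<omega> = (\<Sum>y\<in>nz_values m S. y * centered_count (level m S y) \<omega>)"

lemma measurable_simple_version_history:
  assumes S: "finite_simple m S" and L: "\<And>z. z \<in> space m - L \<Longrightarrow> S z = 0"
  shows "simple_version S \<in> borel_measurable (history L)"
  unfolding simple_version_def
proof (intro borel_measurable_sum borel_measurable_times borel_measurable_const)
  fix y assume "y \<in> nz_values m S"
  then have "y \<noteq> 0" by (auto simp: nz_values_def)
  moreover have "level m S y \<subseteq> L" using L \<open>y \<noteq> 0\<close> by (auto simp: level_def)
  ultimately show "centered_count (level m S y) \<in> borel_measurable (history L)"
    using level_sets[OF S] level_finite[OF S] by (intro measurable_centered_count)
qed

lemma square_integrable_simple_version:
  assumes S: "finite_simple m S" shows "square_integrable P (simple_version S)"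
  unfolding simple_version_def using level_sets[OF S] level_finite[OF S]
  by (intro square_integrable_sum square_integrable_cmult square_integrable_centered_count) (auto simp: nz_values_def)

lemma expectation_simple_version:
  assumes S: "finite_simple m S" shows "expectation (simple_version S) = 0"
proof -
  have "expectation (simple_version S) = (\<Sum>y\<in>nz_values m S. expectation (\<lambda>\<omega>. y * centered_count (level m S y) \<omega>))"
    unfolding simple_version_def using level_sets[OF S] level_finite[OF S]
    by (intro Bochner_Integration.integral_sum integrable_mult_right
        square_integrable_imp_integrable square_integrable_centered_count) (auto simp: nz_values_def)
  also have "\<dots> = 0"
    using level_sets[OF S] level_finite[OF S]
    by (intro sum.neutral) (auto simp: nz_values_def expectation_centered_count)
  finally show ?thesis .
qed

lemma expectation_simple_version_mult:
  assumes S: "finite_simple m S" and T: "finite_simple m T"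
  shows "expectation (\<lambda>\<omega>. simple_version S \<omega> * simple_version T \<omega>) = (LINT z|m. S z * T z)"
proof -
  let ?c = "\<lambda>S y. centered_count (level m S y)"
  note l = level_sets[OF S] level_finite[OF S] level_sets[OF T] level_finite[OF T]
  have i: "integrable P (\<lambda>\<omega>. y * y' * (?c S y \<omega> * ?c T y' \<omega>))"
    if "y \<in> nz_values m S" "y' \<in> nz_values m T" for y y'
    using that l by (intro integrable_mult_right square_integrable_mult square_integrable_centered_count)
      (auto simp: nz_values_def)
  have "expectation (\<lambda>\<omega>. simple_version S \<omega> * simple_version T \<omega>) =
    expectation (\<lambda>\<omega>. \<Sum>y\<in>nz_values m S. \<Sum>y'\<in>nz_values m T. y * y' * (?c S y \<omega> * ?c T y' \<omega>))"
    unfolding simple_version_def by (simp add: sum_product mult_ac)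
  also have "\<dots> = (\<Sum>y\<in>nz_values m S. \<Sum>y'\<in>nz_values m T. expectation (\<lambda>\<omega>. y * y' * (?c S y \<omega> * ?c T y' \<omega>)))"
    using i by (simp add: Bochner_Integration.integral_sum Bochner_Integration.integrable_sum
        del: Bochner_Integration.integral_mult_right Bochner_Integration.integral_mult_right_zero)
  also have "\<dots> = (\<Sum>y\<in>nz_values m S. \<Sum>y'\<in>nz_values m T. y * y' * measure m (level m S y \<inter> level m T y'))"
    using l by (intro sum.cong refl) (auto simp: nz_values_def expectation_centered_count_mult)
  finally show ?thesis by (simp add: finite_simple_integral_mult[OF S T])
qed

lemma expectation_sq_simple_version:
  assumes "finite_simple m S"
  shows "expectation (\<lambda>\<omega>. (simple_version S \<omega>)\<^sup>2) = (LINT z|m. (S z)\<^sup>2)"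
  using expectation_simple_version_mult[OF assms assms] by (simp add: power2_eq_square)

text \<open>The expansion over level sets is not visibly additive, since a difference has other
  level sets. The pathwise integral is additive, and it agrees with the expansion almost
  surely.\<close>

lemma simple_version_diff:
  assumes S: "finite_simple m S" and T: "finite_simple m T"
  shows "AE \<omega> in P. simple_version (\<lambda>z. S z - T z) \<omega> = simple_version S \<omega> - simple_version T \<omega>"
  using compensated_finite_simple[OF S] compensated_finite_simple[OF T]
    compensated_finite_simple(2)[OF finite_simple_diff[OF S T]]
proof eventually_elim
  case (elim \<omega>)
  have i: "integrable M S" if "finite_simple M S" for M :: "'z measure" and S
    using that by (auto intro!: integrableI_simple_bochner_integrable simple_bochner_integrable.intros
        simp: finite_simple_def)
  have "compensated (N \<omega>) m (\<lambda>z. S z - T z) = compensated (N \<omega>) m S - compensated (N \<omega>) m T"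
    unfolding compensated_def using i[OF S] i[OF T] i[OF elim(1)] i[OF elim(3)] by simp
  with elim show ?case by (simp add: simple_version_def)
qed

text \<open>One sequence serves the integrand and the integral at once, so that restrictions and
  products can be carried out on simple functions and followed to both limits.\<close>

definition approximates :: "(nat \<Rightarrow> 'z \<Rightarrow> real) \<Rightarrow> ('z \<Rightarrow> real) \<Rightarrow> ('w \<Rightarrow> real) \<Rightarrow> bool" where
  "approximates S H I \<longleftrightarrow> (\<forall>n. finite_simple m (S n)) \<and> tendsto_L2 m S H \<and>
     tendsto_L2 P (\<lambda>n. simple_version (S n)) I"

lemma has_compensated_integralD:
  assumes "has_compensated_integral P N m H I"
  shows "\<exists>S. approximates S H I"
proof -
  obtain S where S: "\<And>n. finite_simple m (S n)"
    and H: "H \<in> borel_measurable m" "(\<lambda>n. \<integral>\<^sup>+z. ennreal ((S n z - H z)\<^sup>2) \<partial>m) \<longlonglongrightarrow> 0"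
    and I: "I \<in> borel_measurable P"
      "(\<lambda>n. \<integral>\<^sup>+\<omega>. ennreal ((compensated (N \<omega>) m (S n) - I \<omega>)\<^sup>2) \<partial>P) \<longlonglongrightarrow> 0"
    using assms unfolding has_compensated_integral_def finite_simple_def compensated_def by blast
  have "(\<integral>\<^sup>+\<omega>. ennreal ((compensated (N \<omega>) m (S n) - I \<omega>)\<^sup>2) \<partial>P) =
    (\<integral>\<^sup>+\<omega>. ennreal ((simple_version (S n) \<omega> - I \<omega>)\<^sup>2) \<partial>P)" for n
    using compensated_finite_simple(2)[OF S[of n]]
    by (intro nn_integral_cong_AE) (auto simp: simple_version_def)
  with I have "tendsto_L2 P (\<lambda>n. simple_version (S n)) I"
    using S by (intro tendsto_L2I square_integrable_simple_version) auto
  moreover have "tendsto_L2 m S H"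
    using S H by (intro tendsto_L2I square_integrable_finite_simple)
  ultimately show ?thesis using S by (auto simp: approximates_def)
qed

lemma approximates_diff:
  assumes a: "approximates S H I" and b: "approximates T H' I'"
  shows "approximates (\<lambda>n z. S n z - T n z) (\<lambda>z. H z - H' z) (\<lambda>\<omega>. I \<omega> - I' \<omega>)"
  unfolding approximates_def
proof (intro conjI allI)
  have S: "finite_simple m (S n)" "finite_simple m (T n)" for n using a b by (auto simp: approximates_def)
  then show fs: "finite_simple m (\<lambda>z. S n z - T n z)" for n by (rule finite_simple_diff)
  show "tendsto_L2 m (\<lambda>n z. S n z - T n z) (\<lambda>z. H z - H' z)"
    using a b by (intro tendsto_L2_diff) (auto simp: approximates_def)
  have t: "tendsto_L2 P (\<lambda>n \<omega>. simple_version (S n) \<omega> - simple_version (T n) \<omega>) (\<lambda>\<omega>. I \<omega> - I' \<omega>)"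
    using a b by (intro tendsto_L2_diff) (auto simp: approximates_def)
  have [measurable]: "simple_version (\<lambda>z. S n z - T n z) \<in> borel_measurable P"
    "simple_version (S n) \<in> borel_measurable P" "simple_version (T n) \<in> borel_measurable P" for n
    using square_integrable_simple_version fs S by (auto simp: square_integrable_def)
  have [measurable]: "I \<in> borel_measurable P" "I' \<in> borel_measurable P"
    using a b by (auto simp: approximates_def tendsto_L2_def square_integrable_def)
  have "(LINT \<omega>|P. (simple_version (\<lambda>z. S n z - T n z) \<omega> - (I \<omega> - I' \<omega>))\<^sup>2) =
    (LINT \<omega>|P. (simple_version (S n) \<omega> - simple_version (T n) \<omega> - (I \<omega> - I' \<omega>))\<^sup>2)" for n
    using simple_version_diff[OF S(1)[of n] S(2)[of n]] by (intro integral_cong_AE) auto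
  with t show "tendsto_L2 P (\<lambda>n. simple_version (\<lambda>z. S n z - T n z)) (\<lambda>\<omega>. I \<omega> - I' \<omega>)"
    unfolding tendsto_L2_def using square_integrable_simple_version[OF fs] by simp
qed

text \<open>Since \<open>H\<close> vanishes off \<open>L\<close>, the discarded part of
  \<open>S n\<close> is dominated there by the approximation error. It tends to 0 in
  \<open>L2(m)\<close>, and by the isometry for simple functions so does its integral.\<close>

lemma approximates_restrict:
  assumes a: "approximates S H I" and L: "L \<in> sets m" "\<And>z. z \<in> space m - L \<Longrightarrow> H z = 0"
  shows "approximates (\<lambda>n z. S n z * indicator L z) H I"
  unfolding approximates_def
proof (intro conjI allI)
  let ?S = "\<lambda>n z. S n z * indicator L z"
  let ?T = "\<lambda>n z. S n z * indicator (space m - L) z"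
  have S: "finite_simple m (S n)" and H: "square_integrable m H" for n
    using a by (auto simp: approximates_def tendsto_L2_def)
  have S': "finite_simple m (?S n)" "finite_simple m (?T n)" for n
    using finite_simple_restrict[OF S] L by auto
  then show "finite_simple m (?S n)" for n by auto
  have sq: "square_integrable m (?S n)" "square_integrable m (?T n)" "square_integrable m (S n)" for n
    using S S' by (auto intro: square_integrable_finite_simple)
  have lim: "(\<lambda>n. LINT z|m. (S n z - H z)\<^sup>2) \<longlonglongrightarrow> 0" using a by (auto simp: approximates_def tendsto_L2_def)
  have "(LINT z|m. (?S n z - H z)\<^sup>2) \<le> (LINT z|m. (S n z - H z)\<^sup>2)" for n
    using L square_integrable_diff[OF sq(1) H] square_integrable_diff[OF sq(3) H]
    by (intro integral_mono) (auto simp: square_integrable_def indicator_def)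
  then have "(\<lambda>n. LINT z|m. (?S n z - H z)\<^sup>2) \<longlonglongrightarrow> 0"
    by (intro tendsto_sandwich[OF _ _ tendsto_const lim]) auto
  then show "tendsto_L2 m ?S H" using sq H by (auto simp: tendsto_L2_def)
  have "(LINT z|m. (?T n z)\<^sup>2) \<le> (LINT z|m. (S n z - H z)\<^sup>2)" for n
    using L square_integrable_diff[OF sq(3) H] sq(2)[of n]
    by (intro integral_mono) (auto simp: square_integrable_def indicator_def)
  then have "(\<lambda>n. LINT z|m. (?T n z)\<^sup>2) \<longlonglongrightarrow> 0"
    by (intro tendsto_sandwich[OF _ _ tendsto_const lim]) auto
  then have T: "tendsto_L2 P (\<lambda>n. simple_version (?T n)) (\<lambda>_. 0)"
    using S' square_integrable_simple_version
    by (auto simp: tendsto_L2_def expectation_sq_simple_version square_integrable_const)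
  have t: "tendsto_L2 P (\<lambda>n \<omega>. simple_version (S n) \<omega> - simple_version (?T n) \<omega>) (\<lambda>\<omega>. I \<omega> - 0)"
    using a by (intro tendsto_L2_diff T) (auto simp: approximates_def)
  have [measurable]: "simple_version (S n) \<in> borel_measurable P"
    "simple_version (?S n) \<in> borel_measurable P" "simple_version (?T n) \<in> borel_measurable P" for n
    using square_integrable_simple_version S S' by (auto simp: square_integrable_def)
  have [measurable]: "I \<in> borel_measurable P"
    using a by (auto simp: approximates_def tendsto_L2_def square_integrable_def)
  have ae: "AE \<omega> in P. simple_version (?S n) \<omega> = simple_version (S n) \<omega> - simple_version (?T n) \<omega>" for n
  proof -
    have "simple_version (\<lambda>z. S n z - ?T n z) = simple_version (?S n)"
    proof -
      have "S n z - ?T n z = ?S n z" if "z \<in> space m" for z using that by (auto simp: indicator_def)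
      then have "level m (\<lambda>z. S n z - ?T n z) = level m (?S n)" "nz_values m (\<lambda>z. S n z - ?T n z) = nz_values m (?S n)"
        by (auto simp: level_def nz_values_def intro!: ext image_cong)
      then show ?thesis by (simp add: simple_version_def fun_eq_iff)
    qed
    with simple_version_diff[OF S S'(2)[of n], of n] show ?thesis by simp
  qed
  have "(LINT \<omega>|P. (simple_version (?S n) \<omega> - I \<omega>)\<^sup>2) =
    (LINT \<omega>|P. (simple_version (S n) \<omega> - simple_version (?T n) \<omega> - (I \<omega> - 0))\<^sup>2)" for n
  proof (rule integral_cong_AE)
    show "AE \<omega> in P. (simple_version (?S n) \<omega> - I \<omega>)\<^sup>2 =
      (simple_version (S n) \<omega> - simple_version (?T n) \<omega> - (I \<omega> - 0))\<^sup>2"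
      using ae[of n] by eventually_elim simp
  qed auto
  with t show "tendsto_L2 P (\<lambda>n. simple_version (?S n)) I"
    unfolding tendsto_L2_def using square_integrable_simple_version[OF S'(1)] by simp
qed

lemma approximates_measurable: "approximates S H I \<Longrightarrow> square_integrable P I"
  by (auto simp: approximates_def tendsto_L2_def)

context
  fixes L and Z :: "'w \<Rightarrow> real" and c :: real
  assumes L: "L \<in> sets m"
    and Z: "Z \<in> borel_measurable (history L)" "\<And>\<omega>. \<omega> \<in> space P \<Longrightarrow> \<bar>Z \<omega>\<bar> \<le> c"
begin

lemma measurable_Z: "Z \<in> borel_measurable P"
  using measurable_historyD[OF Z(1)] .

lemma integrable_Z: "integrable P Z"
  using Z(2) by (intro integrable_const_bound[of _ c] measurable_Z) auto

text \<open>An integrand that vanishes on \<open>L\<close> can be approximated off \<open>L\<close>,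
  where the simple integrals are independent of everything in \<open>history L\<close>, in
  particular of \<open>Z\<close>.\<close>

lemma approximates_off:
  assumes "approximates S H I" "\<And>z. z \<in> L \<Longrightarrow> H z = 0"
  obtains S' where "approximates S' H I" "\<And>n. finite_simple m (S' n)"
    "\<And>n. simple_version (S' n) \<in> borel_measurable (history (space m - L))"
proof -
  have a: "approximates (\<lambda>n z. S n z * indicator (space m - L) z) H I" (is "approximates ?S H I")
    using L assms by (intro approximates_restrict) auto
  then have f: "finite_simple m (?S n)" for n by (auto simp: approximates_def)
  have "simple_version (?S n) \<in> borel_measurable (history (space m - L))" for n
    using f[of n] by (rule measurable_simple_version_history) auto
  with a f show ?thesis using that by blast
qed

lemma expectation_mult_compensated:
  assumes "approximates S H I" "\<And>z. z \<in> L \<Longrightarrow> H z = 0"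
  shows "expectation (\<lambda>\<omega>. Z \<omega> * I \<omega>) = 0"
proof -
  obtain S' where a: "approximates S' H I" and f: "\<And>n. finite_simple m (S' n)"
    and m: "\<And>n. simple_version (S' n) \<in> borel_measurable (history (space m - L))"
    using approximates_off[OF assms] by blast
  have "(\<lambda>n. expectation (\<lambda>\<omega>. Z \<omega> * simple_version (S' n) \<omega>)) \<longlonglongrightarrow> expectation (\<lambda>\<omega>. Z \<omega> * I \<omega>)"
    using a by (intro tendsto_L2_expectation tendsto_L2_bounded_mult[OF _ measurable_Z Z(2)])
      (auto simp: approximates_def)
  moreover have "expectation (\<lambda>\<omega>. Z \<omega> * simple_version (S' n) \<omega>) = 0" for n
    using expectation_mult_history(1)[OF _ Z(1) m[of n] integrable_Z]
      square_integrable_imp_integrable[OF square_integrable_simple_version[OF f[of n]]]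
      expectation_simple_version[OF f[of n]] by auto
  ultimately show ?thesis using LIMSEQ_unique[OF _ tendsto_const] by fastforce
qed

text \<open>Both integrals live off \<open>L\<close>, so \<open>Z\<close> separates from their
  product before the limit; boundedness of \<open>Z\<close> lets the weighted products pass to the
  limit.\<close>

lemma expectation_mult_compensated_mult:
  assumes "approximates S H I" "\<And>z. z \<in> L \<Longrightarrow> H z = 0"
    and "approximates T H' I'" "\<And>z. z \<in> L \<Longrightarrow> H' z = 0"
  shows "expectation (\<lambda>\<omega>. Z \<omega> * (I \<omega> * I' \<omega>)) = expectation Z * (LINT z|m. H z * H' z)"
proof -
  obtain S' where a: "approximates S' H I" and f: "\<And>n. finite_simple m (S' n)"
    and m: "\<And>n. simple_version (S' n) \<in> borel_measurable (history (space m - L))"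
    using approximates_off[OF assms(1,2)] by blast
  obtain T' where a': "approximates T' H' I'" and f': "\<And>n. finite_simple m (T' n)"
    and m': "\<And>n. simple_version (T' n) \<in> borel_measurable (history (space m - L))"
    using approximates_off[OF assms(3,4)] by blast
  have "(\<lambda>n. expectation (\<lambda>\<omega>. (Z \<omega> * simple_version (S' n) \<omega>) * simple_version (T' n) \<omega>))
    \<longlonglongrightarrow> expectation (\<lambda>\<omega>. (Z \<omega> * I \<omega>) * I' \<omega>)"
    using a a' by (intro tendsto_L2_inner tendsto_L2_bounded_mult[OF _ measurable_Z Z(2)])
      (auto simp: approximates_def)
  moreover have "expectation (\<lambda>\<omega>. (Z \<omega> * simple_version (S' n) \<omega>) * simple_version (T' n) \<omega>) =
    expectation Z * (LINT z|m. S' n z * T' n z)" for n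
  proof -
    have "expectation (\<lambda>\<omega>. Z \<omega> * (simple_version (S' n) \<omega> * simple_version (T' n) \<omega>)) =
      expectation Z * expectation (\<lambda>\<omega>. simple_version (S' n) \<omega> * simple_version (T' n) \<omega>)"
      using m[of n] m'[of n] f[of n] f'[of n]
      by (intro expectation_mult_history(1)[OF _ Z(1) _ integrable_Z, of "space m - L"]
          square_integrable_mult square_integrable_simple_version borel_measurable_times) auto
    then show ?thesis by (simp add: expectation_simple_version_mult[OF f f'] mult.assoc)
  qed
  moreover have "(\<lambda>n. expectation Z * (LINT z|m. S' n z * T' n z)) \<longlonglongrightarrow> expectation Z * (LINT z|m. H z * H' z)"
    using a a' by (intro tendsto_mult tendsto_const tendsto_L2_inner) (auto simp: approximates_def)
  ultimately show ?thesis using LIMSEQ_unique by (fastforce simp: mult.assoc)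
qed

text \<open>Here the first integral lives on \<open>L\<close> and may depend on \<open>Z\<close>.
  Independence is applied between \<open>Z * I\<close> and the centred integral \<open>I'\<close>
  off \<open>L\<close>.\<close>

lemma expectation_mult_compensated_orthogonal:
  assumes "approximates S H I" "\<And>z. z \<in> space m - L \<Longrightarrow> H z = 0"
    and "approximates T H' I'" "\<And>z. z \<in> L \<Longrightarrow> H' z = 0"
  shows "expectation (\<lambda>\<omega>. Z \<omega> * (I \<omega> * I' \<omega>)) = 0"
proof -
  let ?S = "\<lambda>n z. S n z * indicator L z"
  have a: "approximates ?S H I"
    using L assms by (intro approximates_restrict) auto
  then have f: "finite_simple m (?S n)" for n by (auto simp: approximates_def)
  then have m: "simple_version (?S n) \<in> borel_measurable (history L)" for n
    by (rule measurable_simple_version_history) auto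
  obtain T' where a': "approximates T' H' I'" and f': "\<And>n. finite_simple m (T' n)"
    and m': "\<And>n. simple_version (T' n) \<in> borel_measurable (history (space m - L))"
    using approximates_off[OF assms(3,4)] by blast
  have "(\<lambda>n. expectation (\<lambda>\<omega>. (Z \<omega> * simple_version (?S n) \<omega>) * simple_version (T' n) \<omega>))
    \<longlonglongrightarrow> expectation (\<lambda>\<omega>. (Z \<omega> * I \<omega>) * I' \<omega>)"
    using a a' by (intro tendsto_L2_inner tendsto_L2_bounded_mult[OF _ measurable_Z Z(2)])
      (auto simp: approximates_def)
  moreover have "expectation (\<lambda>\<omega>. (Z \<omega> * simple_version (?S n) \<omega>) * simple_version (T' n) \<omega>) = 0" for n
  proof -
    have "integrable P (\<lambda>\<omega>. Z \<omega> * simple_version (?S n) \<omega>)"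
      by (intro square_integrable_imp_integrable square_integrable_bounded_mult[OF _ measurable_Z Z(2)]
          square_integrable_simple_version f)
    moreover have "(\<lambda>\<omega>. Z \<omega> * simple_version (?S n) \<omega>) \<in> borel_measurable (history L)"
      using Z(1) m by auto
    ultimately have "expectation (\<lambda>\<omega>. (Z \<omega> * simple_version (?S n) \<omega>) * simple_version (T' n) \<omega>) =
      expectation (\<lambda>\<omega>. Z \<omega> * simple_version (?S n) \<omega>) * expectation (simple_version (T' n))"
      using square_integrable_imp_integrable[OF square_integrable_simple_version[OF f'[of n]]]
      by (intro expectation_mult_history(1)[OF _ _ m'[of n]]) auto
    then show ?thesis by (simp add: expectation_simple_version[OF f'])
  qed
  ultimately show ?thesis using LIMSEQ_unique[OF _ tendsto_const] by (fastforce simp: mult.assoc)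
qed

end

end

section \<open>The energy form of the kernel\<close>

text \<open>On a bounded interval the weight \<open>(1 + x^2) powr (- k)\<close> is bounded below by
  its value at the endpoint.\<close>

lemma tempered_locally_integrable:
  assumes "tempered g"
  shows "(\<integral>\<^sup>+x\<in>{-r..r}. g x \<partial>lborel) < \<infinity>"
proof -
  obtain k where k: "k > 0" "(\<integral>\<^sup>+x. g x * ennreal ((1 + \<bar>x\<bar>\<^sup>2) powr (- k)) \<partial>lborel) < \<infinity>"
    and [measurable]: "g \<in> borel_measurable borel"
    using assms by (auto simp: tempered_def)
  let ?w = "\<lambda>x::real. (1 + \<bar>x\<bar>\<^sup>2) powr (- k)"
  have "(\<integral>\<^sup>+x\<in>{-r..r}. g x \<partial>lborel) \<le> (\<integral>\<^sup>+x. ennreal ((1 + r\<^sup>2) powr k) * (g x * ennreal (?w x)) \<partial>lborel)"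
  proof (rule nn_integral_mono)
    fix x :: real
    show "g x * indicator {-r..r} x \<le> ennreal ((1 + r\<^sup>2) powr k) * (g x * ennreal (?w x))"
    proof (cases "x \<in> {-r..r}")
      case True
      then have "\<bar>x\<bar>\<^sup>2 \<le> r\<^sup>2" by (auto simp: abs_le_square_iff[symmetric])
      then have "(1 + \<bar>x\<bar>\<^sup>2) powr k \<le> (1 + r\<^sup>2) powr k" using k by (intro powr_mono2) auto
      moreover have "0 < 1 + \<bar>x\<bar>\<^sup>2" by (simp add: add_pos_nonneg)
      ultimately have "1 \<le> (1 + r\<^sup>2) powr k * ?w x"
        by (simp add: powr_minus divide_inverse[symmetric])
      then have "ennreal 1 \<le> ennreal ((1 + r\<^sup>2) powr k * ?w x)" by (rule ennreal_leI)
      then have "g x * 1 \<le> g x * (ennreal ((1 + r\<^sup>2) powr k) * ennreal (?w x))"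
        by (intro mult_left_mono) (auto simp: ennreal_mult)
      then show ?thesis using True by (simp add: mult_ac)
    qed simp
  qed
  also have "\<dots> = ennreal ((1 + r\<^sup>2) powr k) * (\<integral>\<^sup>+x. g x * ennreal (?w x) \<partial>lborel)"
    by (rule nn_integral_cmult) measurable
  also have "\<dots> < \<infinity>" using k by (simp add: ennreal_mult_less_top)
  finally show ?thesis .
qed

text \<open>The shape in which Cauchy-Schwarz delivers convergence: the square of a mixed energy
  against a vanishing energy times a fixed finite one.\<close>

lemma ennreal_tendsto_0_if_square:
  fixes X Y :: "nat \<Rightarrow> ennreal"
  assumes le: "\<And>n. X n ^ 2 \<le> Y n * c" and Y: "Y \<longlonglongrightarrow> 0" and c: "c < \<infinity>"
  shows "X \<longlonglongrightarrow> 0"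
proof (rule order_tendstoI)
  fix e :: ennreal assume e: "0 < e"
  have "(\<lambda>n. Y n * c) \<longlonglongrightarrow> 0 * c"
    using c by (intro tendsto_mult_ennreal Y tendsto_const) auto
  moreover have "0 < e ^ 2" using e by (simp add: power2_eq_square ennreal_zero_less_mult_iff)
  ultimately have "eventually (\<lambda>n. Y n * c < e ^ 2) sequentially"
    by (intro order_tendstoD(2)[of _ 0]) auto
  then show "eventually (\<lambda>n. X n < e) sequentially"
  proof eventually_elim
    case (elim n)
    show ?case
    proof (rule ccontr)
      assume "\<not> X n < e"
      then have "e ^ 2 \<le> X n ^ 2" by (intro power_mono) auto
      with le[of n] elim show False by auto
    qed
  qed
qed auto

lemma sigma_finite_lborel_pair: "sigma_finite_measure (lborel \<Otimes>\<^sub>M lborel :: (real \<times> real) measure)"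
  unfolding lborel_prod by (rule sigma_finite_lborel)

locale correlation_kernel =
  fixes \<kappa> :: "real \<Rightarrow> ennreal"
  assumes kernel_sym: "\<kappa> (- x) = \<kappa> x"
    and kernel_finite: "x \<noteq> 0 \<Longrightarrow> \<kappa> x < \<infinity>"
    and tempered_kernel: "tempered \<kappa>"
    and tempered_corr: "tempered (autocorrelation \<kappa>)"
    and corr_finite: "x \<noteq> 0 \<Longrightarrow> autocorrelation \<kappa> x < \<infinity>"
    and corr_sym: "autocorrelation \<kappa> (- x) = autocorrelation \<kappa> x"
begin

abbreviation f :: "real \<Rightarrow> ennreal" where "f \<equiv> autocorrelation \<kappa>"

text \<open>At the origin \<open>f\<close> may be infinite, and \<open>fr\<close> is then 0 there.
  Since the diagonal is a null set, double integrals do not see the difference.\<close>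

definition fr :: "real \<Rightarrow> real" where "fr x = enn2real (f x)"

lemma kernel_measurable [measurable]: "\<kappa> \<in> borel_measurable borel"
  using tempered_kernel by (simp add: tempered_def)

lemma corr_measurable [measurable]: "f \<in> borel_measurable borel"
  using tempered_corr by (simp add: tempered_def)

lemma fr_measurable [measurable]: "fr \<in> borel_measurable borel"
  unfolding fr_def by measurable

lemma fr_nonneg [simp]: "0 \<le> fr x" by (simp add: fr_def)

lemma ennreal_fr: "x \<noteq> 0 \<Longrightarrow> ennreal (fr x) = f x"
  using corr_finite[of x] by (simp add: fr_def)

lemma fr_sym: "fr (- x) = fr x" by (simp add: fr_def corr_sym)

lemma corr_eq: "(\<integral>\<^sup>+x. \<kappa> (x - y) * \<kappa> (x - y') \<partial>lborel) = f (y - y')"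
proof -
  have "f (y - y') = (\<integral>\<^sup>+v. \<kappa> (y - y' - v) * \<kappa> (- (- v)) \<partial>lborel)"
    by (simp add: autocorrelation_def kernel_sym)
  also have "\<dots> = (\<integral>\<^sup>+x. \<kappa> (y - y' - (y + (- 1) * x)) * \<kappa> (y + (- 1) * x) \<partial>lborel)"
    by (subst nn_integral_real_affine[where c="- 1" and t=y]) auto
  also have "\<dots> = (\<integral>\<^sup>+x. \<kappa> (x - y) * \<kappa> (x - y') \<partial>lborel)"
  proof (rule nn_integral_cong)
    fix x :: real
    have "\<kappa> (y - y' - (y + (- 1) * x)) = \<kappa> (x - y')" by simp
    moreover have "\<kappa> (y + (- 1) * x) = \<kappa> (x - y)" using kernel_sym[of "x - y"] by simp
    ultimately show "\<kappa> (y - y' - (y + (- 1) * x)) * \<kappa> (y + (- 1) * x) = \<kappa> (x - y) * \<kappa> (x - y')"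
      by (simp add: mult.commute)
  qed
  finally show ?thesis by simp
qed

text \<open>The form is positive definite because the correlation is the square of the kernel; this identity
  is the source of its Cauchy-Schwarz inequality.\<close>

lemma corr_form_eq:
  assumes [measurable]: "a \<in> borel_measurable borel" "b \<in> borel_measurable borel"
  shows "(\<integral>\<^sup>+y. \<integral>\<^sup>+y'. a y * b y' * f (y - y') \<partial>lborel \<partial>lborel) =
    (\<integral>\<^sup>+x. (\<integral>\<^sup>+y. a y * \<kappa> (x - y) \<partial>lborel) * (\<integral>\<^sup>+y. b y * \<kappa> (x - y) \<partial>lborel) \<partial>lborel)"
proof -
  have "(\<integral>\<^sup>+y. \<integral>\<^sup>+y'. a y * b y' * f (y - y') \<partial>lborel \<partial>lborel) =
    (\<integral>\<^sup>+y. \<integral>\<^sup>+y'. \<integral>\<^sup>+x. a y * b y' * (\<kappa> (x - y) * \<kappa> (x - y')) \<partial>lborel \<partial>lborel \<partial>lborel)"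
    unfolding corr_eq[symmetric] by (intro nn_integral_cong nn_integral_cmult[symmetric]) measurable
  also have "\<dots> = (\<integral>\<^sup>+y. \<integral>\<^sup>+x. \<integral>\<^sup>+y'. a y * b y' * (\<kappa> (x - y) * \<kappa> (x - y')) \<partial>lborel \<partial>lborel \<partial>lborel)"
    by (intro nn_integral_cong lborel_pair.Fubini') measurable
  also have "\<dots> = (\<integral>\<^sup>+x. \<integral>\<^sup>+y. \<integral>\<^sup>+y'. a y * b y' * (\<kappa> (x - y) * \<kappa> (x - y')) \<partial>lborel \<partial>lborel \<partial>lborel)"
    by (intro lborel_pair.Fubini') measurable
  also have "\<dots> = (\<integral>\<^sup>+x. \<integral>\<^sup>+y. \<integral>\<^sup>+y'. (a y * \<kappa> (x - y)) * (b y' * \<kappa> (x - y')) \<partial>lborel \<partial>lborel \<partial>lborel)"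
    by (simp add: mult_ac)
  also have "\<dots> = (\<integral>\<^sup>+x. \<integral>\<^sup>+y. (a y * \<kappa> (x - y)) * (\<integral>\<^sup>+y'. b y' * \<kappa> (x - y') \<partial>lborel) \<partial>lborel \<partial>lborel)"
    by (intro nn_integral_cong nn_integral_cmult) measurable
  also have "\<dots> = (\<integral>\<^sup>+x. (\<integral>\<^sup>+y. a y * \<kappa> (x - y) \<partial>lborel) * (\<integral>\<^sup>+y. b y * \<kappa> (x - y) \<partial>lborel) \<partial>lborel)"
    by (intro nn_integral_cong nn_integral_multc) measurable
  finally show ?thesis .
qed

section \<open>Local mass of the correlation\<close>

definition corr_mass :: "real \<Rightarrow> ennreal" where
  "corr_mass r = (\<integral>\<^sup>+x\<in>{-r..r}. f x \<partial>lborel)"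

lemma corr_mass_finite: "corr_mass r < \<infinity>"
  unfolding corr_mass_def by (rule tempered_locally_integrable[OF tempered_corr])

lemma corr_shift_le:
  assumes "\<And>y'. y' \<in> B \<Longrightarrow> \<bar>y - y'\<bar> \<le> r" "B \<in> sets borel"
  shows "(\<integral>\<^sup>+y'. indicator B y' * f (y - y') \<partial>lborel) \<le> corr_mass r"
proof -
  have "(\<integral>\<^sup>+y'. indicator B y' * f (y - y') \<partial>lborel) \<le> (\<integral>\<^sup>+y'. f (y - y') * indicator {-r..r} (y - y') \<partial>lborel)"
    using assms(1) by (intro nn_integral_mono) (force simp: indicator_def abs_le_iff)
  also have "\<dots> = corr_mass r"
    unfolding corr_mass_def
    by (subst (2) nn_integral_real_affine[where c="- 1" and t=y]) auto
  finally show ?thesis .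
qed

lemma corr_box_le:
  assumes "\<And>y y'. y \<in> A \<Longrightarrow> y' \<in> B \<Longrightarrow> \<bar>y - y'\<bar> \<le> r" "A \<in> sets borel" "B \<in> sets borel"
  shows "(\<integral>\<^sup>+y. \<integral>\<^sup>+y'. indicator A y * indicator B y' * f (y - y') \<partial>lborel \<partial>lborel)
    \<le> emeasure lborel A * corr_mass r"
proof -
  have "(\<integral>\<^sup>+y. \<integral>\<^sup>+y'. indicator A y * indicator B y' * f (y - y') \<partial>lborel \<partial>lborel) \<le>
    (\<integral>\<^sup>+y. corr_mass r * indicator A y \<partial>lborel)"
  proof (rule nn_integral_mono)
    fix y
    show "(\<integral>\<^sup>+y'. indicator A y * indicator B y' * f (y - y') \<partial>lborel) \<le> corr_mass r * indicator A y"
      using corr_shift_le[of B y r] assms by (cases "y \<in> A") auto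
  qed
  also have "\<dots> = emeasure lborel A * corr_mass r"
    using assms by (subst nn_integral_cmult_indicator) (simp_all add: mult.commute)
  finally show ?thesis .
qed

text \<open>The parameter \<open>q\<close> will run over probability and time. With absolute values
  inside, as in the Walsh norm, the quantity is monotone in the moduli and bounds the signed
  \<open>form\<close>, whose integrability it decides.\<close>

definition enform :: "'q measure \<Rightarrow> ('q \<Rightarrow> real \<Rightarrow> real) \<Rightarrow> ('q \<Rightarrow> real \<Rightarrow> real) \<Rightarrow> ennreal" where
  "enform Q a b = (\<integral>\<^sup>+q. \<integral>\<^sup>+y. \<integral>\<^sup>+y'. ennreal \<bar>a q y * b q y'\<bar> * f (y - y') \<partial>lborel \<partial>lborel \<partial>Q)"

definition form :: "'q measure \<Rightarrow> ('q \<Rightarrow> real \<Rightarrow> real) \<Rightarrow> ('q \<Rightarrow> real \<Rightarrow> real) \<Rightarrow> real" where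
  "form Q a b = (LINT (q, y, y')|(Q \<Otimes>\<^sub>M (lborel \<Otimes>\<^sub>M lborel)). a q y * b q y' * fr (y - y'))"

abbreviation meas2 :: "'q measure \<Rightarrow> ('q \<Rightarrow> real \<Rightarrow> real) \<Rightarrow> bool" where
  "meas2 Q a \<equiv> case_prod a \<in> borel_measurable (Q \<Otimes>\<^sub>M lborel)"

lemma inner_eq_fr:
  assumes [measurable]: "c \<in> borel_measurable borel"
  shows "(\<integral>\<^sup>+y'. ennreal (c y') * f (y - y') \<partial>lborel) = (\<integral>\<^sup>+y'. ennreal (c y') * ennreal (fr (y - y')) \<partial>lborel)"
  using AE_lborel_singleton[of y] by (intro nn_integral_cong_AE) (auto simp: ennreal_fr)

lemma form_measurable:
  assumes [measurable]: "meas2 Q a" "meas2 Q b"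
  shows "(\<lambda>(q, y, y'). a q y * b q y' * fr (y - y')) \<in> borel_measurable (Q \<Otimes>\<^sub>M (lborel \<Otimes>\<^sub>M lborel))"
  by measurable

lemma enform_eq:
  assumes [measurable]: "meas2 Q a" "meas2 Q b"
  shows "enform Q a b = (\<integral>\<^sup>+(q, y, y'). ennreal \<bar>a q y * b q y' * fr (y - y')\<bar> \<partial>(Q \<Otimes>\<^sub>M (lborel \<Otimes>\<^sub>M lborel)))"
proof -
  have "enform Q a b = (\<integral>\<^sup>+q. \<integral>\<^sup>+y. \<integral>\<^sup>+y'. ennreal \<bar>a q y * b q y' * fr (y - y')\<bar> \<partial>lborel \<partial>lborel \<partial>Q)"
    unfolding enform_def
  proof (rule nn_integral_cong, rule nn_integral_cong)
    fix q y assume "q \<in> space Q"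
    then have [measurable]: "b q \<in> borel_measurable borel" by measurable
    show "(\<integral>\<^sup>+y'. ennreal \<bar>a q y * b q y'\<bar> * f (y - y') \<partial>lborel) = (\<integral>\<^sup>+y'. ennreal \<bar>a q y * b q y' * fr (y - y')\<bar> \<partial>lborel)"
      by (subst inner_eq_fr) (auto simp: abs_mult ennreal_mult)
  qed
  also have "\<dots> = (\<integral>\<^sup>+q. \<integral>\<^sup>+p. ennreal \<bar>a q (fst p) * b q (snd p) * fr (fst p - snd p)\<bar> \<partial>(lborel \<Otimes>\<^sub>M lborel) \<partial>Q)"
    by (intro nn_integral_cong, subst lborel.nn_integral_fst[symmetric]) auto
  also have "\<dots> = (\<integral>\<^sup>+(q, y, y'). ennreal \<bar>a q y * b q y' * fr (y - y')\<bar> \<partial>(Q \<Otimes>\<^sub>M (lborel \<Otimes>\<^sub>M lborel)))"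
    by (subst sigma_finite_measure.nn_integral_fst[OF sigma_finite_lborel_pair, symmetric]) (auto simp: case_prod_beta')
  finally show ?thesis .
qed

lemma enform_le_form:
  assumes [measurable]: "meas2 Q a" "meas2 Q b"
  shows "ennreal \<bar>form Q a b\<bar> \<le> enform Q a b"
proof (cases "integrable (Q \<Otimes>\<^sub>M (lborel \<Otimes>\<^sub>M lborel)) (\<lambda>(q, y, y'). a q y * b q y' * fr (y - y'))")
  case True
  from integral_norm_bound_ennreal[OF this] show ?thesis
    unfolding enform_eq[OF assms] form_def by (simp add: case_prod_beta')
next
  case False then show ?thesis by (simp add: form_def not_integrable_integral_eq)
qed

lemma form_integrable:
  assumes [measurable]: "meas2 Q a" "meas2 Q b" and fin: "enform Q a b < \<infinity>"
  shows "integrable (Q \<Otimes>\<^sub>M (lborel \<Otimes>\<^sub>M lborel)) (\<lambda>(q, y, y'). a q y * b q y' * fr (y - y'))"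
  using fin form_measurable[OF assms(1,2)] unfolding enform_eq[OF assms(1,2)] integrable_iff_bounded
  by (simp add: case_prod_beta')

text \<open>Convolving the modulus with \<open>\<kappa>\<close> turns the energy into an ordinary
  \<open>L2\<close> inner product over \<open>Q\<close> and space, where the classical inequality
  applies.\<close>

lemma enform_Cauchy_Schwarz:
  assumes [measurable]: "meas2 Q a" "meas2 Q b"
  shows "enform Q a b ^ 2 \<le> enform Q a a * enform Q b b"
proof -
  \<comment> \<open>The convolution of \<open>\<bar>a q\<bar>\<close> with the kernel, that is the
    square root of the energy operator applied to it.\<close>
  let ?T = "\<lambda>a (q, x). \<integral>\<^sup>+y. ennreal \<bar>a q y\<bar> * \<kappa> (x - y) \<partial>lborel"
  have T [measurable]: "?T a \<in> borel_measurable (Q \<Otimes>\<^sub>M lborel)" if [measurable]: "meas2 Q a" for a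
    unfolding case_prod_beta' by measurable
  have eq: "enform Q a b = (\<integral>\<^sup>+p. ?T a p * ?T b p \<partial>(Q \<Otimes>\<^sub>M lborel))"
    if [measurable]: "meas2 Q a" "meas2 Q b" for a b
  proof -
    have "enform Q a b = (\<integral>\<^sup>+q. \<integral>\<^sup>+x. ?T a (q, x) * ?T b (q, x) \<partial>lborel \<partial>Q)"
      unfolding enform_def
    proof (rule nn_integral_cong)
      fix q assume "q \<in> space Q"
      then have [measurable]: "a q \<in> borel_measurable borel" "b q \<in> borel_measurable borel" by measurable
      show "(\<integral>\<^sup>+y. \<integral>\<^sup>+y'. ennreal \<bar>a q y * b q y'\<bar> * f (y - y') \<partial>lborel \<partial>lborel) = (\<integral>\<^sup>+x. ?T a (q, x) * ?T b (q, x) \<partial>lborel)"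
        unfolding prod.case by (subst corr_form_eq[symmetric]) (auto simp: abs_mult ennreal_mult)
    qed
    also have "\<dots> = (\<integral>\<^sup>+p. ?T a p * ?T b p \<partial>(Q \<Otimes>\<^sub>M lborel))"
      by (rule lborel.nn_integral_fst) (intro borel_measurable_times_ennreal T that)
    finally show ?thesis .
  qed
  have "enform Q a b ^ 2 \<le> (\<integral>\<^sup>+p. ?T a p ^ 2 \<partial>(Q \<Otimes>\<^sub>M lborel)) * (\<integral>\<^sup>+p. ?T b p ^ 2 \<partial>(Q \<Otimes>\<^sub>M lborel))"
    unfolding eq[OF assms] by (rule Cauchy_Schwarz_nn_integral) (rule T assms)+
  then show ?thesis using eq[OF assms(1,1)] eq[OF assms(2,2)] by (simp add: power2_eq_square)
qed

lemma enform_finite: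
  assumes "meas2 Q a" "meas2 Q b" "enform Q a a < \<infinity>" "enform Q b b < \<infinity>"
  shows "enform Q a b < \<infinity>"
proof -
  have "enform Q a b ^ 2 < \<infinity>"
    using enform_Cauchy_Schwarz[OF assms(1,2)] assms(3,4)
    by (auto intro: le_less_trans simp: ennreal_mult_less_top)
  then show ?thesis by (simp add: power_less_top_ennreal)
qed

lemma enform_add_le:
  assumes [measurable]: "meas2 Q a" "meas2 Q b" "meas2 Q c"
  shows "enform Q a (\<lambda>q y. b q y + c q y) \<le> enform Q a b + enform Q a c"
    and "enform Q (\<lambda>q y. b q y + c q y) a \<le> enform Q b a + enform Q c a"
proof -
  have "enform Q a (\<lambda>q y. b q y + c q y) \<le>
    (\<integral>\<^sup>+x. (case x of (q, y, y') \<Rightarrow> ennreal \<bar>a q y * b q y' * fr (y - y')\<bar>) +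
      (case x of (q, y, y') \<Rightarrow> ennreal \<bar>a q y * c q y' * fr (y - y')\<bar>) \<partial>(Q \<Otimes>\<^sub>M (lborel \<Otimes>\<^sub>M lborel)))"
    by (subst enform_eq)
      (auto intro!: nn_integral_mono ennreal_leI simp: ennreal_plus[symmetric] algebra_simps simp del: ennreal_plus)
  also have "\<dots> = enform Q a b + enform Q a c"
    unfolding enform_eq[OF assms(1,2)] enform_eq[OF assms(1,3)] by (rule nn_integral_add) measurable
  finally show "enform Q a (\<lambda>q y. b q y + c q y) \<le> enform Q a b + enform Q a c" .
  have "enform Q (\<lambda>q y. b q y + c q y) a \<le>
    (\<integral>\<^sup>+x. (case x of (q, y, y') \<Rightarrow> ennreal \<bar>b q y * a q y' * fr (y - y')\<bar>) +
      (case x of (q, y, y') \<Rightarrow> ennreal \<bar>c q y * a q y' * fr (y - y')\<bar>) \<partial>(Q \<Otimes>\<^sub>M (lborel \<Otimes>\<^sub>M lborel)))"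
    by (subst enform_eq)
      (auto intro!: nn_integral_mono ennreal_leI simp: ennreal_plus[symmetric] algebra_simps simp del: ennreal_plus)
  also have "\<dots> = enform Q b a + enform Q c a"
    unfolding enform_eq[OF assms(2,1)] enform_eq[OF assms(3,1)] by (rule nn_integral_add) measurable
  finally show "enform Q (\<lambda>q y. b q y + c q y) a \<le> enform Q b a + enform Q c a" .
qed

text \<open>The difference of the two forms splits as \<open>u n\<close> against \<open>b n\<close>
  plus \<open>a'\<close> against \<open>v n\<close>, and \<open>b n = v n + b'\<close>. Every
  resulting mixed energy has a vanishing entry and is handled by Cauchy-Schwarz.\<close>

lemma form_tendsto:
  fixes Q :: "'q measure"
  assumes a [measurable]: "\<And>n. meas2 Q (a n)" "meas2 Q a'" and b [measurable]: "\<And>n. meas2 Q (b n)" "meas2 Q b'"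
    and fin: "enform Q a' a' < \<infinity>" "enform Q b' b' < \<infinity>"
      "\<And>n. enform Q (a n) (a n) < \<infinity>" "\<And>n. enform Q (b n) (b n) < \<infinity>"
    and lim: "(\<lambda>n. enform Q (\<lambda>q y. a n q y - a' q y) (\<lambda>q y. a n q y - a' q y)) \<longlonglongrightarrow> 0"
      "(\<lambda>n. enform Q (\<lambda>q y. b n q y - b' q y) (\<lambda>q y. b n q y - b' q y)) \<longlonglongrightarrow> 0"
  shows "(\<lambda>n. form Q (a n) (b n)) \<longlonglongrightarrow> form Q a' b'"
proof -
  let ?M = "Q \<Otimes>\<^sub>M (lborel \<Otimes>\<^sub>M (lborel :: real measure))"
  define u where "u n q y = a n q y - a' q y" for n q y
  define v where "v n q y = b n q y - b' q y" for n q y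
  have [measurable]: "meas2 Q (u n)" "meas2 Q (v n)" for n
    unfolding u_def v_def by measurable
  have ab: "a n = (\<lambda>q y. u n q y + a' q y)" "b n = (\<lambda>q y. v n q y + b' q y)" for n
    by (auto simp: u_def v_def)
  have lu: "(\<lambda>n. enform Q (u n) (u n)) \<longlonglongrightarrow> 0" and lv: "(\<lambda>n. enform Q (v n) (v n)) \<longlonglongrightarrow> 0"
    using lim unfolding u_def v_def by simp_all
  have 1: "(\<lambda>n. enform Q (u n) b') \<longlonglongrightarrow> 0"
    by (rule ennreal_tendsto_0_if_square[OF enform_Cauchy_Schwarz lu fin(2)]) measurable
  have 2: "(\<lambda>n. enform Q a' (v n)) \<longlonglongrightarrow> 0"
    by (rule ennreal_tendsto_0_if_square[where Y="\<lambda>n. enform Q (v n) (v n)" and c="enform Q a' a'"])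
      (use enform_Cauchy_Schwarz[of a' Q "v _"] lv fin in \<open>auto simp: mult.commute\<close>)
  have ev: "eventually (\<lambda>n. enform Q (v n) (v n) < 1) sequentially"
    using lv by (rule order_tendstoD) simp
  have 3: "(\<lambda>n. enform Q (u n) (v n)) \<longlonglongrightarrow> 0"
  proof -
    \<comment> \<open>The energy of \<open>v n\<close> falls below 1 only eventually, while the
      comparison lemma wants one constant for all indices; the sequence is cut off until
      then.\<close>
    let ?X = "\<lambda>n. if enform Q (v n) (v n) < 1 then enform Q (u n) (v n) else 0"
    have "?X \<longlonglongrightarrow> 0"
    proof (rule ennreal_tendsto_0_if_square[where c=1, OF _ lu])
      fix n show "(?X n)\<^sup>2 \<le> enform Q (u n) (u n) * 1"
        using enform_Cauchy_Schwarz[of "u n" Q "v n"]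
          mult_left_mono[of "enform Q (v n) (v n)" 1 "enform Q (u n) (u n)"] by (auto intro: order_trans)
    qed simp
    moreover have "eventually (\<lambda>n. ?X n = enform Q (u n) (v n)) sequentially"
      using ev by eventually_elim simp
    ultimately show ?thesis by (rule Lim_transform_eventually)
  qed
  have "(\<lambda>n. enform Q (u n) (v n) + enform Q (u n) b' + enform Q a' (v n)) \<longlonglongrightarrow> 0 + 0 + 0"
    by (intro tendsto_add 1 2 3)
  then have lim0: "(\<lambda>n. enform Q (u n) (v n) + enform Q (u n) b' + enform Q a' (v n)) \<longlonglongrightarrow> 0" by simp
  have le: "ennreal \<bar>form Q (a n) (b n) - form Q a' b'\<bar> \<le>
    enform Q (u n) (v n) + enform Q (u n) b' + enform Q a' (v n)" for n
  proof -
    have i: "integrable ?M (\<lambda>(q, y, y'). a n q y * b n q y' * fr (y - y'))"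
      "integrable ?M (\<lambda>(q, y, y'). a' q y * b' q y' * fr (y - y'))"
      by (rule form_integrable[OF a(1) b(1) enform_finite[OF a(1) b(1) fin(3,4)]],
          rule form_integrable[OF a(2) b(2) enform_finite[OF a(2) b(2) fin(1,2)]])
    have eq: "form Q (a n) (b n) - form Q a' b' =
      (LINT p|?M. (case p of (q, y, y') \<Rightarrow> a n q y * b n q y' * fr (y - y')) -
         (case p of (q, y, y') \<Rightarrow> a' q y * b' q y' * fr (y - y')))"
      unfolding form_def by (rule Bochner_Integration.integral_diff[symmetric]) (fact i)+
    have "ennreal \<bar>form Q (a n) (b n) - form Q a' b'\<bar> \<le>
      (\<integral>\<^sup>+p. ennreal \<bar>(case p of (q, y, y') \<Rightarrow> a n q y * b n q y' * fr (y - y')) -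
         (case p of (q, y, y') \<Rightarrow> a' q y * b' q y' * fr (y - y'))\<bar> \<partial>?M)"
      unfolding eq
      using integral_norm_bound_ennreal[OF Bochner_Integration.integrable_diff[OF i]] unfolding real_norm_def .
    also have "\<dots> \<le> (\<integral>\<^sup>+p. (case p of (q, y, y') \<Rightarrow> ennreal \<bar>u n q y * b n q y' * fr (y - y')\<bar>) +
         (case p of (q, y, y') \<Rightarrow> ennreal \<bar>a' q y * v n q y' * fr (y - y')\<bar>) \<partial>?M)"
    proof (rule nn_integral_mono)
      fix p :: "'q \<times> real \<times> real"
      obtain q y y' where p: "p = (q, y, y')" by (cases p)
      have "a n q y * b n q y' * fr (y - y') - a' q y * b' q y' * fr (y - y') =
        u n q y * b n q y' * fr (y - y') + a' q y * v n q y' * fr (y - y')"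
        by (simp add: u_def v_def algebra_simps)
      then have "\<bar>a n q y * b n q y' * fr (y - y') - a' q y * b' q y' * fr (y - y')\<bar> \<le>
        \<bar>u n q y * b n q y' * fr (y - y')\<bar> + \<bar>a' q y * v n q y' * fr (y - y')\<bar>" by linarith
      then show "ennreal \<bar>(case p of (q, y, y') \<Rightarrow> a n q y * b n q y' * fr (y - y')) -
         (case p of (q, y, y') \<Rightarrow> a' q y * b' q y' * fr (y - y'))\<bar> \<le>
         (case p of (q, y, y') \<Rightarrow> ennreal \<bar>u n q y * b n q y' * fr (y - y')\<bar>) +
         (case p of (q, y, y') \<Rightarrow> ennreal \<bar>a' q y * v n q y' * fr (y - y')\<bar>)"
        unfolding p prod.case by (simp add: ennreal_leI flip: ennreal_plus)
    qed
    also have "\<dots> = enform Q (u n) (b n) + enform Q a' (v n)"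
      unfolding enform_eq[OF \<open>meas2 Q (u n)\<close> b(1)] enform_eq[OF a(2) \<open>meas2 Q (v n)\<close>]
      by (rule nn_integral_add) measurable
    also have "enform Q (u n) (b n) \<le> enform Q (u n) (v n) + enform Q (u n) b'"
      unfolding ab by (rule enform_add_le) measurable
    finally show ?thesis by (simp add: add_mono)
  qed
  have "(\<lambda>n. ennreal \<bar>form Q (a n) (b n) - form Q a' b'\<bar>) \<longlonglongrightarrow> ennreal 0"
    unfolding ennreal_0 by (rule tendsto_sandwich[OF _ _ tendsto_const lim0]) (use le in auto)
  then have "(\<lambda>n. \<bar>form Q (a n) (b n) - form Q a' b'\<bar>) \<longlonglongrightarrow> 0"
    by (subst (asm) tendsto_ennreal_iff) auto
  then have "(\<lambda>n. form Q (a n) (b n) - form Q a' b') \<longlonglongrightarrow> 0" by (rule tendsto_rabs_zero_cancel)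
  then show ?thesis by (rule Lim_null[THEN iffD2])
qed

lemma form_sum_left:
  assumes "\<And>i. i \<in> I \<Longrightarrow> meas2 Q (a i)" "meas2 Q b" "\<And>i. i \<in> I \<Longrightarrow> enform Q (a i) b < \<infinity>"
  shows "form Q (\<lambda>q y. \<Sum>i\<in>I. a i q y) b = (\<Sum>i\<in>I. form Q (a i) b)"
proof -
  have "form Q (\<lambda>q y. \<Sum>i\<in>I. a i q y) b = (LINT p|(Q \<Otimes>\<^sub>M (lborel \<Otimes>\<^sub>M lborel)).
     (\<Sum>i\<in>I. (case p of (q, y, y') \<Rightarrow> a i q y * b q y' * fr (y - y'))))"
    unfolding form_def by (simp add: sum_distrib_right case_prod_beta')
  also have "\<dots> = (\<Sum>i\<in>I. form Q (a i) b)"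
    unfolding form_def using assms by (intro Bochner_Integration.integral_sum form_integrable) auto
  finally show ?thesis .
qed

lemma form_sum_right:
  assumes "\<And>i. i \<in> I \<Longrightarrow> meas2 Q (a i)" "meas2 Q b" "\<And>i. i \<in> I \<Longrightarrow> enform Q b (a i) < \<infinity>"
  shows "form Q b (\<lambda>q y. \<Sum>i\<in>I. a i q y) = (\<Sum>i\<in>I. form Q b (a i))"
proof -
  have "form Q b (\<lambda>q y. \<Sum>i\<in>I. a i q y) = (LINT p|(Q \<Otimes>\<^sub>M (lborel \<Otimes>\<^sub>M lborel)).
     (\<Sum>i\<in>I. (case p of (q, y, y') \<Rightarrow> b q y * a i q y' * fr (y - y'))))"
    unfolding form_def by (simp add: sum_distrib_left sum_distrib_right case_prod_beta')
  also have "\<dots> = (\<Sum>i\<in>I. form Q b (a i))"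
    unfolding form_def using assms by (intro Bochner_Integration.integral_sum form_integrable) auto
  finally show ?thesis .
qed

end

section \<open>Increments of the coloured noise\<close>

lemma integral_product_functions:
  fixes g :: "'a \<Rightarrow> real" and h :: "'b \<Rightarrow> real"
  assumes "sigma_finite_measure M1" "sigma_finite_measure M2"
    and "integrable (M1 \<Otimes>\<^sub>M M2) (\<lambda>(x, y). g x * h y)"
  shows "(LINT (x, y)|(M1 \<Otimes>\<^sub>M M2). g x * h y) = (LINT x|M1. g x) * (LINT y|M2. h y)"
proof -
  interpret pair_sigma_finite M1 M2 using assms by (simp add: pair_sigma_finite_def)
  show ?thesis using integral_fst'[OF assms(3)] by simp
qed

locale colored_noise = correlation_kernel \<kappa> + prob_space P
  for \<kappa> :: "real \<Rightarrow> ennreal" and P :: "'w measure" +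
  fixes N :: "'w \<Rightarrow> (real \<times> real \<times> real) measure" and \<nu> :: "real measure"
    and X :: "real \<Rightarrow> (real \<Rightarrow> real) \<Rightarrow> 'w \<Rightarrow> real"
  assumes jump: "jump_measure \<nu>" and prm_intensity: "poisson_random_measure P N (intensity \<nu>)"
    and noise: "levy_colored_noise P N \<nu> \<kappa> X"

sublocale colored_noise \<subseteq> poisson_noise P N "intensity \<nu>"
  by unfold_locales (rule prm_intensity)

context colored_noise
begin

definition m2 :: real where "m2 = (LINT z|\<nu>. z * z)"

lemma sets_jump: "sets \<nu> = sets (restrict_space borel nonzero_reals)"
  using jump by (simp add: jump_measure_def)

lemma space_jump: "space \<nu> = nonzero_reals"
  using sets_eq_imp_space_eq[OF sets_jump] by (simp add: space_restrict_space)

lemma measurable_jump_ident [measurable]: "(\<lambda>z. z) \<in> borel_measurable \<nu>"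
  by (subst measurable_cong_sets[OF sets_jump refl]) (rule measurable_restrict_space1, simp)

lemma jump_sq_finite: "(\<integral>\<^sup>+z. ennreal (z\<^sup>2) \<partial>\<nu>) < \<infinity>"
  using jump by (simp add: jump_measure_def)

lemma m2_nonneg: "0 \<le> m2" unfolding m2_def by (rule Bochner_Integration.integral_nonneg) simp

text \<open>By Chebyshev's inequality the jumps of size at least \<open>1 / Suc n\<close> have
  finite mass, and these sets exhaust the line without 0.\<close>

lemma sigma_finite_jump: "sigma_finite_measure \<nu>"
proof
  let ?A = "\<lambda>n::nat. {z\<in>space \<nu>. 1 / Suc n \<le> \<bar>z\<bar>}"
  have "emeasure \<nu> (?A n) \<noteq> \<infinity>" for n
  proof -
    have "emeasure \<nu> (?A n) = (\<integral>\<^sup>+z. indicator (?A n) z \<partial>\<nu>)" by simp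
    also have "\<dots> \<le> (\<integral>\<^sup>+z. ennreal ((Suc n)\<^sup>2) * ennreal (z\<^sup>2) \<partial>\<nu>)"
    proof (rule nn_integral_mono)
      fix z assume "z \<in> space \<nu>"
      show "indicator (?A n) z \<le> ennreal ((Suc n)\<^sup>2) * ennreal (z\<^sup>2)"
      proof (cases "z \<in> ?A n")
        case True
        then have "1 \<le> real (Suc n) * \<bar>z\<bar>" by (simp add: field_simps)
        then have "1 \<le> (real (Suc n) * \<bar>z\<bar>)\<^sup>2" by (simp add: one_le_power)
        then have "ennreal 1 \<le> ennreal ((Suc n)\<^sup>2 * z\<^sup>2)"
          by (intro ennreal_leI) (simp add: power_mult_distrib)
        with True show ?thesis by (simp add: ennreal_mult)
      qed simp
    qed
    also have "\<dots> < \<infinity>" using jump_sq_finite by (simp add: nn_integral_cmult ennreal_mult_less_top)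
    finally show ?thesis by simp
  qed
  moreover have "(\<Union>n. ?A n) = space \<nu>"
  proof (intro equalityI subsetI)
    fix z assume z: "z \<in> space \<nu>"
    then have "0 < \<bar>z\<bar>" using space_jump by auto
    then obtain n where "inverse (real (Suc n)) < \<bar>z\<bar>" using reals_Archimedean by blast
    then show "z \<in> (\<Union>n. ?A n)" using z by (auto simp: inverse_eq_divide intro!: exI[of _ n] less_imp_le)
  qed auto
  ultimately show "\<exists>A. countable A \<and> A \<subseteq> sets \<nu> \<and> \<Union>A = space \<nu> \<and> (\<forall>a\<in>A. emeasure \<nu> a \<noteq> \<infinity>)"
    by (intro exI[of _ "range ?A"]) auto
qed

section \<open>The past of the noise\<close>

abbreviation time_measure :: "real measure" where "time_measure \<equiv> restrict_space lborel {0..}"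

lemma sigma_finite_time: "sigma_finite_measure time_measure"
  by (intro sigma_finite_measure_restrict_space sigma_finite_lborel) simp

lemma sigma_finite_space_jump: "sigma_finite_measure (lborel \<Otimes>\<^sub>M \<nu> :: (real \<times> real) measure)"
proof -
  interpret pair_sigma_finite "lborel :: real measure" \<nu>
    using sigma_finite_jump sigma_finite_lborel by (simp add: pair_sigma_finite_def)
  show ?thesis by (rule P.sigma_finite_measure_axioms)
qed

definition past :: "real \<Rightarrow> (real \<times> real \<times> real) set" where
  "past p = {0..p} \<times> UNIV \<times> nonzero_reals"

lemma past_sets: "past p \<in> sets (intensity \<nu>)"
proof -
  have "{0..p} \<in> sets time_measure" by (auto simp: sets_restrict_space_iff)
  moreover have "nonzero_reals \<in> sets \<nu>" using space_jump sets.top[of \<nu>] by simp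
  ultimately show ?thesis unfolding past_def intensity_def by (intro pair_measureI) auto
qed

lemma past_mono: "p \<le> q \<Longrightarrow> past p \<subseteq> past q" by (auto simp: past_def)

text \<open>The generators of the filtration are null sets and counts over boxes inside
  \<open>past a\<close>. Passing to the larger field gives access to independence from everything
  after time \<open>a\<close>.\<close>

lemma filtration_history:
  assumes "Y \<in> borel_measurable (noise_filtration P N a)"
  shows "Y \<in> borel_measurable (history (past a))"
proof -
  let ?G = "{(\<lambda>\<omega>. emeasure (N \<omega>) ({0..s} \<times> A \<times> B)) -` C \<inter> space P | s A B C.
         0 \<le> s \<and> s \<le> a \<and> A \<in> sets borel \<and> bounded A \<and>
         B \<in> sets borel \<and> B \<subseteq> nonzero_reals \<and> bounded (inverse ` B) \<and> C \<in> sets borel} \<union> null_sets P"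
  have G: "?G \<subseteq> sets (history (past a))"
  proof (rule Un_least)
    show "null_sets P \<subseteq> sets (history (past a))"
      unfolding sets_history by (rule subsetI, rule sigma_sets.Basic, rule UnI2)
    show "{(\<lambda>\<omega>. emeasure (N \<omega>) ({0..s} \<times> A \<times> B)) -` C \<inter> space P | s A B C.
         0 \<le> s \<and> s \<le> a \<and> A \<in> sets borel \<and> bounded A \<and>
         B \<in> sets borel \<and> B \<subseteq> nonzero_reals \<and> bounded (inverse ` B) \<and> C \<in> sets borel}
       \<subseteq> sets (history (past a))"
    proof
      fix E assume "E \<in> {(\<lambda>\<omega>. emeasure (N \<omega>) ({0..s} \<times> A \<times> B)) -` C \<inter> space P | s A B C.
         0 \<le> s \<and> s \<le> a \<and> A \<in> sets borel \<and> bounded A \<and>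
         B \<in> sets borel \<and> B \<subseteq> nonzero_reals \<and> bounded (inverse ` B) \<and> C \<in> sets borel}"
      then obtain s A B C where E: "E = (\<lambda>\<omega>. emeasure (N \<omega>) ({0..s} \<times> A \<times> B)) -` C \<inter> space P"
        and s: "0 \<le> s" "s \<le> a" "A \<in> sets borel" "B \<in> sets borel" "B \<subseteq> nonzero_reals" "C \<in> sets borel" by blast
      have "{0..s} \<in> sets time_measure" by (auto simp: sets_restrict_space_iff)
      moreover have "B \<in> sets \<nu>" using s by (simp add: sets_jump sets_restrict_space_iff)
      ultimately have "{0..s} \<times> A \<times> B \<in> sets (intensity \<nu>)"
        unfolding intensity_def using s by (intro pair_measureI) auto
      moreover have "{0..s} \<times> A \<times> B \<subseteq> past a" using s by (auto simp: past_def)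
      ultimately have "(\<lambda>\<omega>. emeasure (N \<omega>) ({0..s} \<times> A \<times> B)) \<in> borel_measurable (history (past a))"
        by (rule measurable_count_history)
      from measurable_sets[OF this s(6)] show "E \<in> sets (history (past a))" by (simp add: E)
    qed
  qed
  then have "sigma_sets (space P) ?G \<subseteq> sets (history (past a))"
    using sets.sigma_sets_subset[of ?G "history (past a)"] by simp
  moreover have "?G \<subseteq> Pow (space P)"
  proof
    fix E assume "E \<in> ?G"
    with G have "E \<in> sets (history (past a))" by (rule subsetD)
    from sets.sets_into_space[OF this] show "E \<in> Pow (space P)" by simp
  qed
  then have "sets (noise_filtration P N a) = sigma_sets (space P) ?G" "space (noise_filtration P N a) = space P"
    unfolding noise_filtration_def by (simp_all add: sets_measure_of_conv space_measure_of_conv)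
  ultimately show ?thesis
    using measurable_mono[OF order_refl refl, of "noise_filtration P N a" "history (past a)" borel] assms by auto
qed

section \<open>Energy of bounded spatial sets\<close>

abbreviation bounded_borel :: "real set \<Rightarrow> bool" where
  "bounded_borel A \<equiv> A \<in> sets borel \<and> bounded A"

definition box :: "real set \<Rightarrow> real set \<Rightarrow> ennreal" where
  "box A B = (\<integral>\<^sup>+y. \<integral>\<^sup>+y'. indicator A y * indicator B y' * f (y - y') \<partial>lborel \<partial>lborel)"

lemma box_finite:
  assumes "bounded_borel A" "bounded_borel B" shows "box A B < \<infinity>"
proof -
  obtain r where r: "\<And>y. y \<in> A \<Longrightarrow> \<bar>y\<bar> \<le> r" using assms by (auto simp: bounded_iff)
  obtain r' where r': "\<And>y. y \<in> B \<Longrightarrow> \<bar>y\<bar> \<le> r'" using assms by (auto simp: bounded_iff)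
  have "box A B \<le> emeasure lborel A * corr_mass (r + r')"
    unfolding box_def
  proof (rule corr_box_le)
    fix y y' assume "y \<in> A" "y' \<in> B" with r[of y] r'[of y'] show "\<bar>y - y'\<bar> \<le> r + r'" by linarith
  qed (use assms in auto)
  moreover have "emeasure lborel A < \<infinity>" using assms emeasure_bounded_finite[of A] by auto
  ultimately show ?thesis using corr_mass_finite[of "r + r'"]
    by (auto intro: le_less_trans simp: ennreal_mult_less_top)
qed

abbreviation smooth_ind :: "real set \<Rightarrow> real \<Rightarrow> real" where
  "smooth_ind A \<equiv> smoothed \<kappa> (indicator A)"

text \<open>A tempered kernel has finite mass near any point, so smoothing a bounded set gives
  finite values and the real and extended versions carry the same information.\<close>

lemma smooth_ind_eq:
  assumes "bounded_borel A"
  shows "smooth_ind A x = enn2real (\<integral>\<^sup>+y. indicator A y * \<kappa> (x - y) \<partial>lborel)"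
    and "ennreal (smooth_ind A x) = (\<integral>\<^sup>+y. indicator A y * \<kappa> (x - y) \<partial>lborel)"
proof -
  have [measurable]: "A \<in> sets borel" using assms by auto
  obtain r where r: "\<And>y. y \<in> A \<Longrightarrow> \<bar>y\<bar> \<le> r" using assms by (auto simp: bounded_iff)
  have "(\<integral>\<^sup>+y. indicator A y * \<kappa> (x - y) \<partial>lborel) \<le>
    (\<integral>\<^sup>+y. \<kappa> (x - y) * indicator {-(\<bar>x\<bar> + r)..\<bar>x\<bar> + r} (x - y) \<partial>lborel)"
    using r by (intro nn_integral_mono) (force simp: indicator_def abs_le_iff)
  also have "\<dots> = (\<integral>\<^sup>+y\<in>{-(\<bar>x\<bar> + r)..\<bar>x\<bar> + r}. \<kappa> y \<partial>lborel)"
    by (subst (2) nn_integral_real_affine[where c="- 1" and t=x]) auto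
  also have "\<dots> < \<infinity>" by (rule tempered_locally_integrable[OF tempered_kernel])
  finally have fin: "(\<integral>\<^sup>+y. indicator A y * \<kappa> (x - y) \<partial>lborel) < \<infinity>" .
  have "smooth_ind A x = enn2real (\<integral>\<^sup>+y. ennreal (indicator A y * enn2real (\<kappa> (x - y))) \<partial>lborel)"
    unfolding smoothed_def by (rule integral_eq_nn_integral) auto
  also have "(\<integral>\<^sup>+y. ennreal (indicator A y * enn2real (\<kappa> (x - y))) \<partial>lborel) =
    (\<integral>\<^sup>+y. indicator A y * \<kappa> (x - y) \<partial>lborel)"
  proof (rule nn_integral_cong_AE)
    show "AE y in lborel. ennreal (indicator A y * enn2real (\<kappa> (x - y))) = indicator A y * \<kappa> (x - y)"
      using AE_lborel_singleton[of x]
    proof eventually_elim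
      case (elim y)
      then show ?case using kernel_finite[of "x - y"] by (simp add: ennreal_mult ennreal_indicator)
    qed
  qed
  finally show 1: "smooth_ind A x = enn2real (\<integral>\<^sup>+y. indicator A y * \<kappa> (x - y) \<partial>lborel)" .
  then show "ennreal (smooth_ind A x) = (\<integral>\<^sup>+y. indicator A y * \<kappa> (x - y) \<partial>lborel)"
    using fin by simp
qed

lemma smooth_ind_nonneg: "bounded_borel A \<Longrightarrow> 0 \<le> smooth_ind A x"
  by (simp add: smooth_ind_eq)

lemma smooth_ind_measurable:
  assumes "bounded_borel A" shows "smooth_ind A \<in> borel_measurable borel"
proof -
  have [measurable]: "A \<in> sets borel" using assms by auto
  have "(\<lambda>x. enn2real (\<integral>\<^sup>+y. indicator A y * \<kappa> (x - y) \<partial>lborel)) \<in> borel_measurable borel"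
    by measurable
  moreover have "smooth_ind A = (\<lambda>x. enn2real (\<integral>\<^sup>+y. indicator A y * \<kappa> (x - y) \<partial>lborel))"
    using smooth_ind_eq(1)[OF assms] by auto
  ultimately show ?thesis by simp
qed

lemma box_eq:
  assumes "bounded_borel A" "bounded_borel B"
  shows "enn2real (box A B) = (LINT x|lborel. smooth_ind A x * smooth_ind B x)"
proof -
  have [measurable]: "A \<in> sets borel" "B \<in> sets borel" using assms by auto
  have "box A B = (\<integral>\<^sup>+x. ennreal (smooth_ind A x * smooth_ind B x) \<partial>lborel)"
    unfolding box_def
    by (subst corr_form_eq)
      (auto simp: smooth_ind_eq(2)[OF assms(1), symmetric] smooth_ind_eq(2)[OF assms(2), symmetric]
         ennreal_mult smooth_ind_nonneg assms)
  then show ?thesis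
    using smooth_ind_measurable assms smooth_ind_nonneg
    by (subst integral_eq_nn_integral) (auto intro!: borel_measurable_times)
qed

text \<open>A difference of two indicators because the increment is a difference of two values of
  \<open>X\<close>. For \<open>0 \<le> p \<le> q\<close> it reduces to the indicator of
  \<open>(p,q]\<close>.\<close>

definition increment_integrand :: "real \<Rightarrow> real \<Rightarrow> real set \<Rightarrow> real \<times> real \<times> real \<Rightarrow> real" where
  "increment_integrand p q A = (\<lambda>(s, x, z). (indicator {0..q} s - indicator {0..p} s) * smooth_ind A x * z)"

definition increment :: "real \<Rightarrow> real \<Rightarrow> real set \<Rightarrow> 'w \<Rightarrow> real" where
  "increment p q A \<omega> = X q (indicator A) \<omega> - X p (indicator A) \<omega>"

lemma increment_approximates:
  assumes "0 \<le> p" "0 \<le> q" "bounded_borel A"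
  obtains S where "approximates S (increment_integrand p q A) (increment p q A)"
proof -
  have "has_compensated_integral P N (intensity \<nu>)
    (\<lambda>(s, x, z). indicator {0..t} s * smooth_ind A x * z) (X t (indicator A))" if "0 \<le> t" for t
    using noise that assms unfolding levy_colored_noise_def is_white_noise_integral_def by blast
  from this[OF assms(1)] this[OF assms(2)]
  obtain S T where "approximates S (\<lambda>(s, x, z). indicator {0..p} s * smooth_ind A x * z) (X p (indicator A))"
    "approximates T (\<lambda>(s, x, z). indicator {0..q} s * smooth_ind A x * z) (X q (indicator A))"
    using has_compensated_integralD by blast
  from approximates_diff[OF this(2,1)] show ?thesis
    by (intro that) (simp add: increment_integrand_def increment_def[abs_def] case_prod_beta' algebra_simps)
qed

lemma square_integrable_increment:
  assumes "0 \<le> p" "0 \<le> q" "bounded_borel A"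
  shows "square_integrable P (increment p q A)"
  using increment_approximates[OF assms] approximates_measurable by blast

text \<open>The intensity is a product measure and the integrand separates: time gives the overlap
  of the two intervals, space the energy of the two sets, jumps the second moment.\<close>

lemma integral_increment_integrand:
  assumes "0 \<le> p" "p \<le> q" "0 \<le> p'" "p' \<le> q'" and A: "bounded_borel A" and B: "bounded_borel B"
  shows "(LINT z|intensity \<nu>. increment_integrand p q A z * increment_integrand p' q' B z) =
    measure lborel ({p<..q} \<inter> {p'<..q'}) * enn2real (box A B) * m2"
proof -
  have "0 \<le> q" "0 \<le> q'" using assms by auto
  obtain S where S: "approximates S (increment_integrand p q A) (increment p q A)"
    using increment_approximates[OF \<open>0 \<le> p\<close> \<open>0 \<le> q\<close> A] .
  obtain T where T: "approximates T (increment_integrand p' q' B) (increment p' q' B)"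
    using increment_approximates[OF \<open>0 \<le> p'\<close> \<open>0 \<le> q'\<close> B] .
  have "integrable (intensity \<nu>) (\<lambda>z. increment_integrand p q A z * increment_integrand p' q' B z)"
    using S T by (intro square_integrable_mult) (auto simp: approximates_def tendsto_L2_def)
  moreover define d where "d s = (indicator {0..q} s - indicator {0..p} s) * (indicator {0..q'} s - indicator {0..p'} s :: real)" for s :: real
  define g where "g x = smooth_ind A x * smooth_ind B x" for x
  have eq: "(\<lambda>z. increment_integrand p q A z * increment_integrand p' q' B z) =
    (\<lambda>(s, w). d s * (case w of (x, z) \<Rightarrow> g x * (z * z)))"
    by (auto simp: increment_integrand_def fun_eq_iff d_def g_def)
  ultimately have i: "integrable (time_measure \<Otimes>\<^sub>M (lborel \<Otimes>\<^sub>M \<nu>)) (\<lambda>(s, w). d s * (case w of (x, z) \<Rightarrow> g x * (z * z)))"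
    by (simp add: intensity_def)
  have d: "d s = indicator ({p<..q} \<inter> {p'<..q'}) s" if "0 \<le> s" for s
    using that assms by (auto simp: d_def indicator_def)
  have dint: "(LINT s|time_measure. d s) = measure lborel ({p<..q} \<inter> {p'<..q'})"
  proof -
    have "(LINT s|time_measure. d s) = (LINT s|time_measure. indicator ({p<..q} \<inter> {p'<..q'}) s)"
      using d by (intro Bochner_Integration.integral_cong refl) (simp add: space_restrict_space)
    also have "\<dots> = measure time_measure ({p<..q} \<inter> {p'<..q'} \<inter> space time_measure)" by simp
    also have "{p<..q} \<inter> {p'<..q'} \<inter> space time_measure = {p<..q} \<inter> {p'<..q'}"
      using assms by (auto simp: space_restrict_space)
    also have "measure time_measure ({p<..q} \<inter> {p'<..q'}) = measure lborel ({p<..q} \<inter> {p'<..q'})"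
      using assms by (intro measure_restrict_space) auto
    finally show ?thesis .
  qed
  \<comment> \<open>Joint integrability over time, space and jumps is already known; separating
    space from jumps needs it for this pair alone.\<close>
  have i2: "integrable (lborel \<Otimes>\<^sub>M \<nu>) (\<lambda>(x, z). g x * (z * z))"
  proof -
    have gi: "integrable lborel g"
    proof (rule integrableI_nonneg)
      show "g \<in> borel_measurable lborel" unfolding g_def using smooth_ind_measurable A B by auto
      show "AE x in lborel. 0 \<le> g x" unfolding g_def using smooth_ind_nonneg A B by simp
      have [measurable]: "A \<in> sets borel" "B \<in> sets borel" using A B by auto
      have "(\<integral>\<^sup>+x. ennreal (g x) \<partial>lborel) = box A B"
        unfolding box_def g_def
        by (subst corr_form_eq) (auto simp: smooth_ind_eq(2)[OF A, symmetric] smooth_ind_eq(2)[OF B, symmetric]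
           ennreal_mult smooth_ind_nonneg A B)
      then show "(\<integral>\<^sup>+x. ennreal (g x) \<partial>lborel) < \<infinity>" using box_finite[OF A B] by simp
    qed
    have zi: "integrable \<nu> (\<lambda>z. z * z)"
      using jump_sq_finite by (intro integrableI_nonneg) (auto simp: power2_eq_square)
    interpret lj: pair_sigma_finite "lborel :: real measure" \<nu>
      using sigma_finite_jump sigma_finite_lborel by (simp add: pair_sigma_finite_def)
    have [measurable]: "g \<in> borel_measurable borel" using gi borel_measurable_integrable by fastforce
    show ?thesis
      using gi zi by (intro lj.Fubini_integrable) (auto simp: abs_mult)
  qed
  have "(LINT z|intensity \<nu>. increment_integrand p q A z * increment_integrand p' q' B z) =
    (LINT (s, w)|(time_measure \<Otimes>\<^sub>M (lborel \<Otimes>\<^sub>M \<nu>)). d s * (case w of (x, z) \<Rightarrow> g x * (z * z)))"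
    by (simp add: eq intensity_def)
  also have "\<dots> = (LINT s|time_measure. d s) * (LINT w|(lborel \<Otimes>\<^sub>M \<nu>). (case w of (x, z) \<Rightarrow> g x * (z * z)))"
    by (rule integral_product_functions[OF sigma_finite_time sigma_finite_space_jump i])
  also have "(LINT w|(lborel \<Otimes>\<^sub>M \<nu>). (case w of (x, z) \<Rightarrow> g x * (z * z))) = (LINT x|lborel. g x) * (LINT z|\<nu>. z * z)"
    by (rule integral_product_functions[OF sigma_finite_lborel sigma_finite_jump i2])
  finally show ?thesis using dint box_eq[OF A B] by (simp add: m2_def g_def)
qed

lemma increment_integrand_past: "z \<in> past r \<Longrightarrow> r \<le> p \<Longrightarrow> p \<le> q \<Longrightarrow> increment_integrand p q A z = 0"
  by (auto simp: increment_integrand_def past_def indicator_def)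

lemma increment_integrand_future:
  "z \<in> space (intensity \<nu>) - past r \<Longrightarrow> p \<le> q \<Longrightarrow> q \<le> r \<Longrightarrow> increment_integrand p q A z = 0"
  by (auto simp: increment_integrand_def past_def indicator_def of_bool_def intensity_def
      space_pair_measure space_jump space_restrict_space split: if_splits)

lemma expectation_increment:
  assumes "0 \<le> p" "p \<le> q" "bounded_borel A" and Y: "Y \<in> borel_measurable (noise_filtration P N p)"
    "\<And>\<omega>. \<omega> \<in> space P \<Longrightarrow> \<bar>Y \<omega>\<bar> \<le> c"
  shows "expectation (\<lambda>\<omega>. Y \<omega> * increment p q A \<omega>) = 0"
proof -
  obtain S where S: "approximates S (increment_integrand p q A) (increment p q A)"
    using increment_approximates[of p q A] assms by auto
  show ?thesis
    by (rule expectation_mult_compensated[OF past_sets filtration_history[OF Y(1)] Y(2) S])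
      (use assms increment_integrand_past in auto)
qed

text \<open>Both weights are known at time \<open>p'\<close>, the later of the two starting times.
  The first increment is split there: its part before \<open>p'\<close> is orthogonal to the second
  increment, and its part after \<open>p'\<close> is, together with the second increment,
  independent of the weights.\<close>

lemma expectation_increment_mult_ordered:
  assumes pq: "0 \<le> p" "p \<le> q" "p \<le> p'" "p' \<le> q'" and A: "bounded_borel A" and B: "bounded_borel B"
    and Y: "Y \<in> borel_measurable (noise_filtration P N p)" "\<And>\<omega>. \<omega> \<in> space P \<Longrightarrow> \<bar>Y \<omega>\<bar> \<le> c"
    and Z: "Z \<in> borel_measurable (noise_filtration P N p')" "\<And>\<omega>. \<omega> \<in> space P \<Longrightarrow> \<bar>Z \<omega>\<bar> \<le> d"
  shows "expectation (\<lambda>\<omega>. (Y \<omega> * increment p q A \<omega>) * (Z \<omega> * increment p' q' B \<omega>)) =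
    expectation (\<lambda>\<omega>. Y \<omega> * Z \<omega>) * measure lborel ({p<..q} \<inter> {p'<..q'}) * enn2real (box A B) * m2"
proof -
  \<comment> \<open>The splitting time. If \<open>q \<le> p'\<close> then \<open>r = q\<close> and
    the part after \<open>p'\<close> is an empty increment, so both cases run through the same
    formula.\<close>
  define r where "r = min q p'"
  have r: "p \<le> r" "r \<le> q" "r \<le> p'" "0 \<le> r" "0 \<le> q" "0 \<le> p'" "0 \<le> q'" using pq by (auto simp: r_def)
  have W: "(\<lambda>\<omega>. Y \<omega> * Z \<omega>) \<in> borel_measurable (history (past p'))"
    using filtration_history[OF Z(1)] measurable_history_mono[OF past_mono[OF pq(3)] filtration_history[OF Y(1)]]
    by (intro borel_measurable_times)
  have Wb: "\<bar>Y \<omega> * Z \<omega>\<bar> \<le> \<bar>c\<bar> * \<bar>d\<bar>" if "\<omega> \<in> space P" for \<omega>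
    unfolding abs_mult using Y(2)[OF that] Z(2)[OF that] by (intro mult_mono) auto
  obtain S1 where S1: "approximates S1 (increment_integrand r q A) (increment r q A)"
    using increment_approximates[of r q A] r A by auto
  obtain S2 where S2: "approximates S2 (increment_integrand p r A) (increment p r A)"
    using increment_approximates[of p r A] r pq A by auto
  obtain T where T: "approximates T (increment_integrand p' q' B) (increment p' q' B)"
    using increment_approximates[of p' q' B] r B by auto
  have off: "increment_integrand p' q' B z = 0" if "z \<in> past p'" for z
    using increment_integrand_past[OF that order_refl pq(4)] .
  have off1: "increment_integrand r q A z = 0" if "z \<in> past p'" for z
  proof (cases "q \<le> p'")
    case True then have "r = q" by (simp add: r_def)
    then show ?thesis by (auto simp: increment_integrand_def)
  next
    case False then show ?thesis using increment_integrand_past[OF that, of r q A] r by (simp add: r_def)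
  qed
  have W': "(\<lambda>\<omega>. Y \<omega> * Z \<omega>) \<in> borel_measurable P" by (rule measurable_historyD[OF W])
  have sq: "square_integrable P (increment r q A)" "square_integrable P (increment p r A)"
    "square_integrable P (increment p' q' B)"
    using S1 S2 T by (auto dest: approximates_measurable)
  have i: "integrable P (\<lambda>\<omega>. (Y \<omega> * Z \<omega>) * (increment r q A \<omega> * increment p' q' B \<omega>))"
    "integrable P (\<lambda>\<omega>. (Y \<omega> * Z \<omega>) * (increment p r A \<omega> * increment p' q' B \<omega>))"
    using square_integrable_mult[OF square_integrable_bounded_mult[OF sq(1) W' Wb] sq(3)]
      square_integrable_mult[OF square_integrable_bounded_mult[OF sq(2) W' Wb] sq(3)]
    by (simp_all add: mult.assoc)
  have "expectation (\<lambda>\<omega>. (Y \<omega> * increment p q A \<omega>) * (Z \<omega> * increment p' q' B \<omega>)) =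
    expectation (\<lambda>\<omega>. (Y \<omega> * Z \<omega>) * (increment r q A \<omega> * increment p' q' B \<omega>) +
      (Y \<omega> * Z \<omega>) * (increment p r A \<omega> * increment p' q' B \<omega>))"
    by (simp add: increment_def algebra_simps)
  also have "\<dots> = expectation (\<lambda>\<omega>. (Y \<omega> * Z \<omega>) * (increment r q A \<omega> * increment p' q' B \<omega>)) +
      expectation (\<lambda>\<omega>. (Y \<omega> * Z \<omega>) * (increment p r A \<omega> * increment p' q' B \<omega>))"
    by (rule Bochner_Integration.integral_add[OF i])
  also have "expectation (\<lambda>\<omega>. (Y \<omega> * Z \<omega>) * (increment p r A \<omega> * increment p' q' B \<omega>)) = 0"
    by (rule expectation_mult_compensated_orthogonal[OF past_sets W Wb S2 _ T off])
      (use increment_integrand_future r in auto)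
  also have "expectation (\<lambda>\<omega>. (Y \<omega> * Z \<omega>) * (increment r q A \<omega> * increment p' q' B \<omega>)) =
    expectation (\<lambda>\<omega>. Y \<omega> * Z \<omega>) * (LINT z|intensity \<nu>. increment_integrand r q A z * increment_integrand p' q' B z)"
    by (rule expectation_mult_compensated_mult[OF past_sets W Wb S1 off1 T off])
  also have "(LINT z|intensity \<nu>. increment_integrand r q A z * increment_integrand p' q' B z) =
    measure lborel ({r<..q} \<inter> {p'<..q'}) * enn2real (box A B) * m2"
    using r pq A B by (intro integral_increment_integrand) auto
  also have "{r<..q} \<inter> {p'<..q'} = {p<..q} \<inter> {p'<..q'}"
    using pq by (auto simp: r_def)
  finally show ?thesis by (simp add: mult.assoc)
qed

lemma expectation_increment_mult:
  assumes pq: "0 \<le> p" "p \<le> q" "0 \<le> p'" "p' \<le> q'" and A: "bounded_borel A" and B: "bounded_borel B"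
    and Y: "Y \<in> borel_measurable (noise_filtration P N p)" "\<And>\<omega>. \<omega> \<in> space P \<Longrightarrow> \<bar>Y \<omega>\<bar> \<le> c"
    and Z: "Z \<in> borel_measurable (noise_filtration P N p')" "\<And>\<omega>. \<omega> \<in> space P \<Longrightarrow> \<bar>Z \<omega>\<bar> \<le> d"
  shows "expectation (\<lambda>\<omega>. (Y \<omega> * increment p q A \<omega>) * (Z \<omega> * increment p' q' B \<omega>)) =
    expectation (\<lambda>\<omega>. Y \<omega> * Z \<omega>) * measure lborel ({p<..q} \<inter> {p'<..q'}) * enn2real (box A B) * m2"
proof (cases "p \<le> p'")
  case True then show ?thesis using assms by (intro expectation_increment_mult_ordered) auto
next
  case False
  then have "expectation (\<lambda>\<omega>. (Z \<omega> * increment p' q' B \<omega>) * (Y \<omega> * increment p q A \<omega>)) =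
    expectation (\<lambda>\<omega>. Z \<omega> * Y \<omega>) * measure lborel ({p'<..q'} \<inter> {p<..q}) * enn2real (box B A) * m2"
    using assms by (intro expectation_increment_mult_ordered) auto
  then show ?thesis by (simp add: mult.commute Int_commute box_eq A B)
qed

end

section \<open>The isometry of the Walsh integral\<close>

context correlation_kernel
begin

lemma enform_sum_finite:
  assumes "\<And>i. i \<in> I \<Longrightarrow> meas2 Q (a i)" "\<And>i. i \<in> I \<Longrightarrow> enform Q (a i) (a i) < \<infinity>"
  shows "enform Q (\<lambda>q y. \<Sum>i\<in>I. a i q y) (\<lambda>q y. \<Sum>i\<in>I. a i q y) < \<infinity>"
  using assms
proof (induction I rule: infinite_finite_induct)
  case (insert i I)
  let ?s = "\<lambda>q y. \<Sum>i\<in>I. a i q y"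
  have m [measurable]: "meas2 Q (a i)" "meas2 Q ?s"
    using insert.prems by (auto simp: case_prod_beta' intro!: borel_measurable_sum)
  have fin: "enform Q (a i) (a i) < \<infinity>" "enform Q ?s ?s < \<infinity>"
    using insert by auto
  let ?t = "\<lambda>q y. a i q y + ?s q y"
  have mt: "meas2 Q ?t" by measurable
  have "enform Q ?t ?t \<le> enform Q ?t (a i) + enform Q ?t ?s"
    by (rule enform_add_le(1)[OF mt m])
  also have "\<dots> \<le> (enform Q (a i) (a i) + enform Q ?s (a i)) + (enform Q (a i) ?s + enform Q ?s ?s)"
    by (intro add_mono enform_add_le(2) m)
  also have "\<dots> < \<infinity>"
    using fin enform_finite[OF m fin] enform_finite[OF m(2,1) fin(2,1)] by simp
  finally show ?case using insert by simp
qed (simp_all add: enform_def)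

lemma enform_mono:
  assumes "\<And>q y. q \<in> space Q \<Longrightarrow> \<bar>a q y\<bar> \<le> \<bar>b q y\<bar>"
  shows "enform Q a a \<le> enform Q b b"
  unfolding enform_def
  by (intro nn_integral_mono mult_right_mono ennreal_leI) (auto simp: abs_mult intro!: mult_mono assms)

end

context colored_noise
begin

abbreviation Q :: "('w \<times> real) measure" where "Q \<equiv> P \<Otimes>\<^sub>M lborel"

text \<open>Cut off to \<open>(0,t]\<close>, the interval for which
  \<open>has_walsh_integral\<close> demands predictability. The norm is taken over
  \<open>[0,t]\<close>, but the single instant 0 has no mass.\<close>

definition hat :: "real \<Rightarrow> (real \<Rightarrow> real \<Rightarrow> 'w \<Rightarrow> real) \<Rightarrow> 'w \<times> real \<Rightarrow> real \<Rightarrow> real" where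
  "hat t g q y = indicator {0<..t} (snd q) * g (snd q) y (fst q)"

lemma sigma_finite_Q: "sigma_finite_measure Q"
proof -
  interpret pair_sigma_finite P "lborel :: real measure"
    by (simp add: pair_sigma_finite_def sigma_finite_lborel sigma_finite_measure_axioms)
  show ?thesis by (rule P.sigma_finite_measure_axioms)
qed

lemma elementary_measurable:
  assumes "(Y, a, b, A) \<in> elementaries (noise_filtration P N)"
  shows "Y \<in> borel_measurable P"
proof -
  have "Y \<in> borel_measurable (noise_filtration P N a)" using assms by (simp add: elementaries_def)
  from measurable_historyD[OF filtration_history[OF this]] show ?thesis .
qed

text \<open>The predictable field lives on non-negative times. Its generators are jointly measurable
  for the product structure there, and extension by zero carries this to all times, as Fubini
  arguments over \<open>lborel\<close> require.\<close>

lemma predictable_measurable: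
  assumes "predictable P (noise_filtration P N) g"
  shows "(\<lambda>((\<omega>, s), y). indicator {0..} s * g s y \<omega>) \<in> borel_measurable (Q \<Otimes>\<^sub>M lborel)"
proof -
  let ?S = "{p\<in>space (Q \<Otimes>\<^sub>M lborel). 0 \<le> snd (fst p)}"
  let ?R = "restrict_space (Q \<Otimes>\<^sub>M (lborel :: real measure)) ?S"
  let ?\<phi> = "\<lambda>p :: ('w \<times> real) \<times> real. (fst (fst p), snd (fst p), snd p)"
  have S: "?S \<in> sets (Q \<Otimes>\<^sub>M lborel)" by measurable
  have "?\<phi> \<in> measurable ?R (predictable_sigma P (noise_filtration P N))"
    unfolding predictable_sigma_def
  proof (rule measurable_measure_of)
    show "?\<phi> \<in> space ?R \<rightarrow> space P \<times> {0..} \<times> UNIV"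
      by (auto simp: space_restrict_space space_pair_measure)
    fix G assume "G \<in> {(\<lambda>(\<omega>, t, x). elementary_process E t x \<omega>) -` C \<inter> (space P \<times> {0..} \<times> UNIV) | E C.
        E \<in> elementaries (noise_filtration P N) \<and> C \<in> sets borel}"
    then obtain Y a b A C where G: "G = (\<lambda>(\<omega>, t, x). elementary_process (Y, a, b, A) t x \<omega>) -` C \<inter> (space P \<times> {0..} \<times> UNIV)"
      and E: "(Y, a, b, A) \<in> elementaries (noise_filtration P N)" and C: "C \<in> sets borel" by auto
    have [measurable]: "Y \<in> borel_measurable P" "A \<in> sets borel"
      using elementary_measurable[OF E] E by (auto simp: elementaries_def)
    have "(\<lambda>p. Y (fst (fst p)) * indicator {a<..b} (snd (fst p)) * indicator A (snd p)) \<in> borel_measurable (Q \<Otimes>\<^sub>M lborel)"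
      by measurable
    then have "(\<lambda>p. Y (fst (fst p)) * indicator {a<..b} (snd (fst p)) * indicator A (snd p)) \<in> borel_measurable ?R"
      by (rule measurable_restrict_space1)
    from measurable_sets[OF this C]
    show "?\<phi> -` G \<inter> space ?R \<in> sets ?R"
      by (rule back_subst[where P="\<lambda>X. X \<in> sets ?R"])
        (auto simp: G elementary_process_def space_restrict_space space_pair_measure)
  qed (auto intro: sets.sets_into_space)
  from measurable_compose[OF this assms[unfolded predictable_def]]
  have "(\<lambda>p. g (snd (fst p)) (snd p) (fst (fst p))) \<in> borel_measurable ?R" by simp
  then have "(\<lambda>p. indicator ?S p *\<^sub>R g (snd (fst p)) (snd p) (fst (fst p))) \<in> borel_measurable (Q \<Otimes>\<^sub>M lborel)"
    by (subst (asm) borel_measurable_restrict_space_iff) (use S in \<open>auto simp: Int_absorb2\<close>)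
  then show ?thesis
    by (rule measurable_cong[THEN iffD1, rotated]) (auto simp: indicator_def)
qed

lemma meas2_hat:
  assumes "predictable P (noise_filtration P N) (\<lambda>s x \<omega>. indicator {0<..t} s * g s x \<omega>)"
  shows "meas2 Q (hat t g)"
  using predictable_measurable[OF assms]
  by (rule measurable_cong[THEN iffD1, rotated]) (auto simp: indicator_def hat_def)

lemma walsh_norm_sq_eq_enform:
  assumes [measurable]: "meas2 Q (hat t g)"
  shows "walsh_norm_sq P f t g = enform Q (hat t g) (hat t g)"
proof -
  let ?h = "\<lambda>q. \<integral>\<^sup>+y. \<integral>\<^sup>+y'. ennreal \<bar>hat t g q y * hat t g q y'\<bar> * f (y - y') \<partial>lborel \<partial>lborel"
  have "walsh_norm_sq P f t g = (\<integral>\<^sup>+\<omega>. \<integral>\<^sup>+s. ?h (\<omega>, s) \<partial>lborel \<partial>P)"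
    unfolding walsh_norm_sq_def
  proof (rule nn_integral_cong, rule nn_integral_cong_AE)
    fix \<omega> assume "\<omega> \<in> space P"
    show "AE s in lborel. (\<integral>\<^sup>+x. \<integral>\<^sup>+y. ennreal \<bar>g s x \<omega> * g s y \<omega>\<bar> * f (x - y) \<partial>lborel \<partial>lborel) * indicator {0..t} s = ?h (\<omega>, s)"
      using AE_lborel_singleton[of 0]
    proof eventually_elim
      case (elim s)
      show ?case
      proof (cases "s \<in> {0<..t}")
        case True then show ?thesis by (simp add: hat_def)
      next
        case False with elim show ?thesis by (simp add: hat_def)
      qed
    qed
  qed
  also have "\<dots> = enform Q (hat t g) (hat t g)"
    unfolding enform_def by (rule lborel.nn_integral_fst) measurable
  finally show ?thesis .
qed

section \<open>Bounded elementary processes and their integrals\<close>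

definition good_elementary :: "'w elementary \<Rightarrow> bool" where
  "good_elementary e \<longleftrightarrow> e \<in> elementaries (noise_filtration P N) \<and> bounded (fst e ` space P)"

lemma good_elementaryE:
  assumes "good_elementary e"
  obtains Y a b A c where "e = (Y, a, b, A)" "0 \<le> a" "a < b" "bounded_borel A"
    "Y \<in> borel_measurable (noise_filtration P N a)" "Y \<in> borel_measurable P" "\<And>\<omega>. \<omega> \<in> space P \<Longrightarrow> \<bar>Y \<omega>\<bar> \<le> c"
proof -
  obtain Y a b A where e: "e = (Y, a, b, A)" by (cases e)
  have el: "(Y, a, b, A) \<in> elementaries (noise_filtration P N)"
    using assms unfolding good_elementary_def e by (rule conjunct1)
  have "bounded (Y ` space P)" using assms unfolding good_elementary_def e by simp
  then obtain c where c: "\<forall>y\<in>Y ` space P. norm y \<le> c" unfolding bounded_iff by blast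
  show ?thesis
  proof (rule that)
    show "e = (Y, a, b, A)" by fact
    show "Y \<in> borel_measurable P" by (rule elementary_measurable[OF el])
    show "\<bar>Y \<omega>\<bar> \<le> c" if "\<omega> \<in> space P" for \<omega> using c that by simp
  qed (use el in \<open>simp_all add: elementaries_def\<close>)
qed

text \<open>Because \<open>0 \<le> a\<close>, cutting \<open>(a,b]\<close> to \<open>(0,t]\<close>
  gives the interval between \<open>min t a\<close> and \<open>min t b\<close>, exactly the times at
  which \<open>elementary_integral\<close> reads the noise; it is empty for
  \<open>t \<le> a\<close>.\<close>

lemma hat_elementary:
  assumes "0 \<le> a"
  shows "hat t (elementary_process (Y, a, b, A)) = (\<lambda>(\<omega>, s) y. Y \<omega> * indicator {min t a<..min t b} s * indicator A y)"
  using assms by (auto simp: hat_def elementary_process_def fun_eq_iff indicator_def)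

lemma meas2_hat_elementary:
  assumes "good_elementary e" shows "meas2 Q (hat t (elementary_process e))"
proof -
  obtain Y a b A c where e: "e = (Y, a, b, A)" "0 \<le> a" "a < b" "bounded_borel A"
    "Y \<in> borel_measurable (noise_filtration P N a)" "Y \<in> borel_measurable P"
    and c: "\<And>\<omega>. \<omega> \<in> space P \<Longrightarrow> \<bar>Y \<omega>\<bar> \<le> c"
    using assms by (rule good_elementaryE) blast
  then have [measurable]: "A \<in> sets borel" "Y \<in> borel_measurable P" by auto
  show ?thesis unfolding e(1) hat_elementary[OF e(2)] case_prod_beta' by measurable
qed

lemma enform_hat_elementary_finite:
  assumes "good_elementary e"
  shows "enform Q (hat t (elementary_process e)) (hat t (elementary_process e)) < \<infinity>"
proof -
  obtain Y a b A c where e: "e = (Y, a, b, A)" "0 \<le> a" "a < b" "bounded_borel A"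
    "Y \<in> borel_measurable (noise_filtration P N a)" "Y \<in> borel_measurable P"
    and c: "\<And>\<omega>. \<omega> \<in> space P \<Longrightarrow> \<bar>Y \<omega>\<bar> \<le> c"
    using assms by (rule good_elementaryE) blast
  have [measurable]: "A \<in> sets borel" using e(4) by auto
  let ?I = "{min t a<..min t b}"
  have "enform Q (hat t (elementary_process e)) (hat t (elementary_process e)) \<le>
    enform Q (\<lambda>(\<omega>, s) y. c * indicator ?I s * indicator A y) (\<lambda>(\<omega>, s) y. c * indicator ?I s * indicator A y)"
    unfolding e(1) hat_elementary[OF e(2)]
    by (intro enform_mono)
      (auto simp: space_pair_measure abs_mult intro!: mult_right_mono order_trans[OF c abs_ge_self])
  also have "\<dots> = (\<integral>\<^sup>+(\<omega>, s). \<integral>\<^sup>+y. \<integral>\<^sup>+y'. ennreal (c * c * indicator ?I s) *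
      (indicator A y * indicator A y' * f (y - y')) \<partial>lborel \<partial>lborel \<partial>Q)"
    unfolding enform_def
    by (intro nn_integral_cong, clarsimp, intro nn_integral_cong) (auto simp: indicator_def abs_mult)
  also have "\<dots> = (\<integral>\<^sup>+(\<omega>, s). ennreal (c * c * indicator ?I s) * box A A \<partial>Q)"
    unfolding box_def by (simp add: nn_integral_cmult case_prod_beta')
  also have "\<dots> = (\<integral>\<^sup>+q. (ennreal (c * c) * box A A) * indicator ?I (snd q) \<partial>Q)"
    by (intro nn_integral_cong) (auto simp: indicator_def split: prod.split)
  also have "\<dots> = (\<integral>\<^sup>+\<omega>. \<integral>\<^sup>+s. (ennreal (c * c) * box A A) * indicator ?I s \<partial>lborel \<partial>P)"
    by (subst lborel.nn_integral_fst[symmetric]) auto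
  also have "\<dots> = (ennreal (c * c) * box A A) * emeasure lborel ?I"
    by (simp add: nn_integral_cmult_indicator emeasure_space_1)
  also have "\<dots> < \<infinity>"
    using box_finite[OF e(4,4)] emeasure_bounded_finite[of ?I] by (simp add: ennreal_mult_less_top)
  finally show ?thesis .
qed

lemmas enform_hat_elementary_mixed_finite =
  enform_finite[OF meas2_hat_elementary meas2_hat_elementary enform_hat_elementary_finite enform_hat_elementary_finite]

text \<open>The factors are those of \<open>expectation_increment_mult\<close> except for
  \<open>m2\<close>, which is how the constant of the isometry arises.\<close>

lemma form_hat_elementary:
  assumes g: "good_elementary (Y, a, b, A)" and g': "good_elementary (Y', a', b', A')"
  shows "form Q (hat t (elementary_process (Y, a, b, A))) (hat t' (elementary_process (Y', a', b', A'))) =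
    expectation (\<lambda>\<omega>. Y \<omega> * Y' \<omega>) * measure lborel ({min t a<..min t b} \<inter> {min t' a'<..min t' b'}) * enn2real (box A A')"
proof -
  let ?a = "hat t (elementary_process (Y, a, b, A))" and ?b = "hat t' (elementary_process (Y', a', b', A'))"
  let ?I = "{min t a<..min t b} \<inter> {min t' a'<..min t' b'}"
  obtain Y1 a1 b1 A1 c where "(Y, a, b, A) = (Y1, a1, b1, A1)" "0 \<le> a1" "a1 < b1" "bounded_borel A1"
    "Y1 \<in> borel_measurable (noise_filtration P N a1)" "Y1 \<in> borel_measurable P"
    "\<And>\<omega>. \<omega> \<in> space P \<Longrightarrow> \<bar>Y1 \<omega>\<bar> \<le> c"
    using g by (rule good_elementaryE) blast
  then have e: "0 \<le> a" "bounded_borel A" "Y \<in> borel_measurable P" "\<And>\<omega>. \<omega> \<in> space P \<Longrightarrow> \<bar>Y \<omega>\<bar> \<le> c"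
    by simp_all
  obtain Y1 a1 b1 A1 c' where "(Y', a', b', A') = (Y1, a1, b1, A1)" "0 \<le> a1" "a1 < b1" "bounded_borel A1"
    "Y1 \<in> borel_measurable (noise_filtration P N a1)" "Y1 \<in> borel_measurable P"
    "\<And>\<omega>. \<omega> \<in> space P \<Longrightarrow> \<bar>Y1 \<omega>\<bar> \<le> c'"
    using g' by (rule good_elementaryE) blast
  then have e': "0 \<le> a'" "bounded_borel A'" "Y' \<in> borel_measurable P" "\<And>\<omega>. \<omega> \<in> space P \<Longrightarrow> \<bar>Y' \<omega>\<bar> \<le> c'"
    by simp_all
  have [measurable]: "Y \<in> borel_measurable P" "Y' \<in> borel_measurable P" "A \<in> sets borel" "A' \<in> sets borel"
    using e(2,3) e'(2,3) by simp_all
  let ?g = "\<lambda>(\<omega>, s). (Y \<omega> * Y' \<omega>) * (indicator ?I s :: real)"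
  let ?h = "\<lambda>(y, y'). indicator A y * indicator A' y' * fr (y - y')"
  have ii: "integrable (Q \<Otimes>\<^sub>M (lborel \<Otimes>\<^sub>M lborel)) (\<lambda>(q, y, y'). ?a q y * ?b q y' * fr (y - y'))"
    by (rule form_integrable[OF meas2_hat_elementary[OF g] meas2_hat_elementary[OF g']
          enform_hat_elementary_mixed_finite[OF g g' g g']])
  have eq: "(\<lambda>(q, y, y'). ?a q y * ?b q y' * fr (y - y')) = (\<lambda>(q, p). ?g q * ?h p)"
    unfolding hat_elementary[OF e(1)] hat_elementary[OF e'(1)] by (auto simp: fun_eq_iff indicator_def)
  have "form Q ?a ?b = (LINT q|Q. ?g q) * (LINT p|(lborel \<Otimes>\<^sub>M lborel). ?h p)"
    unfolding form_def eq
    by (rule integral_product_functions[OF sigma_finite_Q sigma_finite_lborel_pair ii[unfolded eq]])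
  also have "(LINT q|Q. ?g q) = expectation (\<lambda>\<omega>. Y \<omega> * Y' \<omega>) * (LINT s|lborel. indicator ?I s)"
  proof (rule integral_product_functions[OF sigma_finite_measure_axioms sigma_finite_lborel])
    have "integrable Q (\<lambda>q. indicator (space P \<times> ?I) q *\<^sub>R (\<bar>c\<bar> * \<bar>c'\<bar>))"
      using emeasure_bounded_finite[of "{max (min t a) (min t' a')<..min (min t b) (min t' b')}"]
      by (intro integrable_indicator)
        (auto simp: lborel.emeasure_pair_measure_Times emeasure_space_1 intro!: pair_measureI)
    then show "integrable Q ?g"
    proof (rule Bochner_Integration.integrable_bound)
      have "\<bar>Y \<omega>\<bar> * \<bar>Y' \<omega>\<bar> \<le> \<bar>c\<bar> * \<bar>c'\<bar>" if "\<omega> \<in> space P" for \<omega>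
        using e(4)[OF that] e'(4)[OF that] by (intro mult_mono) auto
      then show "AE q in Q. norm (?g q) \<le> norm (indicator (space P \<times> ?I) q *\<^sub>R (\<bar>c\<bar> * \<bar>c'\<bar>))"
        by (intro AE_I2) (auto simp: space_pair_measure indicator_def abs_mult)
    qed measurable
  qed
  also have "(LINT p|(lborel \<Otimes>\<^sub>M lborel). ?h p) = enn2real (box A A')"
  proof -
    have "box A A' = (\<integral>\<^sup>+y. \<integral>\<^sup>+y'. ennreal (?h (y, y')) \<partial>lborel \<partial>lborel)"
      unfolding box_def
    proof (rule nn_integral_cong)
      fix y
      have "(\<integral>\<^sup>+y'. indicator A y * indicator A' y' * f (y - y') \<partial>lborel) =
        (\<integral>\<^sup>+y'. ennreal (indicator A y * indicator A' y') * f (y - y') \<partial>lborel)"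
        by (simp add: ennreal_mult ennreal_indicator)
      also have "\<dots> = (\<integral>\<^sup>+y'. ennreal (?h (y, y')) \<partial>lborel)"
        by (subst inner_eq_fr) (auto simp: ennreal_mult)
      finally show "(\<integral>\<^sup>+y'. indicator A y * indicator A' y' * f (y - y') \<partial>lborel) = (\<integral>\<^sup>+y'. ennreal (?h (y, y')) \<partial>lborel)" .
    qed
    also have "\<dots> = (\<integral>\<^sup>+p. ennreal (?h p) \<partial>(lborel \<Otimes>\<^sub>M lborel))"
      by (rule lborel.nn_integral_fst) measurable
    finally have "box A A' = (\<integral>\<^sup>+p. ennreal (?h p) \<partial>(lborel \<Otimes>\<^sub>M lborel))" .
    then show ?thesis by (subst integral_eq_nn_integral) auto
  qed
  finally show ?thesis by simp
qed

lemma elementary_integral_eq: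
  "elementary_integral X t (Y, a, b, A) \<omega> = Y \<omega> * increment (min t a) (min t b) A \<omega>"
  by (simp add: elementary_integral_def increment_def)

lemma square_integrable_elementary_integral:
  assumes "0 \<le> t" "good_elementary e"
  shows "square_integrable P (elementary_integral X t e)"
proof -
  obtain Y a b A c where e: "e = (Y, a, b, A)" "0 \<le> a" "a < b" "bounded_borel A"
    "Y \<in> borel_measurable (noise_filtration P N a)" "Y \<in> borel_measurable P"
    and c: "\<And>\<omega>. \<omega> \<in> space P \<Longrightarrow> \<bar>Y \<omega>\<bar> \<le> c"
    using assms(2) by (rule good_elementaryE) blast
  show ?thesis
    unfolding e(1) elementary_integral_eq[abs_def]
    using assms(1) e by (intro square_integrable_bounded_mult[OF _ e(6) c] square_integrable_increment) auto
qed

lemma expectation_elementary_integral: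
  assumes t: "0 \<le> t" and g: "good_elementary e"
  shows "expectation (elementary_integral X t e) = 0"
proof -
  obtain Y a b A c where e: "e = (Y, a, b, A)" "0 \<le> a" "a < b" "bounded_borel A"
    "Y \<in> borel_measurable (noise_filtration P N a)" "Y \<in> borel_measurable P"
    and c: "\<And>\<omega>. \<omega> \<in> space P \<Longrightarrow> \<bar>Y \<omega>\<bar> \<le> c"
    using g by (rule good_elementaryE) blast
  show ?thesis
  \<comment> \<open>For \<open>t < a\<close> the increment starts at \<open>t\<close>, where
    \<open>Y\<close> need not be measurable yet; but then it is empty.\<close>
  proof (cases "t < a")
    case True then show ?thesis unfolding e(1) elementary_integral_eq[abs_def] using e by (simp add: increment_def)
  next
    case False
    then have "min t a = a" by simp
    then show ?thesis unfolding e(1) elementary_integral_eq[abs_def]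
      using e c t False expectation_increment[of a "min t b" A Y c] by simp
  qed
qed

lemma expectation_elementary_integral_mult:
  assumes t: "0 \<le> t" "0 \<le> t'" and g: "good_elementary e" and g': "good_elementary e'"
  shows "expectation (\<lambda>\<omega>. elementary_integral X t e \<omega> * elementary_integral X t' e' \<omega>) =
    m2 * form Q (hat t (elementary_process e)) (hat t' (elementary_process e'))"
proof -
  obtain Y a b A c where e: "e = (Y, a, b, A)" "0 \<le> a" "a < b" "bounded_borel A"
    "Y \<in> borel_measurable (noise_filtration P N a)" "Y \<in> borel_measurable P"
    and c: "\<And>\<omega>. \<omega> \<in> space P \<Longrightarrow> \<bar>Y \<omega>\<bar> \<le> c"
    using g by (rule good_elementaryE) blast
  obtain Y' a' b' A' c' where e': "e' = (Y', a', b', A')" "0 \<le> a'" "a' < b'" "bounded_borel A'"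
    "Y' \<in> borel_measurable (noise_filtration P N a')" "Y' \<in> borel_measurable P"
    and c': "\<And>\<omega>. \<omega> \<in> space P \<Longrightarrow> \<bar>Y' \<omega>\<bar> \<le> c'"
    using g' by (rule good_elementaryE) blast
  have "expectation (\<lambda>\<omega>. elementary_integral X t e \<omega> * elementary_integral X t' e' \<omega>) =
    expectation (\<lambda>\<omega>. Y \<omega> * Y' \<omega>) * measure lborel ({min t a<..min t b} \<inter> {min t' a'<..min t' b'}) * enn2real (box A A') * m2"
  \<comment> \<open>If a horizon ends before the process starts, its weight need not be measurable
    at the truncated starting time and the increment formula is out of reach; both sides are then
    0.\<close>
  proof (cases "t < a \<or> t' < a'")
    case True
    then have z: "elementary_integral X t e \<omega> * elementary_integral X t' e' \<omega> = 0" for \<omega>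
      unfolding e(1) e'(1) using e(3) e'(3) by (auto simp: elementary_integral_eq increment_def)
    have d: "{min t a<..min t b} \<inter> {min t' a'<..min t' b'} = {}"
      using True by auto
    show ?thesis unfolding z d by simp
  next
    case False
    then have m: "min t a = a" "min t' a' = a'" by auto
    show ?thesis
      unfolding e(1) e'(1) elementary_integral_eq m
      by (rule expectation_increment_mult[OF e(2) _ e'(2) _ e(4) e'(4) e(5) c e'(5) c'])
        (use e(3) e'(3) t False in auto)
  qed
  then show ?thesis unfolding e(1) e'(1) form_hat_elementary[OF g[unfolded e(1)] g'[unfolded e'(1)]] by simp
qed

section \<open>Passage from elementary processes to Walsh integrals\<close>

definition walsh_approximates ::
  "(nat \<Rightarrow> nat \<Rightarrow> 'w elementary) \<Rightarrow> (nat \<Rightarrow> nat) \<Rightarrow> real \<Rightarrow> (real \<Rightarrow> real \<Rightarrow> 'w \<Rightarrow> real) \<Rightarrow> ('w \<Rightarrow> real) \<Rightarrow> bool" where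
  "walsh_approximates E k t g I \<longleftrightarrow> (\<forall>n. \<forall>i<k n. good_elementary (E n i)) \<and>
    (\<lambda>n. enform Q (\<lambda>q y. (\<Sum>i<k n. hat t (elementary_process (E n i)) q y) - hat t g q y)
        (\<lambda>q y. (\<Sum>i<k n. hat t (elementary_process (E n i)) q y) - hat t g q y)) \<longlonglongrightarrow> 0 \<and>
    tendsto_L2 P (\<lambda>n \<omega>. \<Sum>i<k n. elementary_integral X t (E n i) \<omega>) I"

lemma walsh_integrand:
  assumes w: "has_walsh_integral P (noise_filtration P N) f X g t I"
  shows "meas2 Q (hat t g)" "enform Q (hat t g) (hat t g) < \<infinity>"
proof -
  note W = w[unfolded has_walsh_integral_def]
  show m: "meas2 Q (hat t g)" by (rule meas2_hat[OF W[THEN conjunct1]])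
  show "enform Q (hat t g) (hat t g) < \<infinity>"
    using W[THEN conjunct2, THEN conjunct1] unfolding walsh_norm_sq_eq_enform[OF m] .
qed

lemma walsh_approximation:
  assumes t: "0 \<le> t" and w: "has_walsh_integral P (noise_filtration P N) f X g t I"
  shows "\<exists>E k. walsh_approximates E k t g I"
proof -
  note W = w[unfolded has_walsh_integral_def]
  note I = W[THEN conjunct2, THEN conjunct2, THEN conjunct1]
  note ex = W[THEN conjunct2, THEN conjunct2, THEN conjunct2]
  from ex obtain E :: "nat \<Rightarrow> 'w elementary list" where
    E0: "\<forall>n. \<forall>e\<in>set (E n). e \<in> elementaries (noise_filtration P N) \<and> bounded (fst e ` space P)"
    and n: "(\<lambda>n. walsh_norm_sq P f t (\<lambda>s x \<omega>. (\<Sum>e\<leftarrow>E n. elementary_process e s x \<omega>) - g s x \<omega>)) \<longlonglongrightarrow> 0"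
    and i: "(\<lambda>n. \<integral>\<^sup>+\<omega>. ennreal (((\<Sum>e\<leftarrow>E n. elementary_integral X t e \<omega>) - I \<omega>)\<^sup>2) \<partial>P) \<longlonglongrightarrow> 0"
    by (elim exE conjE) (rule that)
  have E: "good_elementary e" if "e \<in> set (E n)" for n e
    unfolding good_elementary_def by (rule bspec[OF spec[OF E0] that])
  note walsh_integrand(1)[OF w, measurable]
  let ?k = "\<lambda>n. length (E n)" and ?E = "\<lambda>n i. E n ! i"
  have good: "good_elementary (?E n i)" if "i < ?k n" for n i by (rule E[OF nth_mem[OF that]])
  have sums: "(\<Sum>e\<leftarrow>E n. F e) = (\<Sum>i<?k n. F (?E n i))" for F :: "'w elementary \<Rightarrow> real" and n
    by (simp add: sum_list_sum_nth atLeast0LessThan)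
  have hs: "hat t (\<lambda>s x \<omega>. (\<Sum>e\<leftarrow>E n. elementary_process e s x \<omega>) - g s x \<omega>) =
    (\<lambda>q y. (\<Sum>i<?k n. hat t (elementary_process (?E n i)) q y) - hat t g q y)" for n
    by (simp add: hat_def[abs_def] sums sum_distrib_left right_diff_distrib)
  have m: "meas2 Q (\<lambda>q y. (\<Sum>i<?k n. hat t (elementary_process (?E n i)) q y) - hat t g q y)" for n
    using meas2_hat_elementary[OF good] by (auto simp: case_prod_beta' intro!: borel_measurable_diff borel_measurable_sum)
  have "walsh_norm_sq P f t (\<lambda>s x \<omega>. (\<Sum>e\<leftarrow>E n. elementary_process e s x \<omega>) - g s x \<omega>) =
    enform Q (\<lambda>q y. (\<Sum>i<?k n. hat t (elementary_process (?E n i)) q y) - hat t g q y)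
        (\<lambda>q y. (\<Sum>i<?k n. hat t (elementary_process (?E n i)) q y) - hat t g q y)" for n
    using walsh_norm_sq_eq_enform[of t "\<lambda>s x \<omega>. (\<Sum>e\<leftarrow>E n. elementary_process e s x \<omega>) - g s x \<omega>"] m[of n]
    unfolding hs by simp
  with n have 1: "(\<lambda>n. enform Q (\<lambda>q y. (\<Sum>i<?k n. hat t (elementary_process (?E n i)) q y) - hat t g q y)
        (\<lambda>q y. (\<Sum>i<?k n. hat t (elementary_process (?E n i)) q y) - hat t g q y)) \<longlonglongrightarrow> 0" by simp
  have 2: "tendsto_L2 P (\<lambda>n \<omega>. \<Sum>i<?k n. elementary_integral X t (?E n i) \<omega>) I"
    using i I good t unfolding sums
    by (intro tendsto_L2I square_integrable_sum square_integrable_elementary_integral) auto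
  have "walsh_approximates ?E ?k t g I"
    unfolding walsh_approximates_def using good 1 2 by blast
  then show ?thesis by blast
qed

theorem walsh_integral_moments:
  assumes t: "0 \<le> t" and w: "has_walsh_integral P (noise_filtration P N) f X g t I"
  shows "square_integrable P I" "expectation I = 0"
proof -
  obtain E k where "walsh_approximates E k t g I" using walsh_approximation[OF assms] by blast
  then have good: "\<And>n i. i < k n \<Longrightarrow> good_elementary (E n i)"
    and lim: "tendsto_L2 P (\<lambda>n \<omega>. \<Sum>i<k n. elementary_integral X t (E n i) \<omega>) I"
    unfolding walsh_approximates_def by auto
  show "square_integrable P I" using lim by (simp add: tendsto_L2_def)
  have "expectation (\<lambda>\<omega>. \<Sum>i<k n. elementary_integral X t (E n i) \<omega>) = 0" for n
  proof -
    have "expectation (\<lambda>\<omega>. \<Sum>i<k n. elementary_integral X t (E n i) \<omega>) =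
      (\<Sum>i<k n. expectation (elementary_integral X t (E n i)))"
      using good t by (intro Bochner_Integration.integral_sum square_integrable_imp_integrable
          square_integrable_elementary_integral) auto
    then show ?thesis using good t by (simp add: expectation_elementary_integral)
  qed
  then show "expectation I = 0"
    using tendsto_L2_expectation[OF lim] LIMSEQ_unique[OF _ tendsto_const] by fastforce
qed

text \<open>Stated for mixed moments with two horizons, since covariances at different times are
  wanted. For elementary sums it is bilinear expansion; in the limit the left side follows the
  \<open>L2\<close> convergence of the integrals and the right side
  \<open>form_tendsto\<close>.\<close>

theorem walsh_isometry:
  assumes t: "0 \<le> t" "0 \<le> t'" and w: "has_walsh_integral P (noise_filtration P N) f X g t I"
    and w': "has_walsh_integral P (noise_filtration P N) f X g' t' I'"
  shows "expectation (\<lambda>\<omega>. I \<omega> * I' \<omega>) = m2 * form Q (hat t g) (hat t' g')"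
proof -
  note m = walsh_integrand[OF w] and m' = walsh_integrand[OF w']
  obtain E k where E: "walsh_approximates E k t g I" using walsh_approximation[OF t(1) w] by blast
  then have good: "\<And>n i. i < k n \<Longrightarrow> good_elementary (E n i)" unfolding walsh_approximates_def by simp
  note n = E[unfolded walsh_approximates_def, THEN conjunct2, THEN conjunct1]
    and lim = E[unfolded walsh_approximates_def, THEN conjunct2, THEN conjunct2]
  obtain E' k' where E': "walsh_approximates E' k' t' g' I'" using walsh_approximation[OF t(2) w'] by blast
  then have good': "\<And>n i. i < k' n \<Longrightarrow> good_elementary (E' n i)" unfolding walsh_approximates_def by simp
  note n' = E'[unfolded walsh_approximates_def, THEN conjunct2, THEN conjunct1]
    and lim' = E'[unfolded walsh_approximates_def, THEN conjunct2, THEN conjunct2]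
  let ?h = "\<lambda>n q y. \<Sum>i<k n. hat t (elementary_process (E n i)) q y"
  let ?h' = "\<lambda>n q y. \<Sum>i<k' n. hat t' (elementary_process (E' n i)) q y"
  have mh: "meas2 Q (?h n)" "meas2 Q (?h' n)" for n
    using meas2_hat_elementary[OF good] meas2_hat_elementary[OF good']
    by (auto simp: case_prod_beta' intro!: borel_measurable_sum)
  have fh: "enform Q (?h n) (?h n) < \<infinity>" "enform Q (?h' n) (?h' n) < \<infinity>" for n
    by (intro enform_sum_finite meas2_hat_elementary enform_hat_elementary_finite; simp add: good good')+
  have "(\<lambda>n. form Q (?h n) (?h' n)) \<longlonglongrightarrow> form Q (hat t g) (hat t' g')"
    by (rule form_tendsto[OF mh(1) m(1) mh(2) m'(1) m(2) m'(2) fh(1) fh(2) n n'])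
  then have 1: "(\<lambda>n. m2 * form Q (?h n) (?h' n)) \<longlonglongrightarrow> m2 * form Q (hat t g) (hat t' g')"
    by (intro tendsto_mult tendsto_const)
  have 2: "(\<lambda>n. expectation (\<lambda>\<omega>. (\<Sum>i<k n. elementary_integral X t (E n i) \<omega>) *
     (\<Sum>i<k' n. elementary_integral X t' (E' n i) \<omega>))) \<longlonglongrightarrow> expectation (\<lambda>\<omega>. I \<omega> * I' \<omega>)"
    by (rule tendsto_L2_inner[OF lim lim'])
  have "expectation (\<lambda>\<omega>. (\<Sum>i<k n. elementary_integral X t (E n i) \<omega>) *
     (\<Sum>i<k' n. elementary_integral X t' (E' n i) \<omega>)) = m2 * form Q (?h n) (?h' n)" for n
  proof -
    let ?c = "\<lambda>i j \<omega>. elementary_integral X t (E n i) \<omega> * elementary_integral X t' (E' n j) \<omega>"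
    have i: "integrable P (?c i j)" if "i < k n" "j < k' n" for i j
      using that good good' t by (intro square_integrable_mult square_integrable_elementary_integral) auto
    have "expectation (\<lambda>\<omega>. (\<Sum>i<k n. elementary_integral X t (E n i) \<omega>) *
       (\<Sum>i<k' n. elementary_integral X t' (E' n i) \<omega>)) = expectation (\<lambda>\<omega>. \<Sum>i<k n. \<Sum>j<k' n. ?c i j \<omega>)"
      by (simp add: sum_product)
    also have "\<dots> = (\<Sum>i<k n. expectation (\<lambda>\<omega>. \<Sum>j<k' n. ?c i j \<omega>))"
      using i by (intro Bochner_Integration.integral_sum Bochner_Integration.integrable_sum) auto
    also have "\<dots> = (\<Sum>i<k n. \<Sum>j<k' n. expectation (?c i j))"
      using i by (intro sum.cong refl Bochner_Integration.integral_sum) auto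
    also have "\<dots> = (\<Sum>i<k n. \<Sum>j<k' n. m2 * form Q (hat t (elementary_process (E n i))) (hat t' (elementary_process (E' n j))))"
      using good good' t by (intro sum.cong refl expectation_elementary_integral_mult) auto
    also have "\<dots> = m2 * (\<Sum>i<k n. form Q (hat t (elementary_process (E n i))) (?h' n))"
    proof -
      have "form Q (hat t (elementary_process (E n i))) (?h' n) =
        (\<Sum>j<k' n. form Q (hat t (elementary_process (E n i))) (hat t' (elementary_process (E' n j))))" if "i < k n" for i
        using that good good'
        by (intro form_sum_right meas2_hat_elementary enform_hat_elementary_mixed_finite) auto
      then show ?thesis by (simp add: sum_distrib_left)
    qed
    also have "(\<Sum>i<k n. form Q (hat t (elementary_process (E n i))) (?h' n)) = form Q (?h n) (?h' n)"
    proof (rule form_sum_left[symmetric])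
      show "meas2 Q (hat t (elementary_process (E n i)))" if "i \<in> {..<k n}" for i
        using that good by (intro meas2_hat_elementary) auto
      show "enform Q (hat t (elementary_process (E n i))) (?h' n) < \<infinity>" if "i \<in> {..<k n}" for i
      proof -
        have gi: "good_elementary (E n i)" using that good by simp
        show ?thesis
          by (rule enform_finite[OF meas2_hat_elementary[OF gi] mh(2) enform_hat_elementary_finite[OF gi] fh(2)])
      qed
    qed (rule mh)
    finally show ?thesis .
  qed
  with 1 2 show ?thesis using LIMSEQ_unique by force
qed

end

section \<open>The wave cone\<close>

text \<open>The bound \<open>B\<close> only guarantees that the supremum \<open>S\<close> is finite,
  so that \<open>S \<le> c + S / 2\<close> can be solved for \<open>S\<close>; it leaves no trace in
  the conclusion. This is why a bound of any quality, even one depending on the base point, is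
  enough to start.\<close>

lemma contraction_bound:
  fixes w :: "'a \<Rightarrow> real"
  assumes nn: "\<And>p. p \<in> A \<Longrightarrow> 0 \<le> w p" and B: "\<And>p. p \<in> A \<Longrightarrow> w p \<le> B"
    and step: "\<And>S. 0 \<le> S \<Longrightarrow> (\<And>p. p \<in> A \<Longrightarrow> w p \<le> S) \<Longrightarrow> (\<And>p. p \<in> A \<Longrightarrow> w p \<le> c + S / 2)"
    and p: "p \<in> A"
  shows "w p \<le> 2 * c"
proof -
  let ?S = "Sup (w ` A)"
  have bdd: "bdd_above (w ` A)" using B by (rule bdd_aboveI2)
  have le: "w q \<le> ?S" if "q \<in> A" for q using that bdd by (intro cSup_upper) auto
  then have "0 \<le> ?S" using nn[OF p] p by force
  then have "w q \<le> c + ?S / 2" if "q \<in> A" for q using step[of ?S q] le that by blast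
  then have "?S \<le> c + ?S / 2" using p by (intro cSup_least) auto
  then have "?S \<le> 2 * c" by simp
  with le[OF p] show ?thesis by simp
qed

context correlation_kernel
begin

definition wcone :: "real \<Rightarrow> real \<Rightarrow> real \<Rightarrow> real \<Rightarrow> real" where
  "wcone t x s y = indicator {0<..t} s * wave_kernel (t - s) (x - y)"

lemma wcone_eq: "wcone t x s y = (if 0 < s \<and> s \<le> t \<and> \<bar>x - y\<bar> < t - s then 1 / 2 else 0)"
  by (simp add: wcone_def wave_kernel_def indicator_def)

lemma wcone_nonneg [simp]: "0 \<le> wcone t x s y" by (simp add: wcone_eq)

lemma wcone_measurable [measurable]: "(\<lambda>(s, y). wcone t x s y) \<in> borel_measurable (lborel \<Otimes>\<^sub>M lborel)"
  unfolding wcone_eq by measurable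

text \<open>The constant comes from \<open>1 / 4 * (2 * T + 2 * T) = T\<close>: a factor
  \<open>1 / 2\<close> for each wave kernel and two self-energies over slices of length at most
  \<open>2 * T\<close>, whose points are at most \<open>2 * T\<close> apart.\<close>

definition cone_mass :: "real \<Rightarrow> real" where
  "cone_mass T = T * enn2real (corr_mass (2 * T))"

lemma cone_mass_nonneg: "0 \<le> T \<Longrightarrow> 0 \<le> cone_mass T" by (simp add: cone_mass_def)

text \<open>Positive definiteness bounds the mixed energy of two sets by their self-energies. The
  bound does not involve the distance between the sets, which makes the estimates for two cones
  uniform in their vertices.\<close>

lemma corr_form_am_gm:
  assumes [measurable]: "A \<in> sets borel" "B \<in> sets borel"
  shows "(\<integral>\<^sup>+y. \<integral>\<^sup>+y'. indicator A y * indicator B y' * f (y - y') \<partial>lborel \<partial>lborel) \<le>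
    (\<integral>\<^sup>+y. \<integral>\<^sup>+y'. indicator A y * indicator A y' * f (y - y') \<partial>lborel \<partial>lborel) +
    (\<integral>\<^sup>+y. \<integral>\<^sup>+y'. indicator B y * indicator B y' * f (y - y') \<partial>lborel \<partial>lborel)"
proof -
  let ?T = "\<lambda>A x. \<integral>\<^sup>+y. indicator A y * \<kappa> (x - y) \<partial>lborel"
  have "(\<integral>\<^sup>+x. ?T A x * ?T B x \<partial>lborel) \<le> (\<integral>\<^sup>+x. ?T A x * ?T A x + ?T B x * ?T B x \<partial>lborel)"
  proof (rule nn_integral_mono)
    fix x
    have "1 * (?T A x * ?T B x) \<le> 2 * (?T A x * ?T B x)" by (intro mult_right_mono) auto
    also have "\<dots> \<le> (?T A x)\<^sup>2 + (?T B x)\<^sup>2"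
      using sum_of_squares_ge_ennreal[of "?T A x" "?T B x"] by (simp add: mult.assoc)
    finally show "?T A x * ?T B x \<le> ?T A x * ?T A x + ?T B x * ?T B x" by (simp add: power2_eq_square)
  qed
  also have "\<dots> = (\<integral>\<^sup>+x. ?T A x * ?T A x \<partial>lborel) + (\<integral>\<^sup>+x. ?T B x * ?T B x \<partial>lborel)"
    by (rule nn_integral_add) measurable
  finally show ?thesis by (simp add: corr_form_eq)
qed

text \<open>At each fixed time the two slices are intervals; after the passage to self-energies only
  correlations at distance below \<open>2 * T\<close> matter, and these have finite mass.\<close>

lemma cone_energy_le:
  assumes T: "t \<le> T" "t' \<le> T"
  shows "(\<integral>\<^sup>+y. \<integral>\<^sup>+y'. ennreal \<bar>wcone t x s y * wcone t' x' s y'\<bar> * f (y - y') \<partial>lborel \<partial>lborel)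
    \<le> ennreal (cone_mass T) * indicator {0<..min t t'} s"
proof (cases "s \<in> {0<..min t t'}")
  case False
  then have z: "wcone t x s y * wcone t' x' s y' = 0" for y y' by (auto simp: wcone_eq)
  show ?thesis unfolding z by simp
next
  case True
  then have "0 \<le> T" using T by auto
  define A where "A x t = {y. \<bar>x - y\<bar> < t - s}" for x t
  have [measurable]: "A x t \<in> sets borel" for x t unfolding A_def by measurable
  have ab: "(\<integral>\<^sup>+y. \<integral>\<^sup>+y'. indicator (A x t) y * indicator (A x t) y' * f (y - y') \<partial>lborel \<partial>lborel)
    \<le> ennreal (2 * T) * corr_mass (2 * T)" if "t \<le> T" for x t
  proof -
    have "(\<integral>\<^sup>+y. \<integral>\<^sup>+y'. indicator (A x t) y * indicator (A x t) y' * f (y - y') \<partial>lborel \<partial>lborel)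
      \<le> emeasure lborel (A x t) * corr_mass (2 * T)"
      using that True by (intro corr_box_le) (auto simp: A_def)
    also have "emeasure lborel (A x t) \<le> emeasure lborel {x - T..x + T}"
      using that True by (intro emeasure_mono) (auto simp: A_def)
    also have "\<dots> = ennreal (2 * T)" using \<open>0 \<le> T\<close> by simp
    finally show ?thesis by (simp add: mult_right_mono)
  qed
  have "(\<integral>\<^sup>+y. \<integral>\<^sup>+y'. ennreal \<bar>wcone t x s y * wcone t' x' s y'\<bar> * f (y - y') \<partial>lborel \<partial>lborel) =
    (\<integral>\<^sup>+y. \<integral>\<^sup>+y'. ennreal (1 / 4) * (indicator (A x t) y * indicator (A x' t') y' * f (y - y')) \<partial>lborel \<partial>lborel)"
    using True by (intro nn_integral_cong) (auto simp: wcone_eq A_def indicator_def)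
  also have "\<dots> = ennreal (1 / 4) * (\<integral>\<^sup>+y. \<integral>\<^sup>+y'. indicator (A x t) y * indicator (A x' t') y' * f (y - y') \<partial>lborel \<partial>lborel)"
    by (simp add: nn_integral_cmult)
  also have "\<dots> \<le> ennreal (1 / 4) * (ennreal (2 * T) * corr_mass (2 * T) + ennreal (2 * T) * corr_mass (2 * T))"
    using T by (intro mult_left_mono order_trans[OF corr_form_am_gm] add_mono ab) auto
  also have "\<dots> = ennreal (cone_mass T)"
  proof -
    have m: "corr_mass (2 * T) = ennreal (enn2real (corr_mass (2 * T)))" using corr_mass_finite by simp
    show ?thesis
      unfolding cone_mass_def by (subst (1 2) m) (use \<open>0 \<le> T\<close> in \<open>simp add: ennreal_mult[symmetric] ennreal_plus[symmetric] del: ennreal_plus\<close>)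
  qed
  finally show ?thesis using True by simp
qed

abbreviation L3 :: "(real \<times> real \<times> real) measure" where "L3 \<equiv> lborel \<Otimes>\<^sub>M (lborel \<Otimes>\<^sub>M lborel)"

definition cone_form :: "(real \<Rightarrow> real \<Rightarrow> real \<Rightarrow> real) \<Rightarrow> real \<Rightarrow> real \<Rightarrow> real \<Rightarrow> real \<Rightarrow> real" where
  "cone_form J t x t' x' = (LINT (s, y, y')|L3. wcone t x s y * wcone t' x' s y' * J s y y' * fr (y - y'))"

lemma nn_integral_exp_le:
  assumes "0 < l" "0 \<le> S" "0 \<le> r"
  shows "(\<integral>\<^sup>+s. ennreal (S * exp (l * s)) * indicator {0<..r} s \<partial>lborel) \<le> ennreal (S / l * exp (l * r))"
proof -
  have "(\<integral>\<^sup>+s. ennreal (S * exp (l * s)) * indicator {0<..r} s \<partial>lborel) \<le>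
    (\<integral>\<^sup>+s. ennreal (S * exp (l * s)) * indicator {0..r} s \<partial>lborel)"
    by (intro nn_integral_mono) (auto simp: indicator_def)
  also have "\<dots> = ennreal (S / l * exp (l * r) - S / l * exp (l * 0))"
    using assms by (intro nn_integral_FTC_Icc) (auto intro!: derivative_eq_intros)
  also have "\<dots> \<le> ennreal (S / l * exp (l * r))" using assms by (intro ennreal_leI) simp
  finally show ?thesis .
qed

text \<open>An exponential weight in time turns the cone form into a contraction.\<close>

lemma cone_form_bound:
  assumes J: "(\<lambda>p. J (fst p) (fst (snd p)) (snd (snd p))) \<in> borel_measurable L3"
    and T: "0 \<le> t" "0 \<le> t'" "t \<le> T" "t' \<le> T" and "0 < l" "0 \<le> S"
    and le: "\<And>s y y'. 0 < s \<Longrightarrow> \<bar>x - y\<bar> < t - s \<Longrightarrow> \<bar>x' - y'\<bar> < t' - s \<Longrightarrow> \<bar>J s y y'\<bar> \<le> S * exp (l * s)"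
  shows "integrable L3 (\<lambda>(s, y, y'). wcone t x s y * wcone t' x' s y' * J s y y' * fr (y - y'))"
    and "\<bar>cone_form J t x t' x'\<bar> \<le> cone_mass T * (S / l * exp (l * min t t'))"
proof -
  let ?k = "\<lambda>(s, y, y'). wcone t x s y * wcone t' x' s y' * J s y y' * fr (y - y')"
  have "(\<lambda>p. wcone t x (fst p) (fst (snd p))) \<in> borel_measurable L3"
    "(\<lambda>p. wcone t' x' (fst p) (snd (snd p))) \<in> borel_measurable L3"
    "(\<lambda>p. fr (fst (snd p) - snd (snd p))) \<in> borel_measurable L3" by measurable
  with J have m: "?k \<in> borel_measurable L3"
    unfolding case_prod_beta' by (intro borel_measurable_times)
  have m': "(\<lambda>p. ennreal \<bar>?k p\<bar>) \<in> borel_measurable L3" by (rule measurable_compose[OF m]) simp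
  have "(\<integral>\<^sup>+p. ennreal \<bar>?k p\<bar> \<partial>L3) = (\<integral>\<^sup>+s. \<integral>\<^sup>+p. ennreal \<bar>?k (s, p)\<bar> \<partial>(lborel \<Otimes>\<^sub>M lborel) \<partial>lborel)"
    by (rule sigma_finite_measure.nn_integral_fst[OF sigma_finite_lborel_pair, symmetric, OF m'])
  also have "\<dots> = (\<integral>\<^sup>+s. \<integral>\<^sup>+y. \<integral>\<^sup>+y'. ennreal \<bar>?k (s, y, y')\<bar> \<partial>lborel \<partial>lborel \<partial>lborel)"
    by (intro nn_integral_cong lborel.nn_integral_fst[symmetric] measurable_compose[OF measurable_Pair1' m']) simp
  also have "\<dots> \<le> (\<integral>\<^sup>+s. \<integral>\<^sup>+y. \<integral>\<^sup>+y'. ennreal (S * exp (l * s)) *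
     (ennreal \<bar>wcone t x s y * wcone t' x' s y'\<bar> * ennreal (fr (y - y'))) \<partial>lborel \<partial>lborel \<partial>lborel)"
  proof (intro nn_integral_mono)
    fix s y y' :: real
    have "\<bar>?k (s, y, y')\<bar> \<le> S * exp (l * s) * (\<bar>wcone t x s y * wcone t' x' s y'\<bar> * fr (y - y'))"
    proof (cases "wcone t x s y * wcone t' x' s y' = 0")
      case False
      then have "\<bar>J s y y'\<bar> \<le> S * exp (l * s)" by (intro le) (auto simp: wcone_eq split: if_splits)
      then have "\<bar>J s y y'\<bar> * (\<bar>wcone t x s y * wcone t' x' s y'\<bar> * fr (y - y')) \<le>
        S * exp (l * s) * (\<bar>wcone t x s y * wcone t' x' s y'\<bar> * fr (y - y'))"
        by (intro mult_right_mono) auto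
      then show ?thesis by (simp add: abs_mult mult_ac)
    qed auto
    then have "ennreal \<bar>?k (s, y, y')\<bar> \<le> ennreal (S * exp (l * s) * (\<bar>wcone t x s y * wcone t' x' s y'\<bar> * fr (y - y')))"
      by (rule ennreal_leI)
    then show "ennreal \<bar>?k (s, y, y')\<bar> \<le> ennreal (S * exp (l * s)) *
     (ennreal \<bar>wcone t x s y * wcone t' x' s y'\<bar> * ennreal (fr (y - y')))"
      using \<open>0 \<le> S\<close> by (simp add: ennreal_mult)
  qed
  also have "\<dots> = (\<integral>\<^sup>+s. ennreal (S * exp (l * s)) *
     (\<integral>\<^sup>+y. \<integral>\<^sup>+y'. ennreal \<bar>wcone t x s y * wcone t' x' s y'\<bar> * f (y - y') \<partial>lborel \<partial>lborel) \<partial>lborel)"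
    by (simp add: nn_integral_cmult inner_eq_fr)
  also have "\<dots> \<le> (\<integral>\<^sup>+s. ennreal (S * exp (l * s)) * (ennreal (cone_mass T) * indicator {0<..min t t'} s) \<partial>lborel)"
    by (intro nn_integral_mono mult_left_mono cone_energy_le T) auto
  also have "\<dots> = ennreal (cone_mass T) * (\<integral>\<^sup>+s. ennreal (S * exp (l * s)) * indicator {0<..min t t'} s \<partial>lborel)"
    by (subst nn_integral_cmult[symmetric]) (auto simp: mult_ac)
  also have "\<dots> \<le> ennreal (cone_mass T) * ennreal (S / l * exp (l * min t t'))"
    using assms by (intro mult_left_mono nn_integral_exp_le) auto
  also have "\<dots> = ennreal (cone_mass T * (S / l * exp (l * min t t')))"
    using assms by (subst ennreal_mult) (auto intro: cone_mass_nonneg)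
  finally have b: "(\<integral>\<^sup>+p. ennreal \<bar>?k p\<bar> \<partial>L3) \<le> ennreal (cone_mass T * (S / l * exp (l * min t t')))" .
  then have "(\<integral>\<^sup>+p. ennreal (norm (?k p)) \<partial>L3) < \<infinity>" by (auto intro: le_less_trans)
  with m show i: "integrable L3 ?k" by (rule integrableI_bounded)
  have "ennreal \<bar>cone_form J t x t' x'\<bar> \<le> (\<integral>\<^sup>+p. ennreal \<bar>?k p\<bar> \<partial>L3)"
    using integral_norm_bound_ennreal[OF i] unfolding cone_form_def real_norm_def .
  also note b
  finally show "\<bar>cone_form J t x t' x'\<bar> \<le> cone_mass T * (S / l * exp (l * min t t'))"
    using assms cone_mass_nonneg[of T] by (subst (asm) ennreal_le_iff) auto
qed

text \<open>Translation invariance of Lebesgue measure. If \<open>k\<close> is not measurable,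
  neither is its translate, and both integrals are 0 by convention, so \<open>k\<close> can be
  arbitrary.\<close>

lemma L3_shift:
  fixes k :: "real \<times> real \<times> real \<Rightarrow> real"
  shows "(LINT p|L3. k p) = (LINT (s, y, y')|L3. k (s, y + a, y' + b))"
proof -
  have "(LINT p|lborel. k p) = (LINT p|lborel. k ((0, a, b) + p))"
  proof (cases "k \<in> borel_measurable borel")
    case True
    have "(LINT p|lborel. k p) = (LINT p|distr lborel borel ((+) (0, a, b)). k p)" by (simp add: lborel_distr_plus)
    also have "\<dots> = (LINT p|lborel. k ((0, a, b) + p))" using True by (subst integral_distr) auto
    finally show ?thesis .
  next
    case False
    have "(\<lambda>p. k ((0, a, b) + p)) \<notin> borel_measurable borel"
    proof
      assume "(\<lambda>p. k ((0, a, b) + p)) \<in> borel_measurable borel"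
      from measurable_compose[OF _ this, of "\<lambda>p. p - (0, a, b)" borel] have "k \<in> borel_measurable borel" by simp
      with False show False by simp
    qed
    then have "\<not> integrable lborel (\<lambda>p. k ((0, a, b) + p))" "\<not> integrable lborel k"
      using False borel_measurable_integrable by force+
    then show ?thesis by (simp add: not_integrable_integral_eq)
  qed
  then show ?thesis unfolding lborel_prod by (simp add: case_prod_beta' plus_prod_def add.commute)
qed

lemma wcone_shift: "wcone t (x + a) s (y + a) = wcone t x s y" by (simp add: wcone_eq)

lemma cone_form_shift:
  "cone_form J t (x + a) t' (x' + b) = (LINT (s, y, y')|L3. wcone t x s y * wcone t' x' s y' * J s (y + a) (y' + b) * fr (y + a - (y' + b)))"
  unfolding cone_form_def by (subst L3_shift[of _ a b]) (simp add: wcone_shift)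

end

section \<open>Second moments of the mild solution\<close>

lemma exp_weight_le_iff: "exp (- c * s) * a \<le> S \<longleftrightarrow> a \<le> S * exp (c * s)" for a c s S :: real
  by (simp add: exp_minus field_simps)

locale mild_noise = colored_noise \<kappa> P N \<nu> X
  for \<kappa> :: "real \<Rightarrow> ennreal" and P :: "'w measure" and N \<nu> X +
  fixes u :: "real \<Rightarrow> real \<Rightarrow> 'w \<Rightarrow> real"
  assumes mild: "mild_solution P N \<kappa> X u"
begin

section \<open>The solution as a Walsh integral\<close>

definition integrand :: "real \<Rightarrow> real \<Rightarrow> real \<Rightarrow> real \<Rightarrow> 'w \<Rightarrow> real" where
  "integrand t x = (\<lambda>s y \<omega>. wave_kernel (t - s) (x - y) * u s y \<omega>)"

text \<open>Extended by zero to negative times, where the solution is not determined, so that it is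
  jointly measurable for Lebesgue measure on the whole time axis.\<close>

definition u0 :: "'w \<times> real \<Rightarrow> real \<Rightarrow> real" where
  "u0 q y = indicator {0..} (snd q) * u (snd q) y (fst q)"

lemma meas2_u0: "meas2 Q u0"
proof -
  have "predictable P (noise_filtration P N) u" using mild by (simp add: mild_solution_def)
  from predictable_measurable[OF this] show ?thesis by (simp add: u0_def[abs_def] case_prod_beta')
qed

lemma hat_integrand: "hat t (integrand t x) = (\<lambda>q y. wcone t x (snd q) y * u0 q y)"
  by (auto simp: hat_def integrand_def wcone_def u0_def fun_eq_iff indicator_def)

lemma measurable_u:
  assumes "0 \<le> t" shows "(\<lambda>(\<omega>, x). u t x \<omega>) \<in> borel_measurable (P \<Otimes>\<^sub>M lborel)"
proof -
  have "(\<lambda>p. case_prod u0 ((fst p, t), snd p)) \<in> borel_measurable (P \<Otimes>\<^sub>M lborel)"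
    by (rule measurable_compose[OF _ meas2_u0]) measurable
  then show ?thesis using assms by (simp add: u0_def case_prod_beta')
qed

lemma measurable_u_section: "0 \<le> t \<Longrightarrow> u t x \<in> borel_measurable P"
  using measurable_compose[OF measurable_Pair2'[of x lborel P] measurable_u[of t]] by simp

lemma mild_integral:
  assumes "0 \<le> t"
  obtains I where "has_walsh_integral P (noise_filtration P N) f X (integrand t x) t I"
    "AE \<omega> in P. u t x \<omega> - 1 = I \<omega>"
proof -
  from mild assms obtain I where I: "has_walsh_integral P (noise_filtration P N) f X (integrand t x) t I"
    and ae: "AE \<omega> in P. u t x \<omega> = 1 + I \<omega>"
    unfolding mild_solution_def integrand_def by blast
  from ae have "AE \<omega> in P. u t x \<omega> - 1 = I \<omega>" by eventually_elim simp
  with I show ?thesis by (rule that)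
qed

lemma enform_integrand:
  assumes "0 \<le> t"
  shows "meas2 Q (hat t (integrand t x))" "enform Q (hat t (integrand t x)) (hat t (integrand t x)) < \<infinity>"
  using mild_integral[OF assms] walsh_integrand by metis+

lemma square_integrable_centered:
  assumes "0 \<le> t" shows "square_integrable P (\<lambda>\<omega>. u t x \<omega> - 1)"
proof -
  obtain I where w: "has_walsh_integral P (noise_filtration P N) f X (integrand t x) t I"
    and ae: "AE \<omega> in P. u t x \<omega> - 1 = I \<omega>" by (rule mild_integral[OF assms])
  have I: "square_integrable P I" by (rule walsh_integral_moments(1)[OF assms w])
  have m: "(\<lambda>\<omega>. u t x \<omega> - 1) \<in> borel_measurable P" using measurable_u_section[OF assms] by measurable
  have "integrable P (\<lambda>\<omega>. (u t x \<omega> - 1)\<^sup>2) \<longleftrightarrow> integrable P (\<lambda>\<omega>. (I \<omega>)\<^sup>2)"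
    using ae m I by (intro Bochner_Integration.integrable_cong_AE) (auto simp: square_integrable_def)
  with I m show ?thesis by (simp add: square_integrable_def)
qed

lemma square_integrable_u: "0 \<le> t \<Longrightarrow> square_integrable P (u t x)"
  using square_integrable_add[OF square_integrable_centered square_integrable_const[of 1]] by simp

lemma expectation_centered:
  assumes "0 \<le> t" shows "expectation (\<lambda>\<omega>. u t x \<omega> - 1) = 0"
proof -
  obtain I where w: "has_walsh_integral P (noise_filtration P N) f X (integrand t x) t I"
    and ae: "AE \<omega> in P. u t x \<omega> - 1 = I \<omega>" by (rule mild_integral[OF assms])
  have "I \<in> borel_measurable P"
    using walsh_integral_moments(1)[OF assms w] by (simp add: square_integrable_def)
  then have "expectation (\<lambda>\<omega>. u t x \<omega> - 1) = expectation I"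
    using ae measurable_u_section[OF assms] by (intro integral_cong_AE) auto
  then show ?thesis using walsh_integral_moments(2)[OF assms w] by simp
qed

lemma expectation_centered_mult:
  assumes t: "0 \<le> t" "0 \<le> t'"
  shows "expectation (\<lambda>\<omega>. (u t x \<omega> - 1) * (u t' x' \<omega> - 1)) =
    m2 * form Q (hat t (integrand t x)) (hat t' (integrand t' x'))"
proof -
  obtain I where w: "has_walsh_integral P (noise_filtration P N) f X (integrand t x) t I"
    and ae: "AE \<omega> in P. u t x \<omega> - 1 = I \<omega>" by (rule mild_integral[OF t(1)])
  obtain I' where w': "has_walsh_integral P (noise_filtration P N) f X (integrand t' x') t' I'"
    and ae': "AE \<omega> in P. u t' x' \<omega> - 1 = I' \<omega>" by (rule mild_integral[OF t(2)])
  have "I \<in> borel_measurable P" "I' \<in> borel_measurable P"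
    using walsh_integral_moments(1)[OF t(1) w] walsh_integral_moments(1)[OF t(2) w']
    by (auto simp: square_integrable_def)
  moreover have "AE \<omega> in P. (u t x \<omega> - 1) * (u t' x' \<omega> - 1) = I \<omega> * I' \<omega>"
    using ae ae' by eventually_elim simp
  ultimately have "expectation (\<lambda>\<omega>. (u t x \<omega> - 1) * (u t' x' \<omega> - 1)) = expectation (\<lambda>\<omega>. I \<omega> * I' \<omega>)"
    using measurable_u_section t by (intro integral_cong_AE) auto
  then show ?thesis using walsh_isometry[OF t w w'] by simp
qed

lemma expectation_u_mult:
  assumes t: "0 \<le> t" "0 \<le> t'"
  shows "expectation (\<lambda>\<omega>. u t x \<omega> * u t' x' \<omega>) = 1 + expectation (\<lambda>\<omega>. (u t x \<omega> - 1) * (u t' x' \<omega> - 1))"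
proof -
  let ?U = "\<lambda>\<omega>. u t x \<omega> - 1" and ?U' = "\<lambda>\<omega>. u t' x' \<omega> - 1"
  note sq = square_integrable_centered[OF t(1), of x] square_integrable_centered[OF t(2), of x']
  note i = square_integrable_mult[OF sq] square_integrable_imp_integrable[OF sq(1)] square_integrable_imp_integrable[OF sq(2)]
  have "expectation (\<lambda>\<omega>. u t x \<omega> * u t' x' \<omega>) = expectation (\<lambda>\<omega>. ?U \<omega> * ?U' \<omega> + (?U \<omega> + ?U' \<omega> + 1))"
    by (simp add: algebra_simps)
  also have "\<dots> = expectation (\<lambda>\<omega>. ?U \<omega> * ?U' \<omega>) + (expectation ?U + expectation ?U' + expectation (\<lambda>_. 1))"
  proof -
    note k = Bochner_Integration.integrable_add[OF i(2,3)]
    have "integrable P (\<lambda>_. 1 :: real)" by simp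
    from Bochner_Integration.integral_add[OF i(1) Bochner_Integration.integrable_add[OF k this]]
      Bochner_Integration.integral_add[OF k this] Bochner_Integration.integral_add[OF i(2,3)]
    show ?thesis by (simp only:)
  qed
  also have "\<dots> = 1 + expectation (\<lambda>\<omega>. ?U \<omega> * ?U' \<omega>)"
    by (simp only: expectation_centered[OF t(1)] expectation_centered[OF t(2)]) (simp add: prob_space)
  finally show ?thesis .
qed

section \<open>The closed equation for the second moments\<close>

definition J :: "real \<Rightarrow> real \<Rightarrow> real \<Rightarrow> real" where
  "J s y y' = expectation (\<lambda>\<omega>. u0 (\<omega>, s) y * u0 (\<omega>, s) y')"

lemma J_eq: "0 \<le> s \<Longrightarrow> J s y y' = expectation (\<lambda>\<omega>. u s y \<omega> * u s y' \<omega>)"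
  by (simp add: J_def u0_def)

lemma J_measurable: "(\<lambda>p. J (fst p) (fst (snd p)) (snd (snd p))) \<in> borel_measurable L3"
proof -
  have "(\<lambda>z. case_prod u0 ((snd z, fst (fst z)), fst (snd (fst z)))) \<in> borel_measurable (L3 \<Otimes>\<^sub>M P)"
    by (rule measurable_compose[OF _ meas2_u0]) measurable
  moreover have "(\<lambda>z. case_prod u0 ((snd z, fst (fst z)), snd (snd (fst z)))) \<in> borel_measurable (L3 \<Otimes>\<^sub>M P)"
    by (rule measurable_compose[OF _ meas2_u0]) measurable
  ultimately have "(\<lambda>(p, \<omega>). u0 (\<omega>, fst p) (fst (snd p)) * u0 (\<omega>, fst p) (snd (snd p))) \<in> borel_measurable (L3 \<Otimes>\<^sub>M P)"
    by (simp add: case_prod_beta')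
  then show ?thesis unfolding J_def by (rule borel_measurable_lebesgue_integral)
qed

lemma J_nonneg_diag: "0 \<le> J s y y" unfolding J_def by (rule Bochner_Integration.integral_nonneg) simp

lemma J_abs_le:
  assumes "0 \<le> s" shows "\<bar>J s y y'\<bar> \<le> (J s y y + J s y' y') / 2"
proof -
  note sq = square_integrable_u[OF assms, of y] square_integrable_u[OF assms, of y']
  note i = square_integrable_mult[OF sq] square_integrable_mult[OF sq(1,1)] square_integrable_mult[OF sq(2,2)]
  have "\<bar>J s y y'\<bar> \<le> expectation (\<lambda>\<omega>. \<bar>u s y \<omega> * u s y' \<omega>\<bar>)"
    unfolding J_eq[OF assms] by (rule integral_abs_bound)
  also have "\<dots> \<le> expectation (\<lambda>\<omega>. (u s y \<omega> * u s y \<omega> + u s y' \<omega> * u s y' \<omega>) / 2)"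
  proof (rule integral_mono)
    fix \<omega>
    have "2 * (\<bar>u s y \<omega>\<bar> * \<bar>u s y' \<omega>\<bar>) \<le> \<bar>u s y \<omega>\<bar>\<^sup>2 + \<bar>u s y' \<omega>\<bar>\<^sup>2"
      using sum_squares_bound[of "\<bar>u s y \<omega>\<bar>" "\<bar>u s y' \<omega>\<bar>"] by (simp add: mult.assoc)
    then show "\<bar>u s y \<omega> * u s y' \<omega>\<bar> \<le> (u s y \<omega> * u s y \<omega> + u s y' \<omega> * u s y' \<omega>) / 2"
      by (simp add: abs_mult power2_eq_square[symmetric])
  qed (use i in auto)
  also have "\<dots> = (J s y y + J s y' y') / 2" using i by (simp add: J_eq[OF assms])
  finally show ?thesis .
qed

text \<open>The wave kernels and the correlation are deterministic, so by Fubini the expectation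
  falls on the product of two values of the solution at the same time. This closes the equation for
  \<open>J\<close>.\<close>

lemma form_eq_cone_form:
  assumes t: "0 \<le> t" "0 \<le> t'"
    and int: "integrable L3 (\<lambda>(s, y, y'). wcone t x s y * wcone t' x' s y' * J s y y' * fr (y - y'))"
  shows "form Q (hat t (integrand t x)) (hat t' (integrand t' x')) = cone_form J t x t' x'"
proof -
  let ?L2 = "lborel \<Otimes>\<^sub>M lborel :: (real \<times> real) measure"
  let ?k = "\<lambda>s p. wcone t x s (fst p) * wcone t' x' s (snd p) * J s (fst p) (snd p) * fr (fst p - snd p)"
  let ?F = "\<lambda>q p. hat t (integrand t x) q (fst p) * hat t' (integrand t' x') q (snd p) * fr (fst p - snd p)"
  interpret QL: pair_sigma_finite Q ?L2
    using sigma_finite_Q sigma_finite_lborel_pair by (simp add: pair_sigma_finite_def)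
  interpret LL: pair_sigma_finite lborel ?L2
    using sigma_finite_lborel sigma_finite_lborel_pair by (simp add: pair_sigma_finite_def)
  interpret PL: pair_sigma_finite P "lborel :: real measure"
    using sigma_finite_lborel sigma_finite_measure_axioms by (simp add: pair_sigma_finite_def)
  have F: "integrable (Q \<Otimes>\<^sub>M ?L2) (case_prod ?F)"
    using form_integrable[OF enform_integrand(1)[OF t(1)] enform_integrand(1)[OF t(2)]
        enform_finite[OF enform_integrand(1)[OF t(1)] enform_integrand(1)[OF t(2)]
          enform_integrand(2)[OF t(1)] enform_integrand(2)[OF t(2)]], of x x']
    by (simp add: case_prod_beta')
  have k: "integrable (lborel \<Otimes>\<^sub>M ?L2) (case_prod ?k)" using int by (simp add: case_prod_beta')
  have "form Q (hat t (integrand t x)) (hat t' (integrand t' x')) = integral\<^sup>L (Q \<Otimes>\<^sub>M ?L2) (case_prod ?F)"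
    unfolding form_def by (simp add: case_prod_beta')
  also have "\<dots> = (LINT p|?L2. LINT q|Q. ?F q p)" by (rule QL.integral_snd[OF F, symmetric])
  also have "\<dots> = (LINT p|?L2. LINT s|lborel. ?k s p)"
  proof (rule integral_cong_AE)
    show "(\<lambda>p. LINT q|Q. ?F q p) \<in> borel_measurable ?L2"
      using QL.integrable_snd[OF F] by (rule borel_measurable_integrable)
    show "(\<lambda>p. LINT s|lborel. ?k s p) \<in> borel_measurable ?L2"
      using LL.integrable_snd[OF k] by (rule borel_measurable_integrable)
    show "AE p in ?L2. (LINT q|Q. ?F q p) = (LINT s|lborel. ?k s p)"
      using QL.AE_integrable_snd[OF F]
    proof eventually_elim
      case (elim p)
      have "(LINT q|Q. ?F q p) = (LINT s|lborel. LINT \<omega>|P. ?F (\<omega>, s) p)"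
      proof -
        have c: "(\<lambda>q. ?F q p) = case_prod (\<lambda>\<omega> s. ?F (\<omega>, s) p)" by auto
        show ?thesis using elim unfolding c by (rule PL.integral_snd[symmetric])
      qed
      also have "\<dots> = (LINT s|lborel. ?k s p)"
      proof (rule Bochner_Integration.integral_cong[OF refl])
        fix s
        have "(LINT \<omega>|P. ?F (\<omega>, s) p) = (LINT \<omega>|P. (wcone t x s (fst p) * wcone t' x' s (snd p) * fr (fst p - snd p)) *
           (u0 (\<omega>, s) (fst p) * u0 (\<omega>, s) (snd p)))"
          unfolding hat_integrand by (simp add: mult_ac)
        also have "\<dots> = (wcone t x s (fst p) * wcone t' x' s (snd p) * fr (fst p - snd p)) * J s (fst p) (snd p)"
          unfolding J_def by (rule integral_mult_right_zero)
        finally show "(LINT \<omega>|P. ?F (\<omega>, s) p) = ?k s p" by (simp add: mult_ac)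
      qed
      finally show ?case .
    qed
  qed
  also have "\<dots> = integral\<^sup>L (lborel \<Otimes>\<^sub>M ?L2) (case_prod ?k)" by (rule LL.integral_snd[OF k])
  also have "\<dots> = cone_form J t x t' x'" unfolding cone_form_def by (simp add: case_prod_beta')
  finally show ?thesis .
qed

text \<open>If \<open>\<bar>y - x\<bar> \<le> T - t\<close>, the backward cone of
  \<open>(t,y)\<close> lies in that of \<open>(T,x)\<close>, and the wave kernel has the same height
  \<open>1 / 2\<close> on both. The integrand at \<open>(t,y)\<close> is then dominated by the one
  at the vertex. The bound still depends on \<open>x\<close> and \<open>T\<close>.\<close>

lemma cone_local_bound:
  assumes "0 \<le> T"
  obtains B where "0 \<le> B" "\<And>t y. 0 \<le> t \<Longrightarrow> \<bar>y - x\<bar> \<le> T - t \<Longrightarrow> J t y y \<le> B"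
proof -
  let ?E = "\<lambda>t y. enform Q (hat t (integrand t y)) (hat t (integrand t y))"
  let ?B = "1 + m2 * enn2real (?E T x)"
  have "J t y y \<le> ?B" if t: "0 \<le> t" "\<bar>y - x\<bar> \<le> T - t" for t y
  proof -
    have le: "?E t y \<le> ?E T x"
    proof (rule enform_mono)
      fix q :: "'w \<times> real" and z
      have "wcone t y (snd q) z \<le> wcone T x (snd q) z" using t by (auto simp: wcone_eq)
      then show "\<bar>hat t (integrand t y) q z\<bar> \<le> \<bar>hat T (integrand T x) q z\<bar>"
        unfolding hat_integrand abs_mult by (intro mult_right_mono) auto
    qed
    have "ennreal \<bar>form Q (hat t (integrand t y)) (hat t (integrand t y))\<bar> \<le> ?E T x"
      using enform_le_form[OF enform_integrand(1)[OF t(1)] enform_integrand(1)[OF t(1)]] le by (rule order_trans)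
    then have "\<bar>form Q (hat t (integrand t y)) (hat t (integrand t y))\<bar> \<le> enn2real (?E T x)"
      using enform_integrand(2)[OF assms, of x]
      by (metis ennreal_enn2real ennreal_le_iff enn2real_nonneg infinity_ennreal_def)
    then have "m2 * form Q (hat t (integrand t y)) (hat t (integrand t y)) \<le> m2 * enn2real (?E T x)"
      by (intro mult_left_mono m2_nonneg) auto
    then show ?thesis
      unfolding J_eq[OF t(1)] expectation_u_mult[OF t(1,1)] expectation_centered_mult[OF t(1,1)] by simp
  qed
  then show ?thesis using m2_nonneg by (intro that[of ?B]) auto
qed

text \<open>Chosen so that \<open>m2 * cone_mass T / rate T \<le> 1 / 2\<close>, the contraction
  factor; the summand 1 keeps it positive when the mass vanishes.\<close>

definition rate :: "real \<Rightarrow> real" where "rate T = 2 * m2 * cone_mass T + 1"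

lemma rate_pos: "0 \<le> T \<Longrightarrow> 0 < rate T"
  using m2_nonneg cone_mass_nonneg[of T] by (simp add: rate_def add_nonneg_pos)

lemma rate_contract:
  assumes "0 \<le> T" "0 \<le> S" "0 \<le> E" shows "m2 * (cone_mass T * (S / rate T * E)) \<le> S / 2 * E"
proof -
  have "m2 * cone_mass T \<le> rate T / 2" by (simp add: rate_def)
  then have "m2 * cone_mass T * (S * E / rate T) \<le> rate T / 2 * (S * E / rate T)"
    using assms rate_pos[of T] by (intro mult_right_mono) auto
  also have "\<dots> = S / 2 * E" using rate_pos[of T] assms by simp
  finally show ?thesis by (simp add: mult_ac)
qed

text \<open>The hypothesis asks for second moments only inside the two backward cones, which allows
  its use before anything global is known. Diagonal values suffice because \<open>J s y y'\<close>
  is bounded by the mean of the two diagonal values.\<close>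

lemma covariance_cone_bound:
  assumes t: "0 \<le> t" "0 \<le> t'" "t \<le> T" "t' \<le> T" and "0 \<le> S"
    and le: "\<And>s y. 0 < s \<Longrightarrow> \<bar>x - y\<bar> < t - s \<or> \<bar>x' - y\<bar> < t' - s \<Longrightarrow> J s y y \<le> S * exp (rate T * s)"
  shows "expectation (\<lambda>\<omega>. (u t x \<omega> - 1) * (u t' x' \<omega> - 1)) = m2 * cone_form J t x t' x'"
    and "integrable L3 (\<lambda>(s, y, y'). wcone t x s y * wcone t' x' s y' * J s y y' * fr (y - y'))"
    and "\<bar>m2 * cone_form J t x t' x'\<bar> \<le> S / 2 * exp (rate T * min t t')"
proof -
  have T: "0 \<le> T" using t by simp
  have le': "\<bar>J s y y'\<bar> \<le> S * exp (rate T * s)" if "0 < s" "\<bar>x - y\<bar> < t - s" "\<bar>x' - y'\<bar> < t' - s" for s y y'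
    using J_abs_le[of s y y'] le[of s y] le[of s y'] that by auto
  show i: "integrable L3 (\<lambda>(s, y, y'). wcone t x s y * wcone t' x' s y' * J s y y' * fr (y - y'))"
    by (rule cone_form_bound(1)[OF J_measurable t rate_pos[OF T] \<open>0 \<le> S\<close>]) (rule le')
  have b: "\<bar>cone_form J t x t' x'\<bar> \<le> cone_mass T * (S / rate T * exp (rate T * min t t'))"
    by (rule cone_form_bound(2)[OF J_measurable t rate_pos[OF T] \<open>0 \<le> S\<close>]) (rule le')
  show "expectation (\<lambda>\<omega>. (u t x \<omega> - 1) * (u t' x' \<omega> - 1)) = m2 * cone_form J t x t' x'"
    unfolding expectation_centered_mult[OF t(1,2)] form_eq_cone_form[OF t(1,2) i] ..
  have "\<bar>m2 * cone_form J t x t' x'\<bar> \<le> m2 * (cone_mass T * (S / rate T * exp (rate T * min t t')))"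
    unfolding abs_mult abs_of_nonneg[OF m2_nonneg] by (rule mult_left_mono[OF b m2_nonneg])
  also have "\<dots> \<le> S / 2 * exp (rate T * min t t')" using T \<open>0 \<le> S\<close> by (intro rate_contract) auto
  finally show "\<bar>m2 * cone_form J t x t' x'\<bar> \<le> S / 2 * exp (rate T * min t t')" .
qed

text \<open>The contraction runs inside the backward cone of \<open>(T,x)\<close>, with weight
  \<open>exp (- rate T * s)\<close>. The constant term 1 of the equation turns into the factor 2,
  which does not depend on \<open>x\<close> although the starting bound did.\<close>

lemma second_moment_bound:
  assumes t: "0 \<le> t" "t \<le> T" shows "J t x x \<le> 2 * exp (rate T * t)"
proof -
  have T: "0 \<le> T" using t by simp
  let ?A = "{(s, y). 0 \<le> s \<and> \<bar>y - x\<bar> \<le> T - s}"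
  let ?w = "\<lambda>(s, y). exp (- rate T * s) * J s y y"
  have E: "exp (- rate T * s) * exp (rate T * s) = 1" for s by (simp add: exp_add[symmetric])
  obtain B where B: "0 \<le> B" "\<And>t y. 0 \<le> t \<Longrightarrow> \<bar>y - x\<bar> \<le> T - t \<Longrightarrow> J t y y \<le> B"
    using cone_local_bound[OF T] by blast
  have "?w (t, x) \<le> 2 * 1"
  proof (rule contraction_bound[where A="?A" and w="?w"])
    show "0 \<le> ?w p" if "p \<in> ?A" for p using J_nonneg_diag by (auto split: prod.split)
    show "?w p \<le> B" if pA: "p \<in> ?A" for p
    proof -
      obtain s y where p: "p = (s, y)" "0 \<le> s" "\<bar>y - x\<bar> \<le> T - s" using pA by (cases p) auto
      have "exp (- rate T * s) * J s y y \<le> 1 * B"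
        using p B rate_pos[OF T] J_nonneg_diag by (intro mult_mono) auto
      with p show ?thesis by simp
    qed
    fix S p assume S: "0 \<le> S" "\<And>p. p \<in> ?A \<Longrightarrow> ?w p \<le> S" and p: "p \<in> ?A"
    obtain s y where ps: "p = (s, y)" "0 \<le> s" "\<bar>y - x\<bar> \<le> T - s" using p by (cases p) auto
    have le: "J r z z \<le> S * exp (rate T * r)" if "0 < r" "\<bar>y - z\<bar> < s - r \<or> \<bar>y - z\<bar> < s - r" for r z
    proof -
      \<comment> \<open>Backward cones of points of \<open>?A\<close> stay inside \<open>?A\<close>,
        so the induction hypothesis covers everything that the equation refers to.\<close>
      have "(r, z) \<in> ?A" using that ps by auto
      from S(2)[OF this] show ?thesis by (simp only: prod.case exp_weight_le_iff)
    qed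
    have sT: "s \<le> T" using ps by auto
    have c: "expectation (\<lambda>\<omega>. (u s y \<omega> - 1) * (u s y \<omega> - 1)) = m2 * cone_form J s y s y"
      by (rule covariance_cone_bound(1)[OF ps(2,2) sT sT S(1)]) (rule le)
    have b: "\<bar>m2 * cone_form J s y s y\<bar> \<le> S / 2 * exp (rate T * min s s)"
      by (rule covariance_cone_bound(3)[OF ps(2,2) sT sT S(1)]) (rule le)
    have "J s y y = 1 + m2 * cone_form J s y s y"
      using expectation_u_mult[OF ps(2,2), of y y] c by (simp add: J_eq[OF ps(2)])
    also have "\<dots> \<le> 1 + S / 2 * exp (rate T * s)" using b by simp
    finally have "exp (- rate T * s) * J s y y \<le> exp (- rate T * s) * (1 + S / 2 * exp (rate T * s))"
      by (intro mult_left_mono) auto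
    also have "\<dots> = exp (- rate T * s) + S / 2" using E[of s] by (simp add: algebra_simps)
    also have "\<dots> \<le> 1 + S / 2" using rate_pos[OF T] ps(2) by simp
    finally show "?w p \<le> 1 + S / 2" by (simp add: ps(1))
  next
    show "(t, x) \<in> ?A" using t by simp
  qed
  then show ?thesis by (simp only: prod.case exp_weight_le_iff mult_1_right)
qed

lemma J_bound:
  assumes "0 \<le> s" "s \<le> T" shows "\<bar>J s y y'\<bar> \<le> 2 * exp (rate T * s)"
proof -
  have "\<bar>J s y y'\<bar> \<le> (J s y y + J s y' y') / 2" by (rule J_abs_le[OF assms(1)])
  also have "\<dots> \<le> (2 * exp (rate T * s) + 2 * exp (rate T * s)) / 2"
    using second_moment_bound[OF assms] by (intro divide_right_mono add_mono) auto
  finally show ?thesis by simp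
qed

lemma covariance_eq:
  assumes t: "0 \<le> t" "0 \<le> t'"
  shows "expectation (\<lambda>\<omega>. (u t x \<omega> - 1) * (u t' x' \<omega> - 1)) = m2 * cone_form J t x t' x'"
    and "integrable L3 (\<lambda>(s, y, y'). wcone t x s y * wcone t' x' s y' * J s y y' * fr (y - y'))"
  by (rule covariance_cone_bound[OF t max.cobounded1 max.cobounded2, where S=2]; use t in \<open>auto intro!: second_moment_bound\<close>)+

text \<open>The correlation depends on differences only, so the translated moments solve the same
  equation. The constant terms cancel in the difference, and the contraction with
  \<open>c = 0\<close> forces it to vanish.\<close>

theorem J_shift:
  assumes "0 \<le> t" shows "J t (y + a) (y' + a) = J t y y'"
proof -
  let ?T = t
  let ?A = "{(s, y :: real, y' :: real). 0 \<le> s \<and> s \<le> ?T}"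
  let ?D = "\<lambda>s y y'. J s y y' - J s (y + a) (y' + a)"
  let ?w = "\<lambda>(s, y, y'). exp (- rate ?T * s) * \<bar>?D s y y'\<bar>"
  have E: "exp (- rate ?T * s) * exp (rate ?T * s) = 1" for s by (simp add: exp_add[symmetric])
  have Da: "(\<lambda>p. J (fst p) (fst (snd p) + a) (snd (snd p) + a)) \<in> borel_measurable L3"
  proof -
    have "(\<lambda>p. (fst p, fst (snd p) + a, snd (snd p) + a)) \<in> measurable L3 L3" by measurable
    from measurable_compose[OF this J_measurable] show ?thesis by simp
  qed
  have Dm: "(\<lambda>p. ?D (fst p) (fst (snd p)) (snd (snd p))) \<in> borel_measurable L3"
    by (intro borel_measurable_diff J_measurable Da)
  have "?w (t, y, y') \<le> 2 * 0"
  proof (rule contraction_bound[where A="?A" and w="?w"])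
    show "0 \<le> ?w p" if "p \<in> ?A" for p by (auto split: prod.split)
    \<comment> \<open>Each of the two moments contributes at most 2 after weighting, by
      \<open>J_bound\<close>.\<close>
    show "?w p \<le> 4" if pA: "p \<in> ?A" for p
    proof -
      obtain s z z' where p: "p = (s, z, z')" "0 \<le> s" "s \<le> ?T" using pA by (cases p) auto
      have "\<bar>?D s z z'\<bar> \<le> 4 * exp (rate ?T * s)"
        using J_bound[OF p(2,3), of z z'] J_bound[OF p(2,3), of "z + a" "z' + a"] by linarith
      then have "exp (- rate ?T * s) * \<bar>?D s z z'\<bar> \<le> exp (- rate ?T * s) * (4 * exp (rate ?T * s))"
        by (intro mult_left_mono) auto
      with p E[of s] show ?thesis by (simp add: mult_ac)
    qed
    fix S p assume S: "0 \<le> S" "\<And>p. p \<in> ?A \<Longrightarrow> ?w p \<le> S" and p: "p \<in> ?A"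
    obtain s z z' where ps: "p = (s, z, z')" "0 \<le> s" "s \<le> ?T" using p by (cases p) auto
    have le: "\<bar>?D r x x'\<bar> \<le> S * exp (rate ?T * r)" if "0 < r" "\<bar>z - x\<bar> < s - r" "\<bar>z' - x'\<bar> < s - r" for r x x'
    proof -
      have "(r, x, x') \<in> ?A" using that ps by auto
      from S(2)[OF this] show ?thesis by (simp only: prod.case exp_weight_le_iff)
    qed
    have i: "integrable L3 (\<lambda>(r, x, x'). wcone s z r x * wcone s z' r x' * J r x x' * fr (x - x'))"
      by (rule covariance_eq(2)[OF ps(2,2)])
    have ia: "integrable L3 (\<lambda>(r, x, x'). wcone s z r x * wcone s z' r x' * J r (x + a) (x' + a) * fr (x - x'))"
      by (rule cone_form_bound(1)[OF Da ps(2,2,3,3) rate_pos[OF assms], of 2]) (use J_bound ps in auto)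
    have "?D s z z' = m2 * cone_form J s z s z' - m2 * cone_form J s (z + a) s (z' + a)"
      using expectation_u_mult[OF ps(2,2)] covariance_eq(1)[OF ps(2,2)] by (simp add: J_eq[OF ps(2)])
    also have "cone_form J s (z + a) s (z' + a) = (LINT (r, x, x')|L3. wcone s z r x * wcone s z' r x' * J r (x + a) (x' + a) * fr (x - x'))"
      unfolding cone_form_shift by simp
    also have "m2 * cone_form J s z s z' - m2 * \<dots> = m2 * cone_form ?D s z s z'"
      unfolding cone_form_def right_diff_distrib[symmetric] Bochner_Integration.integral_diff[OF i ia, symmetric]
      by (simp add: case_prod_beta' algebra_simps)
    finally have "\<bar>?D s z z'\<bar> = m2 * \<bar>cone_form ?D s z s z'\<bar>" using m2_nonneg by (simp add: abs_mult)
    also have "\<dots> \<le> m2 * (cone_mass ?T * (S / rate ?T * exp (rate ?T * min s s)))"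
    proof (rule mult_left_mono[OF _ m2_nonneg])
      show "\<bar>cone_form ?D s z s z'\<bar> \<le> cone_mass ?T * (S / rate ?T * exp (rate ?T * min s s))"
        by (rule cone_form_bound(2)[OF Dm ps(2,2,3,3) rate_pos[OF assms] S(1)]) (rule le)
    qed
    also have "\<dots> \<le> S / 2 * exp (rate ?T * s)" using assms S(1) by (simp only: min.idem) (intro rate_contract, auto)
    finally show "?w p \<le> 0 + S / 2" unfolding ps(1) prod.case add_0 exp_weight_le_iff .
  next
    show "(t, y, y') \<in> ?A" using assms by simp
  qed
  then show ?thesis by (simp add: mult_le_0_iff)
qed

end

section \<open>Averaging a stationary covariance over large intervals\<close>

text \<open>Dominated convergence is applied along sequences; keeping them above \<open>K\<close>
  makes division and rescaling by the terms legitimate for every index.\<close>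

lemma tendsto_at_topI_sequentially_ge:
  fixes g :: "real \<Rightarrow> real"
  assumes "\<And>X. (\<And>n. K \<le> X n) \<Longrightarrow> filterlim X at_top sequentially \<Longrightarrow> (\<lambda>n. g (X n)) \<longlonglongrightarrow> l"
  shows "(g \<longlongrightarrow> l) at_top"
proof (rule tendsto_at_topI_sequentially)
  fix X :: "nat \<Rightarrow> real" assume X: "filterlim X at_top sequentially"
  let ?Y = "\<lambda>n. max K (X n)"
  have ev: "eventually (\<lambda>n. K \<le> X n) sequentially" using X by (auto simp: filterlim_at_top)
  have "filterlim ?Y at_top sequentially"
    using X by (rule filterlim_at_top_mono) simp
  then have "(\<lambda>n. g (?Y n)) \<longlonglongrightarrow> l" by (intro assms) auto
  moreover have "eventually (\<lambda>n. g (?Y n) = g (X n)) sequentially"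
    using ev by eventually_elim (simp add: max_def)
  ultimately show "(\<lambda>n. g (X n)) \<longlonglongrightarrow> l" by (rule Lim_transform_eventually)
qed

definition window_integral :: "(real \<Rightarrow> real) \<Rightarrow> real \<Rightarrow> real" where
  "window_integral C R = (LINT x'|lborel. LINT x|lborel. indicator {-R..R} x * indicator {-R..R} x' * C (x - x'))"

text \<open>After \<open>x' = R * \<xi>\<close> and \<open>z = x - x'\<close>, the window seen from
  an interior point \<open>\<xi>\<close> of \<open>[-1,1]\<close> grows to the whole line, so the
  inner integral tends to the full integral of \<open>C\<close>. The factor 2 is the length of
  \<open>[-1,1]\<close>.\<close>

lemma window_integral_integrable_limit:
  assumes C: "integrable lborel C"
  shows "((\<lambda>R. 1 / R * window_integral C R) \<longlongrightarrow> 2 * (LINT z|lborel. C z)) at_top"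
proof (rule tendsto_at_topI_sequentially_ge[where K=1])
  fix X :: "nat \<Rightarrow> real" assume X: "\<And>n. 1 \<le> X n" and lim: "filterlim X at_top sequentially"
  have [measurable]: "C \<in> borel_measurable borel" using C borel_measurable_integrable by fastforce
  let ?i = "\<lambda>n \<xi>. LINT z|lborel. indicator {-X n..X n} (z + X n * \<xi>) * C z"
  have eq: "1 / X n * window_integral C (X n) = (LINT \<xi>|lborel. indicator {-1..1} \<xi> * ?i n \<xi>)" for n
  proof -
    have Xn: "0 < X n" using X[of n] by simp
    have "window_integral C (X n) = (LINT x'|lborel. indicator {-X n..X n} x' * (LINT x|lborel. indicator {-X n..X n} x * C (x - x')))"
      unfolding window_integral_def
      by (intro Bochner_Integration.integral_cong refl)
        (simp add: mult.assoc mult.left_commute flip: Bochner_Integration.integral_mult_right_zero)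
    also have "\<dots> = (LINT x'|lborel. indicator {-X n..X n} x' * (LINT z|lborel. indicator {-X n..X n} (z + x') * C z))"
    proof -
      have "(LINT x|lborel. indicator {-X n..X n} x * C (x - x')) = (LINT z|lborel. indicator {-X n..X n} (z + x') * C z)" for x'
        by (subst lborel_integral_real_affine[where c=1 and t=x']) (auto simp: add.commute)
      then show ?thesis by (simp only:)
    qed
    also have "\<dots> = X n * (LINT \<xi>|lborel. indicator {-X n..X n} (X n * \<xi>) * ?i n \<xi>)"
      using Xn by (subst lborel_integral_real_affine[where c="X n" and t=0]) auto
    also have "(\<lambda>\<xi>. indicator {-X n..X n} (X n * \<xi>) * ?i n \<xi>) = (\<lambda>\<xi>. indicator {-1..1} \<xi> * ?i n \<xi>)"
    proof
      fix \<xi>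
      have "X n * \<xi> \<in> {-X n..X n} \<longleftrightarrow> \<xi> \<in> {-1..1}"
        using Xn mult_le_cancel_left_pos[OF Xn, of "-1" \<xi>] mult_le_cancel_left_pos[OF Xn, of \<xi> 1] by simp
      then show "indicator {-X n..X n} (X n * \<xi>) * ?i n \<xi> = indicator {-1..1} \<xi> * ?i n \<xi>"
        by (simp add: indicator_def)
    qed
    finally show ?thesis using Xn by simp
  qed
  have inner: "(\<lambda>n. ?i n \<xi>) \<longlonglongrightarrow> (LINT z|lborel. C z)" if \<xi>: "\<bar>\<xi>\<bar> < 1" for \<xi>
  proof (rule integral_dominated_convergence[where w="\<lambda>z. \<bar>C z\<bar>"])
    show "AE z in lborel. (\<lambda>n. indicator {-X n..X n} (z + X n * \<xi>) * C z) \<longlonglongrightarrow> C z"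
    proof (intro AE_I2 tendsto_eventually)
      fix z
      have "eventually (\<lambda>n. \<bar>z\<bar> / (1 - \<bar>\<xi>\<bar>) \<le> X n) sequentially" using lim by (auto simp: filterlim_at_top)
      then show "eventually (\<lambda>n. indicator {-X n..X n} (z + X n * \<xi>) * C z = C z) sequentially"
      proof eventually_elim
        case (elim n)
        then have "\<bar>z\<bar> \<le> X n * (1 - \<bar>\<xi>\<bar>)" using \<xi> by (simp add: field_simps)
        moreover have "\<bar>X n * \<xi>\<bar> = X n * \<bar>\<xi>\<bar>" using X[of n] by (simp add: abs_mult)
        ultimately have "\<bar>z + X n * \<xi>\<bar> \<le> X n" by (simp add: algebra_simps)
        then show ?case by (simp add: indicator_def abs_le_iff)
      qed
    qed
    show "AE z in lborel. norm (indicator {-X n..X n} (z + X n * \<xi>) * C z) \<le> \<bar>C z\<bar>" for n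
      by (intro AE_I2) (auto simp: indicator_def)
  qed (use C in auto)
  have ile: "\<bar>?i n \<xi>\<bar> \<le> (LINT z|lborel. \<bar>C z\<bar>)" for n \<xi>
  proof -
    have "\<bar>?i n \<xi>\<bar> \<le> (LINT z|lborel. \<bar>indicator {-X n..X n} (z + X n * \<xi>) * C z\<bar>)" by (rule integral_abs_bound)
    also have "\<dots> \<le> (LINT z|lborel. \<bar>C z\<bar>)"
    proof (rule integral_mono')
      show "integrable lborel (\<lambda>z. \<bar>C z\<bar>)" using C by simp
    qed (auto simp: indicator_def)
    finally show ?thesis .
  qed
  have "(\<lambda>n. LINT \<xi>|lborel. indicator {-1..1} \<xi> * ?i n \<xi>) \<longlonglongrightarrow>
    (LINT \<xi>::real|lborel. indicator {-1..1} \<xi> * (LINT z|lborel. C z))"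
  proof (rule integral_dominated_convergence[where w="\<lambda>\<xi>::real. indicator {-1..1} \<xi> * (LINT z|lborel. \<bar>C z\<bar>)"])
    \<comment> \<open>At the endpoints the window exhausts only a half-line; two points do not
      count.\<close>
    show "AE \<xi>::real in lborel. (\<lambda>n. indicator {-1..1} \<xi> * ?i n \<xi>) \<longlonglongrightarrow> indicator {-1..1} \<xi> * (LINT z|lborel. C z)"
      using AE_lborel_singleton[of 1] AE_lborel_singleton[of "-1"]
    proof eventually_elim
      case (elim \<xi>)
      show ?case
      proof (cases "\<xi> \<in> {-1..1}")
        case True with elim have "\<bar>\<xi>\<bar> < 1" by auto
        from inner[OF this] show ?thesis by (rule tendsto_mult_left)
      qed simp
    qed
    show "AE \<xi>::real in lborel. norm (indicator {-1..1} \<xi> * ?i n \<xi>) \<le> indicator {-1..1} \<xi> * (LINT z|lborel. \<bar>C z\<bar>)" for n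
      using ile by (intro AE_I2) (auto simp: indicator_def)
  qed (auto intro!: integrable_mult_left integrable_real_indicator)
  then show "(\<lambda>n. 1 / X n * window_integral C (X n)) \<longlonglongrightarrow> 2 * (LINT z|lborel. C z)"
    unfolding eq by simp
qed

text \<open>Rescaling both variables by \<open>R\<close> produces \<open>R^2\<close>, and
  \<open>R powr (- (\<alpha> + 1)) * R^2 = R powr (1 - \<alpha>)\<close> is what
  \<open>C (R * (x - x'))\<close> needs in order to converge to
  \<open>l * \<bar>x - x'\<bar> powr (\<alpha> - 1)\<close>. The power bound on \<open>C\<close> is
  scale invariant and provides the dominating function.\<close>

lemma window_integral_power_limit:
  assumes [measurable]: "C \<in> borel_measurable borel" and "0 < \<alpha>"
    and bound: "\<And>z. z \<noteq> 0 \<Longrightarrow> \<bar>C z\<bar> \<le> M * \<bar>z\<bar> powr (\<alpha> - 1)"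
    and lim: "\<And>z. filterlim (\<lambda>n. \<bar>z n\<bar>) at_top sequentially \<Longrightarrow> (\<lambda>n. \<bar>z n\<bar> powr (1 - \<alpha>) * C (z n)) \<longlonglongrightarrow> l"
    and int: "integrable (lborel \<Otimes>\<^sub>M lborel)
      (\<lambda>(x', x). indicator {-1..1} x * indicator {-1..1} x' * \<bar>x - x'\<bar> powr (\<alpha> - 1))"
  shows "((\<lambda>R. R powr (- (\<alpha> + 1)) * window_integral C R) \<longlongrightarrow>
    (LINT (x', x)|(lborel \<Otimes>\<^sub>M lborel). l * (indicator {-1..1} x * indicator {-1..1} x' * \<bar>x - x'\<bar> powr (\<alpha> - 1)))) at_top"
proof (rule tendsto_at_topI_sequentially_ge[where K=1])
  fix X :: "nat \<Rightarrow> real" assume X: "\<And>n. 1 \<le> X n" and Xlim: "filterlim X at_top sequentially"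
  let ?I = "\<lambda>x' x. indicator {-1..1} x * indicator {-1..1} x' :: real"
  let ?k = "\<lambda>n x' x. ?I x' x * (X n powr (1 - \<alpha>) * C (X n * (x - x')))"
  have M: "0 \<le> M" using bound[of 1] abs_ge_zero[of "C 1"] by simp
  have kb: "\<bar>?k n x' x\<bar> \<le> M * (?I x' x * \<bar>x - x'\<bar> powr (\<alpha> - 1))" if "x \<noteq> x'" for n x x'
  proof -
    have Xn: "0 < X n" using X[of n] by simp
    have "\<bar>C (X n * (x - x'))\<bar> \<le> M * \<bar>X n * (x - x')\<bar> powr (\<alpha> - 1)" using that Xn by (intro bound) auto
    then have "X n powr (1 - \<alpha>) * \<bar>C (X n * (x - x'))\<bar> \<le> X n powr (1 - \<alpha>) * (M * \<bar>X n * (x - x')\<bar> powr (\<alpha> - 1))"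
      by (intro mult_left_mono) auto
    also have "\<dots> = M * ((X n powr (1 - \<alpha>) * X n powr (\<alpha> - 1)) * \<bar>x - x'\<bar> powr (\<alpha> - 1))"
      using Xn by (simp add: abs_mult powr_mult)
    also have "X n powr (1 - \<alpha>) * X n powr (\<alpha> - 1) = 1" using Xn by (simp add: powr_add[symmetric])
    finally show ?thesis by (auto simp: abs_mult indicator_def)
  qed
  \<comment> \<open>Bound and limit of \<open>C\<close> say nothing at the origin, so the diagonal
    is set aside as a null set.\<close>
  have diag: "AE p in lborel \<Otimes>\<^sub>M lborel. snd p \<noteq> (fst p :: real)"
  proof (rule lborel_pair.AE_pair_measure)
    show "{p \<in> space (lborel \<Otimes>\<^sub>M lborel). snd p \<noteq> (fst p :: real)} \<in> sets (lborel \<Otimes>\<^sub>M lborel)" by measurable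
    show "AE x in lborel. AE y in lborel. snd (x, y) \<noteq> (fst (x, y) :: real)"
      using AE_lborel_singleton by auto
  qed
  have km [measurable]: "(\<lambda>(x', x). ?k n x' x) \<in> borel_measurable (lborel \<Otimes>\<^sub>M lborel)" for n
    by measurable
  have ki: "integrable (lborel \<Otimes>\<^sub>M lborel) (\<lambda>(x', x). ?k n x' x)" for n
  proof (rule Bochner_Integration.integrable_bound)
    show "integrable (lborel \<Otimes>\<^sub>M lborel) (\<lambda>p. M * (case p of (x', x) \<Rightarrow> ?I x' x * \<bar>x - x'\<bar> powr (\<alpha> - 1)))"
      by (rule integrable_mult_right[OF int])
    show "AE p in lborel \<Otimes>\<^sub>M lborel. norm (case p of (x', x) \<Rightarrow> ?k n x' x) \<le>
      norm (M * (case p of (x', x) \<Rightarrow> ?I x' x * \<bar>x - x'\<bar> powr (\<alpha> - 1)))"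
      using diag
    proof eventually_elim
      case (elim p)
      have "\<bar>?k n (fst p) (snd p)\<bar> \<le> M * (?I (fst p) (snd p) * \<bar>snd p - fst p\<bar> powr (\<alpha> - 1))"
        using elim by (rule kb)
      also have "\<dots> \<le> \<bar>\<dots>\<bar>" by (rule abs_ge_self)
      finally show ?case by (simp only: case_prod_beta' real_norm_def)
    qed
  qed (rule km)
  have eq: "X n powr (- (\<alpha> + 1)) * window_integral C (X n) = (LINT (x', x)|(lborel \<Otimes>\<^sub>M lborel). ?k n x' x)" for n
  proof -
    have Xn: "0 < X n" using X[of n] by simp
    have ind: "indicator {-X n..X n} (X n * x) = (indicator {-1..1} x :: real)" for x
    proof -
      have "X n * x \<in> {-X n..X n} \<longleftrightarrow> x \<in> {-1..1}"
        using mult_le_cancel_left_pos[OF Xn, of "-1" x] mult_le_cancel_left_pos[OF Xn, of x 1] by simp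
      then show ?thesis by (simp add: indicator_def)
    qed
    have "window_integral C (X n) = X n * (LINT x'|lborel. LINT x|lborel. indicator {-X n..X n} x * indicator {-X n..X n} (X n * x') * C (x - X n * x'))"
      unfolding window_integral_def using Xn by (subst lborel_integral_real_affine[where c="X n" and t=0]) auto
    also have "\<dots> = X n * (LINT x'|lborel. X n * (LINT x|lborel. indicator {-X n..X n} (X n * x) * indicator {-X n..X n} (X n * x') * C (X n * x - X n * x')))"
    proof (intro arg_cong2[where f="(*)"] refl Bochner_Integration.integral_cong)
      fix x'
      show "(LINT x|lborel. indicator {-X n..X n} x * indicator {-X n..X n} (X n * x') * C (x - X n * x')) =
        X n * (LINT x|lborel. indicator {-X n..X n} (X n * x) * indicator {-X n..X n} (X n * x') * C (X n * x - X n * x'))"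
        using Xn by (subst lborel_integral_real_affine[where c="X n" and t=0]) auto
    qed
    also have "\<dots> = X n * X n * (LINT x'|lborel. LINT x|lborel. ?I x' x * C (X n * (x - x')))"
      unfolding ind by (simp add: right_diff_distrib)
    finally have "X n powr (- (\<alpha> + 1)) * window_integral C (X n) =
      (X n powr (- (\<alpha> + 1)) * (X n * X n)) * (LINT x'|lborel. LINT x|lborel. ?I x' x * C (X n * (x - x')))"
      by (simp only: mult.assoc)
    also have "X n powr (- (\<alpha> + 1)) * (X n * X n) = X n powr (1 - \<alpha>)"
    proof -
      have "X n * X n = X n powr 2" using Xn by (simp add: powr_numeral power2_eq_square)
      then show ?thesis by (simp add: powr_add[symmetric])
    qed
    also have "X n powr (1 - \<alpha>) * (LINT x'|lborel. LINT x|lborel. ?I x' x * C (X n * (x - x'))) =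
      (LINT x'|lborel. LINT x|lborel. ?k n x' x)"
      by (simp add: mult.left_commute flip: Bochner_Integration.integral_mult_right_zero)
    also have "\<dots> = (LINT (x', x)|(lborel \<Otimes>\<^sub>M lborel). ?k n x' x)"
      using lborel_pair.integral_fst'[OF ki[of n]] by simp
    finally show ?thesis .
  qed
  show "(\<lambda>n. X n powr (- (\<alpha> + 1)) * window_integral C (X n)) \<longlonglongrightarrow>
    (LINT (x', x)|(lborel \<Otimes>\<^sub>M lborel). l * (?I x' x * \<bar>x - x'\<bar> powr (\<alpha> - 1)))"
    unfolding eq
  proof (rule integral_dominated_convergence[where w="\<lambda>p. M * (case p of (x', x) \<Rightarrow> ?I x' x * \<bar>x - x'\<bar> powr (\<alpha> - 1))"])
    show "integrable (lborel \<Otimes>\<^sub>M lborel) (\<lambda>p. M * (case p of (x', x) \<Rightarrow> ?I x' x * \<bar>x - x'\<bar> powr (\<alpha> - 1)))"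
      by (rule integrable_mult_right[OF int])
    show "AE p in lborel \<Otimes>\<^sub>M lborel. norm (case p of (x', x) \<Rightarrow> ?k n x' x) \<le>
      M * (case p of (x', x) \<Rightarrow> ?I x' x * \<bar>x - x'\<bar> powr (\<alpha> - 1))" for n
      using diag
    proof eventually_elim
      case (elim p) then show ?case unfolding case_prod_beta' real_norm_def by (rule kb)
    qed
    show "AE p in lborel \<Otimes>\<^sub>M lborel. (\<lambda>n. case p of (x', x) \<Rightarrow> ?k n x' x) \<longlonglongrightarrow>
      (case p of (x', x) \<Rightarrow> l * (?I x' x * \<bar>x - x'\<bar> powr (\<alpha> - 1)))"
      using diag
    proof eventually_elim
      case (elim p)
      obtain x' x where p: "p = (x', x)" by (cases p)
      have d: "0 < \<bar>x - x'\<bar>" using elim p by auto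
      have "filterlim (\<lambda>n. \<bar>x - x'\<bar> * X n) at_top sequentially"
        using d by (intro filterlim_tendsto_pos_mult_at_top[OF tendsto_const _ Xlim])
      also have "(\<lambda>n. \<bar>x - x'\<bar> * X n) = (\<lambda>n. \<bar>X n * (x - x')\<bar>)"
      proof
        fix n show "\<bar>x - x'\<bar> * X n = \<bar>X n * (x - x')\<bar>" using X[of n] by (simp add: abs_mult mult.commute)
      qed
      finally have "(\<lambda>n. \<bar>X n * (x - x')\<bar> powr (1 - \<alpha>) * C (X n * (x - x'))) \<longlonglongrightarrow> l" by (rule lim)
      then have "(\<lambda>n. (?I x' x * \<bar>x - x'\<bar> powr (\<alpha> - 1)) * (\<bar>X n * (x - x')\<bar> powr (1 - \<alpha>) * C (X n * (x - x')))) \<longlonglongrightarrow>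
        (?I x' x * \<bar>x - x'\<bar> powr (\<alpha> - 1)) * l" by (rule tendsto_mult_left)
      moreover have "(?I x' x * \<bar>x - x'\<bar> powr (\<alpha> - 1)) * (\<bar>X n * (x - x')\<bar> powr (1 - \<alpha>) * C (X n * (x - x'))) = ?k n x' x" for n
      proof -
        have "\<bar>X n * (x - x')\<bar> powr (1 - \<alpha>) = X n powr (1 - \<alpha>) * \<bar>x - x'\<bar> powr (1 - \<alpha>)"
          using X[of n] by (simp add: abs_mult powr_mult)
        then have "(?I x' x * \<bar>x - x'\<bar> powr (\<alpha> - 1)) * (\<bar>X n * (x - x')\<bar> powr (1 - \<alpha>) * C (X n * (x - x'))) =
          ?k n x' x * (\<bar>x - x'\<bar> powr (\<alpha> - 1) * \<bar>x - x'\<bar> powr (1 - \<alpha>))"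
          by (simp only: mult_ac)
        also have "\<bar>x - x'\<bar> powr (\<alpha> - 1) * \<bar>x - x'\<bar> powr (1 - \<alpha>) = 1"
          using d by (simp add: powr_add[symmetric])
        finally show ?thesis by simp
      qed
      ultimately have "(\<lambda>n. ?k n x' x) \<longlonglongrightarrow> (?I x' x * \<bar>x - x'\<bar> powr (\<alpha> - 1)) * l" by (simp only:)
      then show ?case by (simp only: p prod.case mult.commute[of l])
    qed
  qed measurable
qed

section \<open>Decay of the covariance\<close>

context mild_noise
begin

definition covariance :: "real \<Rightarrow> real \<Rightarrow> real \<Rightarrow> real" where
  "covariance t t' z = m2 * cone_form J t z t' 0"

lemma covariance_stationary:
  assumes t: "0 \<le> t" "0 \<le> t'"
  shows "expectation (\<lambda>\<omega>. (u t x \<omega> - 1) * (u t' x' \<omega> - 1)) = covariance t t' (x - x')"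
proof -
  have "cone_form J t ((x - x') + x') t' (0 + x') = cone_form J t (x - x') t' 0"
    unfolding cone_form_shift
    unfolding cone_form_def
  proof (rule Bochner_Integration.integral_cong[OF refl], clarify)
    fix s y y'
    show "wcone t (x - x') s y * wcone t' 0 s y' * J s (y + x') (y' + x') * fr (y + x' - (y' + x')) =
      wcone t (x - x') s y * wcone t' 0 s y' * J s y y' * fr (y - y')"
      \<comment> \<open>Translation invariance of \<open>J\<close> is known for non-negative times;
        at negative times the cones vanish.\<close>
      by (cases "0 \<le> s") (simp_all add: J_shift wcone_eq)
  qed
  then show ?thesis unfolding covariance_eq(1)[OF t] covariance_def by simp
qed

lemma J_eq_covariance: "0 \<le> s \<Longrightarrow> J s y y' = 1 + covariance s s (y - y')"
  using expectation_u_mult[of s s y y'] covariance_stationary[of s s y y'] by (simp add: J_eq)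

lemma covariance_abs_le:
  assumes t: "0 \<le> t" "0 \<le> t'" obtains B where "0 \<le> B" "\<And>z. \<bar>covariance t t' z\<bar> \<le> B"
proof -
  let ?T = "max t t'"
  have "\<bar>covariance t t' z\<bar> \<le> 2 / 2 * exp (rate ?T * min t t')" for z
    unfolding covariance_def
    by (rule covariance_cone_bound(3)[OF t max.cobounded1 max.cobounded2]) (use t in \<open>auto intro!: second_moment_bound\<close>)
  then show ?thesis by (intro that[of "2 / 2 * exp (rate ?T * min t t')"]) auto
qed

text \<open>Both vertices are placed at the origin; the separation of the two points will enter
  through the other factors.\<close>

definition cones :: "real \<Rightarrow> real \<Rightarrow> real \<times> real \<times> real \<Rightarrow> real" where
  "cones t t' = (\<lambda>(s, y, y'). wcone t 0 s y * wcone t' 0 s y')"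

lemma cones_nonneg: "0 \<le> cones t t' p" by (simp add: cones_def case_prod_beta')

lemma cones_measurable: "cones t t' \<in> borel_measurable L3"
proof -
  have "(\<lambda>p. wcone t 0 (fst p) (fst (snd p))) \<in> borel_measurable L3"
    "(\<lambda>p. wcone t' 0 (fst p) (snd (snd p))) \<in> borel_measurable L3" by measurable
  then show ?thesis unfolding cones_def case_prod_beta' by (rule borel_measurable_times)
qed

lemma integrable_cones: "integrable L3 (cones t t')"
proof -
  let ?S = "{0..t} \<times> {-t..t} \<times> {-t'..t'}"
  have S: "?S \<in> sets borel" by (intro borel_closed closed_Times) auto
  have "bounded ?S" by (intro bounded_Times) auto
  then have "emeasure lborel ?S < \<infinity>" by (rule emeasure_bounded_finite)
  then have "integrable L3 (indicator ?S :: _ \<Rightarrow> real)"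
    unfolding lborel_prod using S by (intro integrable_real_indicator) auto
  then show ?thesis
    by (rule Bochner_Integration.integrable_bound[OF _ cones_measurable])
      (intro AE_I2, auto simp: cones_def wcone_eq indicator_def split: if_splits)
qed

text \<open>Shifting \<open>y\<close> by \<open>z\<close> freezes the domain of integration and
  moves the dependence on \<open>z\<close> into \<open>J\<close> and the correlation, the form
  needed for dominated convergence and for integration over \<open>z\<close>.\<close>

lemma covariance_as_integral:
  "covariance t t' z = m2 * (LINT p|L3. cones t t' p * J (fst p) (fst (snd p) + z) (snd (snd p)) * fr (fst (snd p) - snd (snd p) + z))"
  using cone_form_shift[of J t 0 z t' 0 0]
  by (simp add: covariance_def cones_def case_prod_beta' algebra_simps)

lemma J_shift_measurable:
  "(\<lambda>p. J (fst p) (fst (snd p) + z) (snd (snd p))) \<in> borel_measurable L3"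
proof -
  have "(\<lambda>p. (fst p, fst (snd p) + z, snd (snd p))) \<in> measurable L3 L3" by measurable
  from measurable_compose[OF this J_measurable] show ?thesis by simp
qed

lemma cones_support:
  assumes "cones t t' (s, y, y') \<noteq> 0"
  shows "0 < s" "s \<le> t" "s \<le> t'" "\<bar>y\<bar> < t" "\<bar>y'\<bar> < t'"
  using assms by (auto simp: cones_def wcone_eq split: if_splits)

section \<open>Power-law correlation: decay and exact asymptotics\<close>

context
  fixes \<alpha> c :: real
  assumes \<alpha>: "0 < \<alpha>" "\<alpha> < 1" and c: "0 \<le> c" and riesz: "\<And>w. w \<noteq> 0 \<Longrightarrow> fr w = c * \<bar>w\<bar> powr (\<alpha> - 1)"
begin

text \<open>A shift by at most half of \<open>\<bar>z\<bar>\<close> leaves a distance of at least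
  \<open>\<bar>z\<bar> / 2\<close>; as the exponent is negative, halving costs the factor
  \<open>2 powr (1 - \<alpha>)\<close>.\<close>

lemma fr_far_le:
  assumes "2 * a \<le> \<bar>z\<bar>" "\<bar>w\<bar> \<le> a" "z \<noteq> 0"
  shows "fr (w + z) \<le> c * 2 powr (1 - \<alpha>) * \<bar>z\<bar> powr (\<alpha> - 1)"
proof -
  have h: "\<bar>z\<bar> / 2 \<le> \<bar>w + z\<bar>" "0 < \<bar>z\<bar> / 2" using assms by linarith+
  then have "w + z \<noteq> 0" by auto
  then have "fr (w + z) = c * \<bar>w + z\<bar> powr (\<alpha> - 1)" by (rule riesz)
  also have "\<dots> \<le> c * (\<bar>z\<bar> / 2) powr (\<alpha> - 1)"
    using h \<alpha> c by (intro mult_left_mono powr_mono2') auto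
  also have "(\<bar>z\<bar> / 2) powr (\<alpha> - 1) = 2 powr (1 - \<alpha>) * \<bar>z\<bar> powr (\<alpha> - 1)"
    using powr_minus_divide[of 2 "\<alpha> - 1"] by (simp add: powr_divide)
  finally show ?thesis by (simp add: mult.assoc)
qed

lemma covariance_far_integrand:
  assumes t: "0 \<le> t" "0 \<le> t'" and z: "2 * (t + t') \<le> \<bar>z\<bar>" "z \<noteq> 0"
  shows "\<bar>cones t t' (s, y, y') * J s (y + z) y' * fr (y - y' + z)\<bar> \<le>
    cones t t' (s, y, y') * (2 * exp (rate t * t) * (c * 2 powr (1 - \<alpha>) * \<bar>z\<bar> powr (\<alpha> - 1)))"
proof (cases "cones t t' (s, y, y') = 0")
  case False
  note sp = cones_support[OF this]
  have "\<bar>J s (y + z) y'\<bar> \<le> 2 * exp (rate t * s)" using sp by (intro J_bound) auto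
  also have "\<dots> \<le> 2 * exp (rate t * t)" using sp rate_pos[OF t(1)] by simp
  finally have "\<bar>J s (y + z) y'\<bar> * fr (y - y' + z) \<le> 2 * exp (rate t * t) * (c * 2 powr (1 - \<alpha>) * \<bar>z\<bar> powr (\<alpha> - 1))"
    using sp z by (intro mult_mono fr_far_le[of "t + t'"]) auto
  then have "cones t t' (s, y, y') * (\<bar>J s (y + z) y'\<bar> * fr (y - y' + z)) \<le>
    cones t t' (s, y, y') * (2 * exp (rate t * t) * (c * 2 powr (1 - \<alpha>) * \<bar>z\<bar> powr (\<alpha> - 1)))"
    by (intro mult_left_mono cones_nonneg)
  then show ?thesis using cones_nonneg[of t t' "(s, y, y')"] by (simp add: abs_mult mult.assoc)
qed simp

text \<open>Far out the correlation decays uniformly over the cones, while \<open>J\<close> is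
  bounded. Near the origin the covariance is bounded and the power is bounded below. The two
  constants are added to cover both ranges.\<close>

lemma covariance_decay:
  assumes t: "0 < t" "0 < t'"
  obtains M where "\<And>z. z \<noteq> 0 \<Longrightarrow> \<bar>covariance t t' z\<bar> \<le> M * \<bar>z\<bar> powr (\<alpha> - 1)"
proof -
  obtain B where B: "0 \<le> B" "\<And>z. \<bar>covariance t t' z\<bar> \<le> B" using covariance_abs_le[of t t'] t by auto
  let ?K = "2 * exp (rate t * t) * (c * 2 powr (1 - \<alpha>))"
  let ?M1 = "m2 * ((LINT p|L3. cones t t' p) * ?K)"
  \<comment> \<open>For \<open>\<bar>z\<bar> < 2 * (t + t')\<close> this compensates the smallest
    value that the power can take. The threshold is twice the largest distance between points of the
    two cones.\<close>
  let ?M2 = "B * (2 * (t + t')) powr (1 - \<alpha>)"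
  have I: "0 \<le> (LINT p|L3. cones t t' p)" using cones_nonneg by (intro Bochner_Integration.integral_nonneg) auto
  have M1: "0 \<le> ?M1" using c m2_nonneg I by auto
  have M2: "0 \<le> ?M2" using B by simp
  have "\<bar>covariance t t' z\<bar> \<le> (?M1 + ?M2) * \<bar>z\<bar> powr (\<alpha> - 1)" if z: "z \<noteq> 0" for z
  proof (cases "2 * (t + t') \<le> \<bar>z\<bar>")
    case True
    let ?k = "\<lambda>p. cones t t' p * J (fst p) (fst (snd p) + z) (snd (snd p)) * fr (fst (snd p) - snd (snd p) + z)"
    have "\<bar>LINT p|L3. ?k p\<bar> \<le> (LINT p|L3. \<bar>?k p\<bar>)" by (rule integral_abs_bound)
    also have "\<dots> \<le> (LINT p|L3. cones t t' p * (2 * exp (rate t * t) * (c * 2 powr (1 - \<alpha>) * \<bar>z\<bar> powr (\<alpha> - 1))))"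
    proof (rule integral_mono')
      show "integrable L3 (\<lambda>p. cones t t' p * (2 * exp (rate t * t) * (c * 2 powr (1 - \<alpha>) * \<bar>z\<bar> powr (\<alpha> - 1))))"
        by (rule integrable_mult_left) (rule integrable_cones)
      show "\<bar>?k p\<bar> \<le> cones t t' p * (2 * exp (rate t * t) * (c * 2 powr (1 - \<alpha>) * \<bar>z\<bar> powr (\<alpha> - 1)))" for p
        using covariance_far_integrand[of t t' z "fst p" "fst (snd p)" "snd (snd p)"] t True z by simp
      show "0 \<le> cones t t' p * (2 * exp (rate t * t) * (c * 2 powr (1 - \<alpha>) * \<bar>z\<bar> powr (\<alpha> - 1)))" for p
        using c cones_nonneg by (intro mult_nonneg_nonneg) auto
    qed
    also have "\<dots> = (LINT p|L3. cones t t' p) * ?K * \<bar>z\<bar> powr (\<alpha> - 1)" by simp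
    finally have "m2 * \<bar>LINT p|L3. ?k p\<bar> \<le> m2 * ((LINT p|L3. cones t t' p) * ?K * \<bar>z\<bar> powr (\<alpha> - 1))"
      by (rule mult_left_mono[OF _ m2_nonneg])
    then have "\<bar>covariance t t' z\<bar> \<le> ?M1 * \<bar>z\<bar> powr (\<alpha> - 1)"
      unfolding covariance_as_integral abs_mult abs_of_nonneg[OF m2_nonneg] by (simp only: mult.assoc)
    also have "\<dots> \<le> (?M1 + ?M2) * \<bar>z\<bar> powr (\<alpha> - 1)" using M2 by (intro mult_right_mono) auto
    finally show ?thesis .
  next
    case False
    have "1 = \<bar>z\<bar> powr (1 - \<alpha>) * \<bar>z\<bar> powr (\<alpha> - 1)" using z by (simp add: powr_add[symmetric])
    also have "\<dots> \<le> (2 * (t + t')) powr (1 - \<alpha>) * \<bar>z\<bar> powr (\<alpha> - 1)"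
      using False \<alpha> by (intro mult_right_mono powr_mono2) auto
    finally have "B * 1 \<le> B * ((2 * (t + t')) powr (1 - \<alpha>) * \<bar>z\<bar> powr (\<alpha> - 1))"
      using B by (intro mult_left_mono) auto
    then have "\<bar>covariance t t' z\<bar> \<le> ?M2 * \<bar>z\<bar> powr (\<alpha> - 1)" using B(2)[of z] by simp
    also have "\<dots> \<le> (?M1 + ?M2) * \<bar>z\<bar> powr (\<alpha> - 1)" using M1 by (intro mult_right_mono) auto
    finally show ?thesis .
  qed
  then show ?thesis by (rule that)
qed

lemma filterlim_abs_add:
  fixes z :: "nat \<Rightarrow> real"
  assumes "filterlim (\<lambda>n. \<bar>z n\<bar>) at_top sequentially" shows "filterlim (\<lambda>n. \<bar>w + z n\<bar>) at_top sequentially"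
proof (rule filterlim_at_top_mono)
  show "filterlim (\<lambda>n. - \<bar>w\<bar> + \<bar>z n\<bar>) at_top sequentially"
    by (rule filterlim_tendsto_add_at_top[OF tendsto_const assms])
qed (auto intro!: always_eventually)

text \<open>The crude decay at equal times, fed back: distant values of the solution decorrelate and
  each has mean 1.\<close>

lemma J_tendsto_1:
  assumes s: "0 < s" and z: "filterlim (\<lambda>n. \<bar>z n\<bar>) at_top sequentially"
  shows "(\<lambda>n. J s (y + z n) y') \<longlonglongrightarrow> 1"
proof -
  obtain M where M: "\<And>z. z \<noteq> 0 \<Longrightarrow> \<bar>covariance s s z\<bar> \<le> M * \<bar>z\<bar> powr (\<alpha> - 1)"
    using covariance_decay[OF s s] by blast
  let ?w = "\<lambda>n. (y - y') + z n"
  have w: "filterlim (\<lambda>n. \<bar>?w n\<bar>) at_top sequentially" by (rule filterlim_abs_add[OF z])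
  have "((\<lambda>x. M * x powr (\<alpha> - 1)) \<longlongrightarrow> M * 0) at_top"
    using \<alpha> by (intro tendsto_mult tendsto_const tendsto_neg_powr filterlim_ident) auto
  from filterlim_compose[OF this w] have lim: "(\<lambda>n. M * \<bar>?w n\<bar> powr (\<alpha> - 1)) \<longlonglongrightarrow> 0" by simp
  have "eventually (\<lambda>n. 1 \<le> \<bar>?w n\<bar>) sequentially" using w unfolding filterlim_at_top by blast
  then have "eventually (\<lambda>n. norm (covariance s s (?w n)) \<le> M * \<bar>?w n\<bar> powr (\<alpha> - 1)) sequentially"
    by eventually_elim (use M in auto)
  from Lim_null_comparison[OF this lim] have "(\<lambda>n. covariance s s (?w n)) \<longlonglongrightarrow> 0" .
  from tendsto_add[OF tendsto_const[of 1] this]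
  show ?thesis using s by (simp add: J_eq_covariance algebra_simps)
qed

text \<open>Factoring \<open>z n\<close> out of \<open>w + z n\<close> leaves a ratio that tends to
  1, so a fixed displacement is invisible on the scale of \<open>z n\<close>.\<close>

lemma fr_tendsto:
  assumes z: "filterlim (\<lambda>n. \<bar>z n\<bar>) at_top sequentially"
  shows "(\<lambda>n. \<bar>z n\<bar> powr (1 - \<alpha>) * fr (w + z n)) \<longlonglongrightarrow> c"
proof -
  have zi: "filterlim z at_infinity sequentially"
    using z by (auto simp: filterlim_at_infinity_conv_norm_at_top)
  have "(\<lambda>n. w * inverse (z n) + 1) \<longlonglongrightarrow> w * 0 + 1"
    by (intro tendsto_intros filterlim_compose[OF tendsto_inverse_0 zi])
  then have "(\<lambda>n. \<bar>w * inverse (z n) + 1\<bar> powr (\<alpha> - 1)) \<longlonglongrightarrow> \<bar>w * 0 + 1\<bar> powr (\<alpha> - 1)"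
    by (intro tendsto_powr tendsto_rabs tendsto_const) auto
  from tendsto_mult_left[OF this, of c]
  have lim: "(\<lambda>n. c * \<bar>w * inverse (z n) + 1\<bar> powr (\<alpha> - 1)) \<longlonglongrightarrow> c" by simp
  have "eventually (\<lambda>n. \<bar>w\<bar> + 1 \<le> \<bar>z n\<bar>) sequentially" using z unfolding filterlim_at_top by blast
  then have "eventually (\<lambda>n. c * \<bar>w * inverse (z n) + 1\<bar> powr (\<alpha> - 1) = \<bar>z n\<bar> powr (1 - \<alpha>) * fr (w + z n)) sequentially"
  proof eventually_elim
    case (elim n)
    then have nz: "z n \<noteq> 0" "w + z n \<noteq> 0" by auto
    have "w + z n = z n * (w * inverse (z n) + 1)" using nz by (simp add: field_simps)
    then have "\<bar>w + z n\<bar> powr (\<alpha> - 1) = \<bar>z n\<bar> powr (\<alpha> - 1) * \<bar>w * inverse (z n) + 1\<bar> powr (\<alpha> - 1)"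
      by (metis abs_ge_zero abs_mult powr_mult)
    moreover have "\<bar>z n\<bar> powr (1 - \<alpha>) * \<bar>z n\<bar> powr (\<alpha> - 1) = 1" using nz by (simp add: powr_add[symmetric])
    ultimately show ?case unfolding riesz[OF nz(2)]
      by (simp add: mult.left_commute[of "\<bar>z n\<bar> powr (1 - \<alpha>)"] flip: mult.assoc)
  qed
  with lim show ?thesis by (rule Lim_transform_eventually)
qed

text \<open>In the integral over the fixed cones \<open>J\<close> tends to 1 and the rescaled
  correlation to \<open>c\<close>. Each slice of a cone has mass \<open>t - s\<close>, so the
  remaining integral is that of \<open>(t - s) * (t' - s)\<close> over
  \<open>0 < s < min t t'\<close>.\<close>

lemma covariance_asymptotics:
  assumes t: "0 < t" "0 < t'" and z: "filterlim (\<lambda>n. \<bar>z n\<bar>) at_top sequentially"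
  shows "(\<lambda>n. \<bar>z n\<bar> powr (1 - \<alpha>) * covariance t t' (z n)) \<longlonglongrightarrow> m2 * (c * (LINT p|L3. cones t t' p))"
proof -
  have "eventually (\<lambda>n. 2 * (t + t') \<le> \<bar>z n\<bar>) sequentially" using z unfolding filterlim_at_top by blast
  then obtain k where k: "\<And>n. k \<le> n \<Longrightarrow> 2 * (t + t') \<le> \<bar>z n\<bar>" by (auto simp: eventually_sequentially)
  \<comment> \<open>The dominating function is valid only far out; the sequence is shifted to start
    there, and the shift is undone at the end.\<close>
  define w where "w n = z (n + k)" for n
  have wz: "2 * (t + t') \<le> \<bar>w n\<bar>" for n unfolding w_def by (rule k) simp
  have w0: "w n \<noteq> 0" for n using wz[of n] t by auto
  have w: "filterlim (\<lambda>n. \<bar>w n\<bar>) at_top sequentially"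
    unfolding w_def using z by (rule filterlim_compose) (rule filterlim_add_const_nat_at_top)
  let ?k = "\<lambda>n p. cones t t' p * J (fst p) (fst (snd p) + w n) (snd (snd p)) * fr (fst (snd p) - snd (snd p) + w n)"
  let ?B = "2 * exp (rate t * t) * (c * 2 powr (1 - \<alpha>))"
  have kb: "\<bar>\<bar>w n\<bar> powr (1 - \<alpha>) * ?k n p\<bar> \<le> cones t t' p * ?B" for n p
  proof -
    have "\<bar>?k n p\<bar> \<le> cones t t' p * (2 * exp (rate t * t) * (c * 2 powr (1 - \<alpha>) * \<bar>w n\<bar> powr (\<alpha> - 1)))"
      using covariance_far_integrand[of t t' "w n" "fst p" "fst (snd p)" "snd (snd p)"] t wz[of n] w0[of n] by simp
    then have "\<bar>w n\<bar> powr (1 - \<alpha>) * \<bar>?k n p\<bar> \<le> \<bar>w n\<bar> powr (1 - \<alpha>) * (cones t t' p * (2 * exp (rate t * t) * (c * 2 powr (1 - \<alpha>) * \<bar>w n\<bar> powr (\<alpha> - 1))))"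
      by (rule mult_left_mono) simp
    also have "\<dots> = cones t t' p * ?B * (\<bar>w n\<bar> powr (1 - \<alpha>) * \<bar>w n\<bar> powr (\<alpha> - 1))" by (simp only: mult_ac)
    also have "\<bar>w n\<bar> powr (1 - \<alpha>) * \<bar>w n\<bar> powr (\<alpha> - 1) = 1" using w0[of n] by (simp add: powr_add[symmetric])
    finally show ?thesis by (simp add: abs_mult)
  qed
  have km: "(\<lambda>p. \<bar>w n\<bar> powr (1 - \<alpha>) * ?k n p) \<in> borel_measurable L3" for n
  proof -
    have "(\<lambda>p. fr (fst (snd p) - snd (snd p) + w n)) \<in> borel_measurable L3" by measurable
    then show ?thesis
      by (intro borel_measurable_times borel_measurable_const cones_measurable J_shift_measurable)
  qed
  have "(\<lambda>n. LINT p|L3. \<bar>w n\<bar> powr (1 - \<alpha>) * ?k n p) \<longlonglongrightarrow> (LINT p|L3. cones t t' p * c)"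
  proof (rule integral_dominated_convergence[where w="\<lambda>p. cones t t' p * ?B"])
    show "integrable L3 (\<lambda>p. cones t t' p * ?B)" by (rule integrable_mult_left) (rule integrable_cones)
    show "AE p in L3. norm (\<bar>w n\<bar> powr (1 - \<alpha>) * ?k n p) \<le> cones t t' p * ?B" for n
      using kb by (intro AE_I2) simp
    show "AE p in L3. (\<lambda>n. \<bar>w n\<bar> powr (1 - \<alpha>) * ?k n p) \<longlonglongrightarrow> cones t t' p * c"
    proof (rule AE_I2)
      fix p :: "real \<times> real \<times> real"
      show "(\<lambda>n. \<bar>w n\<bar> powr (1 - \<alpha>) * ?k n p) \<longlonglongrightarrow> cones t t' p * c"
      proof (cases "cones t t' p = 0")
        case False
        then have "0 < fst p" using cones_support(1)[of t t' "fst p" "fst (snd p)" "snd (snd p)"] by simp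
        from tendsto_mult[OF tendsto_mult[OF tendsto_const[of "cones t t' p"] J_tendsto_1[OF this w]] fr_tendsto[OF w]]
        have "(\<lambda>n. cones t t' p * J (fst p) (fst (snd p) + w n) (snd (snd p)) *
          (\<bar>w n\<bar> powr (1 - \<alpha>) * fr (fst (snd p) - snd (snd p) + w n))) \<longlonglongrightarrow> cones t t' p * 1 * c" .
        then show ?thesis by (simp only: mult_1_right mult.left_commute[of "\<bar>w _\<bar> powr (1 - \<alpha>)"])
      qed simp
    qed
    show "(\<lambda>p. cones t t' p * c) \<in> borel_measurable L3" using cones_measurable by measurable
  qed (rule km)
  from tendsto_mult_left[OF this, of m2]
  have "(\<lambda>n. m2 * (LINT p|L3. \<bar>w n\<bar> powr (1 - \<alpha>) * ?k n p)) \<longlonglongrightarrow> m2 * (LINT p|L3. cones t t' p * c)" .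
  moreover have "m2 * (LINT p|L3. \<bar>w n\<bar> powr (1 - \<alpha>) * ?k n p) = \<bar>w n\<bar> powr (1 - \<alpha>) * covariance t t' (w n)" for n
    unfolding integral_mult_right_zero covariance_as_integral by (rule mult.left_commute)
  moreover have "(LINT p|L3. cones t t' p * c) = c * (LINT p|L3. cones t t' p)" by simp
  ultimately have "(\<lambda>n. \<bar>w n\<bar> powr (1 - \<alpha>) * covariance t t' (w n)) \<longlonglongrightarrow> m2 * (c * (LINT p|L3. cones t t' p))"
    by (simp only:)
  then show ?thesis unfolding w_def by (rule LIMSEQ_offset)
qed

end

end

section \<open>Integrable and Riesz kernels\<close>

context correlation_kernel
begin

lemma ennreal_fr_le: "ennreal (fr w) \<le> f w"
  by (cases "f w") (simp_all add: fr_def)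

text \<open>By Tonelli the integral of the correlation is the square of the integral of the
  kernel.\<close>

lemma corr_integrable:
  assumes "(\<integral>\<^sup>+x. \<kappa> x \<partial>lborel) < \<infinity>"
  shows "(\<integral>\<^sup>+w. f w \<partial>lborel) < \<infinity>"
proof -
  have "(\<integral>\<^sup>+w. f w \<partial>lborel) = (\<integral>\<^sup>+w. \<integral>\<^sup>+x. \<kappa> (x - w) * \<kappa> x \<partial>lborel \<partial>lborel)"
    using corr_eq[of _ 0] by simp
  also have "\<dots> = (\<integral>\<^sup>+x. \<integral>\<^sup>+w. \<kappa> (x - w) * \<kappa> x \<partial>lborel \<partial>lborel)"
    by (rule lborel_pair.Fubini') measurable
  also have "\<dots> = (\<integral>\<^sup>+x. (\<integral>\<^sup>+w. \<kappa> w \<partial>lborel) * \<kappa> x \<partial>lborel)"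
  proof (rule nn_integral_cong)
    fix x :: real
    have "(\<integral>\<^sup>+w. \<kappa> w \<partial>lborel) = (\<integral>\<^sup>+w. \<kappa> (x - w) \<partial>lborel)"
      by (subst nn_integral_real_affine[where c="- 1" and t=x]) auto
    then show "(\<integral>\<^sup>+w. \<kappa> (x - w) * \<kappa> x \<partial>lborel) = (\<integral>\<^sup>+w. \<kappa> w \<partial>lborel) * \<kappa> x"
      by (simp add: nn_integral_multc)
  qed
  also have "\<dots> = (\<integral>\<^sup>+w. \<kappa> w \<partial>lborel) * (\<integral>\<^sup>+x. \<kappa> x \<partial>lborel)" by (rule nn_integral_cmult) measurable
  also have "\<dots> < \<infinity>" using assms by (simp add: ennreal_mult_less_top)
  finally show ?thesis .
qed

text \<open>The convolution of the Riesz kernel with itself is found, up to a constant, from its homogeneity.\<close>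

lemma riesz_corr:
  assumes \<alpha>: "0 < \<alpha>" "\<alpha> < 1" and \<kappa>: "\<kappa> = riesz_kernel (\<alpha> / 2)"
  shows "0 < fr 1" and "w \<noteq> 0 \<Longrightarrow> fr w = fr 1 * \<bar>w\<bar> powr (\<alpha> - 1)"
proof -
  let ?b = "1 - \<alpha> / 2"
  have rc: "0 < riesz_const (\<alpha> / 2)"
    unfolding riesz_const_def using \<alpha> by (intro mult_pos_pos divide_pos_pos Gamma_real_pos) auto
  \<comment> \<open>The kernel is positive away from 0 and infinite at 0, so the integrand defining
    \<open>f 1\<close> vanishes nowhere and \<open>f 1\<close> is positive.\<close>
  have pos: "\<kappa> x \<noteq> 0" for x using rc by (simp add: \<kappa> riesz_kernel_def)
  have hom: "\<kappa> (l * x) = ennreal (l powr (- ?b)) * \<kappa> x" if l: "0 < l" for l x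
  proof (cases "x = 0")
    case True then show ?thesis using l by (simp add: \<kappa> riesz_kernel_def ennreal_mult_top)
  next
    case False
    have "\<bar>l * x\<bar> powr (- ?b) = l powr (- ?b) * \<bar>x\<bar> powr (- ?b)" using l by (simp add: abs_mult powr_mult)
    then have "riesz_const (\<alpha> / 2) * \<bar>l * x\<bar> powr (- ?b) = l powr (- ?b) * (riesz_const (\<alpha> / 2) * \<bar>x\<bar> powr (- ?b))"
      by (simp only: mult.left_commute)
    then show ?thesis using l rc False by (simp add: \<kappa> riesz_kernel_def ennreal_mult mult.left_commute)
  qed
  have "f 1 \<noteq> 0"
  proof
    assume "f 1 = 0"
    then have "(\<integral>\<^sup>+x. \<kappa> (x - 1) * \<kappa> (x - 0) \<partial>lborel) = 0" using corr_eq[of 1 0] by simp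
    then have "AE x in lborel. \<kappa> (x - 1) * \<kappa> (x - 0) = 0" by (subst (asm) nn_integral_0_iff_AE) auto
    then have "AE x in (lborel :: real measure). False" using pos by simp
    then have "emeasure lborel (UNIV :: real set) = 0"
      by (subst (asm) AE_iff_measurable[where N=UNIV]) auto
    then show False by simp
  qed
  then show "0 < fr 1" unfolding fr_def using corr_finite[of 1] by (simp add: enn2real_positive_iff zero_less_iff_neq_zero)
  have fl: "fr l = fr 1 * l powr (\<alpha> - 1)" if l: "0 < l" for l
  proof -
    have "f l = (\<integral>\<^sup>+x. \<kappa> (x - l) * \<kappa> (x - 0) \<partial>lborel)" using corr_eq[of l 0] by simp
    also have "\<dots> = ennreal l * (\<integral>\<^sup>+x. \<kappa> (l * x - l) * \<kappa> (l * x - 0) \<partial>lborel)"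
      using l by (subst nn_integral_real_affine[where c=l and t=0]) auto
    also have "(\<integral>\<^sup>+x. \<kappa> (l * x - l) * \<kappa> (l * x - 0) \<partial>lborel) =
      (\<integral>\<^sup>+x. ennreal (l powr (- ?b) * l powr (- ?b)) * (\<kappa> (x - 1) * \<kappa> (x - 0)) \<partial>lborel)"
    proof (rule nn_integral_cong)
      fix x
      have "\<kappa> (l * x - l) = ennreal (l powr (- ?b)) * \<kappa> (x - 1)"
        using hom[OF l, of "x - 1"] by (simp add: right_diff_distrib)
      moreover have "\<kappa> (l * x - 0) = ennreal (l powr (- ?b)) * \<kappa> (x - 0)" using hom[OF l, of x] by simp
      ultimately show "\<kappa> (l * x - l) * \<kappa> (l * x - 0) = ennreal (l powr (- ?b) * l powr (- ?b)) * (\<kappa> (x - 1) * \<kappa> (x - 0))"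
        by (simp only: ennreal_mult powr_ge_zero mult_ac)
    qed
    also have "\<dots> = ennreal (l powr (- ?b) * l powr (- ?b)) * f 1"
      using corr_eq[of 1 0] by (subst nn_integral_cmult) auto
    finally have "f l = ennreal (l * (l powr (- ?b) * l powr (- ?b))) * f 1"
      using l by (simp add: ennreal_mult mult.assoc)
    \<comment> \<open>One power of \<open>l\<close> from the substitution and two from the kernels:
      \<open>1 - 2 * (1 - \<alpha> / 2) = \<alpha> - 1\<close>.\<close>
    moreover have "l * (l powr (- ?b) * l powr (- ?b)) = l powr (\<alpha> - 1)"
      using l powr_add[of l 1 "- ?b + - ?b"] powr_add[of l "- ?b" "- ?b"] by simp
    ultimately show ?thesis by (simp add: fr_def enn2real_mult mult.commute)
  qed
  show "fr w = fr 1 * \<bar>w\<bar> powr (\<alpha> - 1)" if "w \<noteq> 0"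
    using fl[of "\<bar>w\<bar>"] fr_sym[of w] that by (cases "0 < w") auto
qed

text \<open>The power is a multiple of the correlation off the diagonal, and the correlation has
  finite mass on bounded sets; no explicit integration of the power is called for.\<close>

lemma riesz_window_integrable:
  assumes c: "0 < c" and fr: "\<And>w. w \<noteq> 0 \<Longrightarrow> fr w = c * \<bar>w\<bar> powr (\<alpha> - 1)"
  shows "integrable (lborel \<Otimes>\<^sub>M lborel)
    (\<lambda>(x', x). indicator {-1..1} x * indicator {-1..1} x' * \<bar>x - x'\<bar> powr (\<alpha> - 1))"
proof (rule integrableI_bounded)
  let ?k = "\<lambda>(x', x). indicator {-1..1} x * indicator {-1..1} x' * \<bar>x - x'\<bar> powr (\<alpha> - 1)"
  show m: "?k \<in> borel_measurable (lborel \<Otimes>\<^sub>M lborel)" by measurable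
  have "(\<integral>\<^sup>+p. ennreal (norm (?k p)) \<partial>(lborel \<Otimes>\<^sub>M lborel)) = (\<integral>\<^sup>+x'. \<integral>\<^sup>+x. ennreal (norm (?k (x', x))) \<partial>lborel \<partial>lborel)"
    by (rule lborel.nn_integral_fst[symmetric]) measurable
  also have "\<dots> = (\<integral>\<^sup>+x'. \<integral>\<^sup>+x. ennreal (1 / c) * (indicator {-1..1} x' * indicator {-1..1} x * f (x' - x)) \<partial>lborel \<partial>lborel)"
  proof (rule nn_integral_cong, rule nn_integral_cong_AE)
    fix x' :: real
    show "AE x in lborel. ennreal (norm (?k (x', x))) = ennreal (1 / c) * (indicator {-1..1} x' * indicator {-1..1} x * f (x' - x))"
      using AE_lborel_singleton[of x']
    proof eventually_elim
      case (elim x)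
      then have "f (x' - x) = ennreal (c * \<bar>x - x'\<bar> powr (\<alpha> - 1))"
        using ennreal_fr[of "x' - x"] fr[of "x' - x"] by (simp add: abs_minus_commute)
      then have "ennreal (1 / c) * f (x' - x) = ennreal (\<bar>x - x'\<bar> powr (\<alpha> - 1))"
        using c by (simp add: ennreal_mult[symmetric])
      then show ?case by (auto simp: indicator_def)
    qed
  qed
  also have "\<dots> = ennreal (1 / c) * (\<integral>\<^sup>+x'. \<integral>\<^sup>+x. indicator {-1..1} x' * indicator {-1..1} x * f (x' - x) \<partial>lborel \<partial>lborel)"
    by (simp add: nn_integral_cmult)
  also have "\<dots> \<le> ennreal (1 / c) * (emeasure lborel {-1..1::real} * corr_mass 2)"
    by (intro mult_left_mono corr_box_le) auto
  also have "\<dots> < \<infinity>" using corr_mass_finite[of 2] by (simp add: ennreal_mult_less_top)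
  finally show "(\<integral>\<^sup>+p. ennreal (norm (?k p)) \<partial>(lborel \<Otimes>\<^sub>M lborel)) < \<infinity>" .
qed

end

context mild_noise
begin

section \<open>Integrability of the covariance and the two growth regimes\<close>

lemma covariance_measurable:
  assumes t: "0 \<le> t" "0 \<le> t'" shows "covariance t t' \<in> borel_measurable borel"
proof -
  have 1: "(\<lambda>p. u t (fst p) (snd p)) \<in> borel_measurable (borel \<Otimes>\<^sub>M P)"
    using measurable_compose[of "\<lambda>p. (snd p, fst p)" "borel \<Otimes>\<^sub>M P" "P \<Otimes>\<^sub>M lborel" "\<lambda>(\<omega>, x). u t x \<omega>", OF _ measurable_u[OF t(1)]]
    by (simp add: measurable_Pair)
  have 2: "(\<lambda>p. u t' 0 (snd p)) \<in> borel_measurable (borel \<Otimes>\<^sub>M P)"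
    by (rule measurable_compose[OF measurable_snd measurable_u_section[OF t(2)]])
  have "(\<lambda>(z, \<omega>). (u t z \<omega> - 1) * (u t' 0 \<omega> - 1)) \<in> borel_measurable (borel \<Otimes>\<^sub>M P)"
    unfolding case_prod_beta' using 1 2 by (intro borel_measurable_times borel_measurable_diff) auto
  then have "(\<lambda>z. expectation (\<lambda>\<omega>. (u t z \<omega> - 1) * (u t' 0 \<omega> - 1))) \<in> borel_measurable borel"
    by (rule borel_measurable_lebesgue_integral)
  then show ?thesis by (simp add: covariance_stationary[OF t])
qed

text \<open>With the cones fixed and \<open>J\<close> bounded on them, integrating over
  \<open>z\<close> first gives the full integral of the correlation for every point of the cones,
  leaving their finite mass as a factor.\<close>

lemma covariance_integrable:
  assumes t: "0 \<le> t" "0 \<le> t'" and \<kappa>: "(\<integral>\<^sup>+x. \<kappa> x \<partial>lborel) < \<infinity>"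
  shows "integrable lborel (covariance t t')"
proof (rule integrableI_bounded)
  show "covariance t t' \<in> borel_measurable lborel" using covariance_measurable[OF t] by simp
  let ?B = "m2 * (2 * exp (rate t * t))"
  let ?g = "\<lambda>z p. ennreal (cones t t' p) * f (fst (snd p) - snd (snd p) + z)"
  interpret L: pair_sigma_finite "lborel :: real measure" L3
    by (simp add: pair_sigma_finite_def lborel_prod sigma_finite_lborel)
  have B: "0 \<le> ?B" using m2_nonneg by simp
  have le: "ennreal \<bar>covariance t t' z\<bar> \<le> ennreal ?B * (\<integral>\<^sup>+p. ?g z p \<partial>L3)" for z
  proof -
    let ?k = "\<lambda>p. cones t t' p * J (fst p) (fst (snd p) + z) (snd (snd p)) * fr (fst (snd p) - snd (snd p) + z)"
    have "ennreal \<bar>LINT p|L3. ?k p\<bar> \<le> (\<integral>\<^sup>+p. ennreal \<bar>?k p\<bar> \<partial>L3)"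
    proof (cases "integrable L3 ?k")
      case True from integral_norm_bound_ennreal[OF this] show ?thesis by simp
    qed (simp add: not_integrable_integral_eq)
    also have "\<dots> \<le> (\<integral>\<^sup>+p. ennreal (2 * exp (rate t * t)) * ?g z p \<partial>L3)"
    proof (rule nn_integral_mono)
      fix p :: "real \<times> real \<times> real"
      show "ennreal \<bar>?k p\<bar> \<le> ennreal (2 * exp (rate t * t)) * ?g z p"
      proof (cases "cones t t' p = 0")
        case False
        note sp = cones_support[of t t' "fst p" "fst (snd p)" "snd (snd p)", simplified, OF False]
        have "\<bar>J (fst p) (fst (snd p) + z) (snd (snd p))\<bar> \<le> 2 * exp (rate t * fst p)" using sp by (intro J_bound) auto
        also have "\<dots> \<le> 2 * exp (rate t * t)" using sp rate_pos[OF t(1)] by simp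
        finally have "\<bar>J (fst p) (fst (snd p) + z) (snd (snd p))\<bar> * (cones t t' p * fr (fst (snd p) - snd (snd p) + z)) \<le>
          2 * exp (rate t * t) * (cones t t' p * fr (fst (snd p) - snd (snd p) + z))"
          using cones_nonneg by (intro mult_right_mono) auto
        then have "\<bar>?k p\<bar> \<le> 2 * exp (rate t * t) * (cones t t' p * fr (fst (snd p) - snd (snd p) + z))"
          using cones_nonneg[of t t' p] by (simp add: abs_mult mult_ac)
        then have "ennreal \<bar>?k p\<bar> \<le> ennreal (2 * exp (rate t * t) * (cones t t' p * fr (fst (snd p) - snd (snd p) + z)))"
          by (rule ennreal_leI)
        also have "\<dots> = ennreal (2 * exp (rate t * t)) * (ennreal (cones t t' p) * ennreal (fr (fst (snd p) - snd (snd p) + z)))"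
          using cones_nonneg by (subst ennreal_mult, simp, simp, subst ennreal_mult) auto
        also have "\<dots> \<le> ennreal (2 * exp (rate t * t)) * ?g z p"
        proof (intro mult_left_mono)
          show "ennreal (fr (fst (snd p) - snd (snd p) + z)) \<le> f (fst (snd p) - snd (snd p) + z)"
            by (rule ennreal_fr_le)
        qed auto
        finally show ?thesis .
      qed simp
    qed
    also have "\<dots> = ennreal (2 * exp (rate t * t)) * (\<integral>\<^sup>+p. ?g z p \<partial>L3)"
    proof (rule nn_integral_cmult)
      have "(\<lambda>p. f (fst (snd p) - snd (snd p) + z)) \<in> borel_measurable L3" by measurable
      then show "?g z \<in> borel_measurable L3"
        by (intro borel_measurable_times_ennreal measurable_compose[OF cones_measurable]) auto
    qed
    finally have "ennreal m2 * ennreal \<bar>LINT p|L3. ?k p\<bar> \<le> ennreal m2 * (ennreal (2 * exp (rate t * t)) * (\<integral>\<^sup>+p. ?g z p \<partial>L3))"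
      by (rule mult_left_mono) simp
    then show ?thesis
      using m2_nonneg by (simp add: covariance_as_integral abs_mult ennreal_mult mult.assoc)
  qed
  have gm: "(\<lambda>(z, p). ?g z p) \<in> borel_measurable (lborel \<Otimes>\<^sub>M L3)"
  proof -
    have "(\<lambda>q. f (fst (snd (snd q)) - snd (snd (snd q)) + fst q)) \<in> borel_measurable (lborel \<Otimes>\<^sub>M L3)" by measurable
    moreover have "(\<lambda>q. ennreal (cones t t' (snd q))) \<in> borel_measurable (lborel \<Otimes>\<^sub>M L3)"
      by (rule measurable_compose[OF measurable_snd measurable_compose[OF cones_measurable measurable_ennreal]])
    ultimately show ?thesis unfolding case_prod_beta' by (intro borel_measurable_times_ennreal)
  qed
  have "(\<integral>\<^sup>+z. ennreal (norm (covariance t t' z)) \<partial>lborel) \<le> (\<integral>\<^sup>+z. ennreal ?B * (\<integral>\<^sup>+p. ?g z p \<partial>L3) \<partial>lborel)"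
    using le by (intro nn_integral_mono) simp
  also have "\<dots> = ennreal ?B * (\<integral>\<^sup>+z. \<integral>\<^sup>+p. ?g z p \<partial>L3 \<partial>lborel)"
    by (intro nn_integral_cmult L.M2.borel_measurable_nn_integral gm)
  also have "(\<integral>\<^sup>+z. \<integral>\<^sup>+p. ?g z p \<partial>L3 \<partial>lborel) = (\<integral>\<^sup>+p. \<integral>\<^sup>+z. ?g z p \<partial>lborel \<partial>L3)"
    by (rule L.Fubini'[OF gm, symmetric])
  also have "\<dots> = (\<integral>\<^sup>+p. ennreal (cones t t' p) * (\<integral>\<^sup>+w. f w \<partial>lborel) \<partial>L3)"
  proof (rule nn_integral_cong)
    fix p :: "real \<times> real \<times> real"
    have "(\<integral>\<^sup>+w. f w \<partial>lborel) = (\<integral>\<^sup>+z. f (fst (snd p) - snd (snd p) + z) \<partial>lborel)"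
      by (subst nn_integral_real_affine[where c=1 and t="fst (snd p) - snd (snd p)"]) auto
    then show "(\<integral>\<^sup>+z. ?g z p \<partial>lborel) = ennreal (cones t t' p) * (\<integral>\<^sup>+w. f w \<partial>lborel)"
      by (simp add: nn_integral_cmult)
  qed
  also have "\<dots> = (\<integral>\<^sup>+p. ennreal (cones t t' p) \<partial>L3) * (\<integral>\<^sup>+w. f w \<partial>lborel)"
    by (intro nn_integral_multc measurable_compose[OF cones_measurable]) auto
  also have "(\<integral>\<^sup>+p. ennreal (cones t t' p) \<partial>L3) = ennreal (LINT p|L3. cones t t' p)"
    using cones_nonneg by (intro nn_integral_eq_integral integrable_cones) auto
  also have "ennreal ?B * (ennreal (LINT p|L3. cones t t' p) * (\<integral>\<^sup>+w. f w \<partial>lborel)) < \<infinity>"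
    using corr_integrable[OF \<kappa>] by (simp add: ennreal_mult_less_top)
  finally show "(\<integral>\<^sup>+z. ennreal (norm (covariance t t' z)) \<partial>lborel) < \<infinity>" .
qed

lemma window_covariance_limit:
  assumes B: "assumption_B \<kappa>" and \<beta>1: "integrable_kernel \<kappa> \<Longrightarrow> \<beta> = 1"
    and \<beta>2: "\<And>\<alpha>. 0 < \<alpha> \<Longrightarrow> \<alpha> < 1 \<Longrightarrow> \<kappa> = riesz_kernel (\<alpha> / 2) \<Longrightarrow> \<beta> = \<alpha> + 1" and t: "0 < t" "0 < t'"
  shows "\<exists>k. ((\<lambda>R. R powr (- \<beta>) * window_integral (covariance t t') R) \<longlongrightarrow> k) at_top"
proof (cases "integrable_kernel \<kappa>")
  case True
  then have "integrable lborel (covariance t t')"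
    using t by (intro covariance_integrable) (auto simp: integrable_kernel_def)
  from window_integral_integrable_limit[OF this]
  have lim: "((\<lambda>R. 1 / R * window_integral (covariance t t') R) \<longlongrightarrow> 2 * (LINT z|lborel. covariance t t' z)) at_top" .
  \<comment> \<open>The two normalisations are compared for \<open>R > 0\<close> only, which
    suffices at infinity.\<close>
  moreover have "eventually (\<lambda>R. 1 / R * window_integral (covariance t t') R = R powr (- \<beta>) * window_integral (covariance t t') R) at_top"
    using eventually_gt_at_top[of 0] by eventually_elim (simp add: \<beta>1[OF True] powr_minus_divide)
  ultimately have "((\<lambda>R. R powr (- \<beta>) * window_integral (covariance t t') R) \<longlongrightarrow> 2 * (LINT z|lborel. covariance t t' z)) at_top"
    by (rule Lim_transform_eventually)
  then show ?thesis by blast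
next
  case False
  then obtain \<alpha> where \<alpha>: "0 < \<alpha>" "\<alpha> < 1" "\<kappa> = riesz_kernel (\<alpha> / 2)" using B by (auto simp: assumption_B_def)
  note c = riesz_corr[OF \<alpha>]
  obtain M where M: "\<And>z. z \<noteq> 0 \<Longrightarrow> \<bar>covariance t t' z\<bar> \<le> M * \<bar>z\<bar> powr (\<alpha> - 1)"
    using covariance_decay[OF \<alpha>(1,2) less_imp_le[OF c(1)] c(2) t] by blast
  have "((\<lambda>R. R powr (- (\<alpha> + 1)) * window_integral (covariance t t') R) \<longlongrightarrow>
    (LINT (x', x)|(lborel \<Otimes>\<^sub>M lborel). m2 * (fr 1 * (LINT p|L3. cones t t' p)) *
      (indicator {-1..1} x * indicator {-1..1} x' * \<bar>x - x'\<bar> powr (\<alpha> - 1)))) at_top"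
  proof (rule window_integral_power_limit[OF _ \<alpha>(1) M])
    show "covariance t t' \<in> borel_measurable borel" using t by (intro covariance_measurable) auto
    show "integrable (lborel \<Otimes>\<^sub>M lborel) (\<lambda>(x', x). indicator {-1..1} x * indicator {-1..1} x' * \<bar>x - x'\<bar> powr (\<alpha> - 1))"
      by (rule riesz_window_integrable[OF c])
    show "(\<lambda>n. \<bar>z n\<bar> powr (1 - \<alpha>) * covariance t t' (z n)) \<longlonglongrightarrow> m2 * (fr 1 * (LINT p|L3. cones t t' p))"
      if "filterlim (\<lambda>n. \<bar>z n\<bar>) at_top sequentially" for z
      by (rule covariance_asymptotics[OF \<alpha>(1,2) less_imp_le[OF c(1)] c(2) t that])
  qed
  then show ?thesis using \<beta>2[OF \<alpha>] by auto
qed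

section \<open>The spatial integral\<close>

text \<open>The indicator is absorbed into the integrand, so that Fubini's theorem is applied over
  the whole line.\<close>

definition window :: "real \<Rightarrow> real \<Rightarrow> real \<Rightarrow> 'w \<Rightarrow> real" where
  "window t R x \<omega> = indicator {-R..R} x * (u t x \<omega> - 1)"

lemma window_measurable:
  assumes "0 \<le> t" shows "(\<lambda>(\<omega>, x). window t R x \<omega>) \<in> borel_measurable (P \<Otimes>\<^sub>M lborel)"
proof -
  have "(\<lambda>p. u t (snd p) (fst p)) \<in> borel_measurable (P \<Otimes>\<^sub>M lborel)"
    using measurable_u[OF assms] by (simp add: case_prod_beta')
  then show ?thesis unfolding window_def case_prod_beta' by measurable
qed

lemma spatial_integral_eq: "spatial_integral u R t \<omega> = (LINT x|lborel. window t R x \<omega>)"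
  by (simp add: spatial_integral_def set_lebesgue_integral_def window_def)

text \<open>The product is at most half the sum of the squares, and \<open>covariance t t 0\<close>
  is the variance at every point of space. The resulting bound is constant on the square and makes
  the triple integral finite.\<close>

lemma window_mult_le:
  assumes t: "0 \<le> t" "0 \<le> t'"
  shows "(\<integral>\<^sup>+\<omega>. ennreal \<bar>window t R x \<omega> * window t' R x' \<omega>\<bar> \<partial>P) \<le>
    ennreal ((covariance t t 0 + covariance t' t' 0) / 2) * indicator ({-R..R} \<times> {-R..R}) (x, x')"
proof (cases "x \<in> {-R..R} \<and> x' \<in> {-R..R}")
  case True
  note sq = square_integrable_centered[OF t(1), of x] square_integrable_centered[OF t(2), of x']
  have i: "integrable P (\<lambda>\<omega>. ((u t x \<omega> - 1)\<^sup>2 + (u t' x' \<omega> - 1)\<^sup>2) / 2)"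
    using sq by (auto simp: square_integrable_def)
  have "(\<integral>\<^sup>+\<omega>. ennreal \<bar>window t R x \<omega> * window t' R x' \<omega>\<bar> \<partial>P) \<le> (\<integral>\<^sup>+\<omega>. ennreal (((u t x \<omega> - 1)\<^sup>2 + (u t' x' \<omega> - 1)\<^sup>2) / 2) \<partial>P)"
  proof (intro nn_integral_mono ennreal_leI)
    fix \<omega>
    have "2 * (\<bar>u t x \<omega> - 1\<bar> * \<bar>u t' x' \<omega> - 1\<bar>) \<le> (u t x \<omega> - 1)\<^sup>2 + (u t' x' \<omega> - 1)\<^sup>2"
      using sum_squares_bound[of "\<bar>u t x \<omega> - 1\<bar>" "\<bar>u t' x' \<omega> - 1\<bar>"] by (simp add: mult.assoc)
    then show "\<bar>window t R x \<omega> * window t' R x' \<omega>\<bar> \<le> ((u t x \<omega> - 1)\<^sup>2 + (u t' x' \<omega> - 1)\<^sup>2) / 2"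
      using True by (simp add: window_def abs_mult)
  qed
  also have "\<dots> = ennreal (expectation (\<lambda>\<omega>. ((u t x \<omega> - 1)\<^sup>2 + (u t' x' \<omega> - 1)\<^sup>2) / 2))"
    using i by (rule nn_integral_eq_integral) simp
  also have "expectation (\<lambda>\<omega>. ((u t x \<omega> - 1)\<^sup>2 + (u t' x' \<omega> - 1)\<^sup>2) / 2) =
    (expectation (\<lambda>\<omega>. (u t x \<omega> - 1)\<^sup>2) + expectation (\<lambda>\<omega>. (u t' x' \<omega> - 1)\<^sup>2)) / 2"
    using sq by (simp add: square_integrable_def)
  also have "\<dots> = (covariance t t 0 + covariance t' t' 0) / 2"
    using covariance_stationary[OF t(1,1), of x x] covariance_stationary[OF t(2,2), of x' x'] by (simp add: power2_eq_square)
  finally show ?thesis using True by simp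
next
  case False then show ?thesis by (auto simp: window_def)
qed

text \<open>Two uses of Fubini: over space and probability for almost sure integrability of paths
  and the mean, and over two space variables and probability for the product moment. Both rest on
  second moments that do not depend on the point of space.\<close>

theorem spatial_integral_covariance:
  assumes t: "0 \<le> t" "0 \<le> t'"
  shows "AE \<omega> in P. integrable lborel (\<lambda>x. window t R x \<omega>)"
    and "spatial_integral u R t \<in> borel_measurable P"
    and "integrable P (\<lambda>\<omega>. spatial_integral u R t \<omega> * spatial_integral u R t' \<omega>)"
    and "expectation (\<lambda>\<omega>. spatial_integral u R t \<omega> * spatial_integral u R t' \<omega>) = window_integral (covariance t t') R"
    and "expectation (spatial_integral u R t) = 0"
proof -
  let ?L2 = "lborel \<Otimes>\<^sub>M lborel :: (real \<times> real) measure"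
  interpret PL: pair_sigma_finite P "lborel :: real measure"
    using sigma_finite_lborel sigma_finite_measure_axioms by (simp add: pair_sigma_finite_def)
  interpret LP: pair_sigma_finite ?L2 P
    using sigma_finite_lborel_pair sigma_finite_measure_axioms by (simp add: pair_sigma_finite_def)
  have int1: "integrable (P \<Otimes>\<^sub>M lborel) (\<lambda>(\<omega>, x). window t R x \<omega>)" if t: "0 \<le> t" for t
  proof (rule integrableI_bounded[OF window_measurable[OF t]])
    have m: "(\<lambda>(x, \<omega>). ennreal \<bar>window t R x \<omega>\<bar>) \<in> borel_measurable (lborel \<Otimes>\<^sub>M P)"
      using measurable_compose[OF measurable_pair_swap'[of "lborel" P] measurable_compose[OF window_measurable[OF t, of R], of "\<lambda>x. ennreal \<bar>x\<bar>" borel]]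
      by (simp add: case_prod_beta')
    have m': "(\<lambda>p. ennreal \<bar>case p of (\<omega>, x) \<Rightarrow> window t R x \<omega>\<bar>) \<in> borel_measurable (P \<Otimes>\<^sub>M lborel)"
      by (rule measurable_compose[OF window_measurable[OF t]]) simp
    have "(\<integral>\<^sup>+p. ennreal (norm (case p of (\<omega>, x) \<Rightarrow> window t R x \<omega>)) \<partial>(P \<Otimes>\<^sub>M lborel)) =
      (\<integral>\<^sup>+x. \<integral>\<^sup>+\<omega>. ennreal \<bar>window t R x \<omega>\<bar> \<partial>P \<partial>lborel)"
      using PL.nn_integral_snd[OF m'] by simp
    also have "\<dots> \<le> (\<integral>\<^sup>+x. ennreal (1 + covariance t t 0) * indicator {-R..R} x \<partial>lborel)"
    proof (rule nn_integral_mono)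
      fix x
      note sq = square_integrable_centered[OF t, of x]
      show "(\<integral>\<^sup>+\<omega>. ennreal \<bar>window t R x \<omega>\<bar> \<partial>P) \<le> ennreal (1 + covariance t t 0) * indicator {-R..R} x"
      proof (cases "x \<in> {-R..R}")
        case True
        have "(\<integral>\<^sup>+\<omega>. ennreal \<bar>window t R x \<omega>\<bar> \<partial>P) \<le> (\<integral>\<^sup>+\<omega>. ennreal (1 + (u t x \<omega> - 1)\<^sup>2) \<partial>P)"
        proof (intro nn_integral_mono ennreal_leI)
          fix \<omega>
          have "2 * \<bar>u t x \<omega> - 1\<bar> \<le> 1 + (u t x \<omega> - 1)\<^sup>2" using sum_squares_bound[of 1 "\<bar>u t x \<omega> - 1\<bar>"] by simp
          moreover have "\<bar>u t x \<omega> - 1\<bar> \<le> 2 * \<bar>u t x \<omega> - 1\<bar>" by simp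
          ultimately have "\<bar>u t x \<omega> - 1\<bar> \<le> 1 + (u t x \<omega> - 1)\<^sup>2" by (rule order_trans[rotated])
          then show "\<bar>window t R x \<omega>\<bar> \<le> 1 + (u t x \<omega> - 1)\<^sup>2" using True by (simp add: window_def)
        qed
        also have "\<dots> = ennreal (expectation (\<lambda>\<omega>. 1 + (u t x \<omega> - 1)\<^sup>2))"
          using sq by (intro nn_integral_eq_integral) (auto simp: square_integrable_def)
        also have "expectation (\<lambda>\<omega>. 1 + (u t x \<omega> - 1)\<^sup>2) = 1 + covariance t t 0"
          using sq covariance_stationary[OF t t, of x x] by (simp add: square_integrable_def prob_space power2_eq_square)
        finally show ?thesis using True by simp
      qed (simp add: window_def)
    qed
    also have "\<dots> < \<infinity>"
      using emeasure_bounded_finite[of "{-R..R}"] by (simp add: nn_integral_cmult_indicator ennreal_mult_less_top)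
    finally show "(\<integral>\<^sup>+p. ennreal (norm (case p of (\<omega>, x) \<Rightarrow> window t R x \<omega>)) \<partial>(P \<Otimes>\<^sub>M lborel)) < \<infinity>" .
  qed
  show "AE \<omega> in P. integrable lborel (\<lambda>x. window t R x \<omega>)"
    using PL.AE_integrable_fst'[OF int1[OF t(1)]] by simp
  show "spatial_integral u R t \<in> borel_measurable P"
    unfolding spatial_integral_eq[abs_def] by (rule lborel.borel_measurable_lebesgue_integral[OF window_measurable[OF t(1)]])
  have "expectation (spatial_integral u R t) = (LINT x|lborel. expectation (window t R x))"
    unfolding spatial_integral_eq[abs_def] by (rule PL.Fubini_integral[OF int1[OF t(1)], symmetric])
  also have "\<dots> = 0" by (simp add: window_def[abs_def] expectation_centered[OF t(1)])
  finally show "expectation (spatial_integral u R t) = 0" .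
  let ?H = "\<lambda>p \<omega>. window t R (snd p) \<omega> * window t' R (fst p) \<omega>"
  have wm: "(\<lambda>q. window t R (snd (fst q)) (snd q)) \<in> borel_measurable (?L2 \<Otimes>\<^sub>M P)"
    "(\<lambda>q. window t' R (fst (fst q)) (snd q)) \<in> borel_measurable (?L2 \<Otimes>\<^sub>M P)"
    using measurable_compose[of "\<lambda>q. (snd q, snd (fst q))" "?L2 \<Otimes>\<^sub>M P" "P \<Otimes>\<^sub>M lborel", OF _ window_measurable[OF t(1), of R]]
      measurable_compose[of "\<lambda>q. (snd q, fst (fst q))" "?L2 \<Otimes>\<^sub>M P" "P \<Otimes>\<^sub>M lborel", OF _ window_measurable[OF t(2), of R]]
    by simp_all
  have Hm: "case_prod ?H \<in> borel_measurable (?L2 \<Otimes>\<^sub>M P)"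
    unfolding case_prod_beta' by (rule borel_measurable_times[OF wm])
  have Hi: "integrable (?L2 \<Otimes>\<^sub>M P) (case_prod ?H)"
  proof (rule integrableI_bounded[OF Hm])
    have Hm': "(\<lambda>q. ennreal \<bar>case_prod ?H q\<bar>) \<in> borel_measurable (?L2 \<Otimes>\<^sub>M P)"
      by (rule measurable_compose[OF Hm]) simp
    let ?S = "{-R..R} \<times> {-R..R}"
    have S: "?S \<in> sets ?L2" by simp
    have "emeasure lborel ?S < \<infinity>" by (intro emeasure_bounded_finite bounded_Times) auto
    then have Sf: "emeasure ?L2 ?S < \<infinity>" by (simp add: lborel_prod)
    have "(\<integral>\<^sup>+q. ennreal (norm (case_prod ?H q)) \<partial>(?L2 \<Otimes>\<^sub>M P)) = (\<integral>\<^sup>+p. \<integral>\<^sup>+\<omega>. ennreal \<bar>?H p \<omega>\<bar> \<partial>P \<partial>?L2)"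
      using nn_integral_fst[OF Hm'] by simp
    also have "\<dots> \<le> (\<integral>\<^sup>+p. ennreal ((covariance t t 0 + covariance t' t' 0) / 2) * indicator ?S p \<partial>?L2)"
    proof (rule nn_integral_mono)
      fix p
      show "(\<integral>\<^sup>+\<omega>. ennreal \<bar>?H p \<omega>\<bar> \<partial>P) \<le> ennreal ((covariance t t 0 + covariance t' t' 0) / 2) * indicator ?S p"
        using window_mult_le[OF t, of R "snd p" "fst p"] by (cases p) (simp add: indicator_times mult.commute)
    qed
    also have "\<dots> < \<infinity>" using S Sf by (simp add: nn_integral_cmult_indicator ennreal_mult_less_top)
    finally show "(\<integral>\<^sup>+q. ennreal (norm (case_prod ?H q)) \<partial>(?L2 \<Otimes>\<^sub>M P)) < \<infinity>" .
  qed
  \<comment> \<open>For almost every outcome the double integral over the square is finite and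
    factors into the two spatial integrals.\<close>
  have ae: "AE \<omega> in P. (LINT p|?L2. ?H p \<omega>) = spatial_integral u R t \<omega> * spatial_integral u R t' \<omega>"
    using LP.AE_integrable_snd[OF Hi]
  proof eventually_elim
    case (elim \<omega>)
    then have i: "integrable ?L2 (\<lambda>(x', x). window t' R x' \<omega> * window t R x \<omega>)"
      by (simp add: case_prod_beta' mult.commute)
    have "(LINT p|?L2. ?H p \<omega>) = (LINT (x', x)|?L2. window t' R x' \<omega> * window t R x \<omega>)"
      by (simp add: case_prod_beta' mult.commute)
    also have "\<dots> = (LINT x'|lborel. window t' R x' \<omega>) * (LINT x|lborel. window t R x \<omega>)"
      by (rule integral_product_functions[OF sigma_finite_lborel sigma_finite_lborel i])
    finally show ?case by (simp add: spatial_integral_eq mult.commute)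
  qed
  have Fm: "(\<lambda>\<omega>. spatial_integral u R t \<omega> * spatial_integral u R t' \<omega>) \<in> borel_measurable P"
    unfolding spatial_integral_eq
    by (intro borel_measurable_times lborel.borel_measurable_lebesgue_integral window_measurable t)
  have Gi: "integrable P (\<lambda>\<omega>. LINT p|?L2. ?H p \<omega>)" by (rule LP.integrable_snd[OF Hi])
  then show "integrable P (\<lambda>\<omega>. spatial_integral u R t \<omega> * spatial_integral u R t' \<omega>)"
    using integrable_cong_AE[OF borel_measurable_integrable[OF Gi] Fm ae] by simp
  have "expectation (\<lambda>\<omega>. spatial_integral u R t \<omega> * spatial_integral u R t' \<omega>) = expectation (\<lambda>\<omega>. LINT p|?L2. ?H p \<omega>)"
    using integral_cong_AE[OF borel_measurable_integrable[OF Gi] Fm ae] by simp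
  also have "\<dots> = (LINT p|?L2. expectation (?H p))" by (rule LP.Fubini_integral[OF Hi])
  also have "\<dots> = (LINT x'|lborel. LINT x|lborel. expectation (?H (x', x)))"
    by (rule lborel_pair.integral_fst'[OF LP.integrable_fst[OF Hi], symmetric])
  also have "\<dots> = window_integral (covariance t t') R"
    unfolding window_integral_def
  proof (intro Bochner_Integration.integral_cong refl)
    fix x x' :: real
    have "expectation (?H (x', x)) = expectation (\<lambda>\<omega>. (indicator {-R..R} x * indicator {-R..R} x') * ((u t x \<omega> - 1) * (u t' x' \<omega> - 1)))"
      by (simp add: window_def mult_ac)
    also have "\<dots> = indicator {-R..R} x * indicator {-R..R} x' * covariance t t' (x - x')"
      unfolding integral_mult_right_zero covariance_stationary[OF t] ..
    finally show "expectation (?H (x', x)) = indicator {-R..R} x * indicator {-R..R} x' * covariance t t' (x - x')" .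
  qed
  finally show "expectation (\<lambda>\<omega>. spatial_integral u R t \<omega> * spatial_integral u R t' \<omega>) = window_integral (covariance t t') R" .
qed

end

section \<open>From the assumptions to the limit\<close>

lemma assumption_A_correlation_kernel:
  assumes "assumption_A \<kappa>" shows "correlation_kernel \<kappa>"
proof -
  note A = assms[unfolded assumption_A_def]
  note sym = A[THEN conjunct2, THEN conjunct1] and temp = A[THEN conjunct2, THEN conjunct2, THEN conjunct1]
    and ex = A[THEN conjunct2, THEN conjunct2, THEN conjunct2, THEN conjunct1]
    and fin = A[THEN conjunct2, THEN conjunct2, THEN conjunct2, THEN conjunct2]
  from ex have corr: "(\<forall>x. autocorrelation \<kappa> (- x) = autocorrelation \<kappa> x) \<and> tempered (autocorrelation \<kappa>)"
    by (elim exE conjE) (intro conjI)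
  show ?thesis
  proof
    show "\<kappa> (- x) = \<kappa> x" for x using sym by simp
    show "autocorrelation \<kappa> (- x) = autocorrelation \<kappa> x" for x using corr by simp
    show "\<kappa> x < \<infinity>" if "x \<noteq> 0" for x by (rule fin[THEN spec, THEN mp, OF that, THEN conjunct1])
    show "autocorrelation \<kappa> x < \<infinity>" if "x \<noteq> 0" for x
      by (rule fin[THEN spec, THEN mp, OF that, THEN conjunct2])
    show "tempered \<kappa>" by (rule temp)
    show "tempered (autocorrelation \<kappa>)" by (rule corr[THEN conjunct2])
  qed
qed

theorem theorem1p4:
  fixes P :: "'w measure"
    and \<nu> :: "real measure"
    and N :: "'w \<Rightarrow> (real \<times> real \<times> real) measure"
    and \<kappa> :: "real \<Rightarrow> ennreal"
    and X :: "real \<Rightarrow> (real \<Rightarrow> real) \<Rightarrow> 'w \<Rightarrow> real"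
    and u :: "real \<Rightarrow> real \<Rightarrow> 'w \<Rightarrow> real"
    and \<beta> :: real
  assumes "prob_space P" and "complete_measure P"
    and "jump_measure \<nu>"
    and "poisson_random_measure P N (intensity \<nu>)"
    and "assumption_A \<kappa>" and "assumption_B \<kappa>"
    and "levy_colored_noise P N \<nu> \<kappa> X"
    and "mild_solution P N \<kappa> X u"
    and "integrable_kernel \<kappa> \<Longrightarrow> \<beta> = 1"
    and "\<And>\<alpha>. 0 < \<alpha> \<Longrightarrow> \<alpha> < 1 \<Longrightarrow> \<kappa> = riesz_kernel (\<alpha> / 2) \<Longrightarrow> \<beta> = \<alpha> + 1"
  defines "F \<equiv> spatial_integral u"
  shows "(\<forall>t>0. \<forall>R>0. (AE \<omega> in P. set_integrable lborel {- R..R} (\<lambda>x. u t x \<omega> - 1)) \<and>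
                       F R t \<in> borel_measurable P \<and> integrable P (\<lambda>\<omega>. (F R t \<omega>)\<^sup>2)) \<and>
         (\<exists>K :: real \<Rightarrow> real \<Rightarrow> real.
           (\<forall>t>0. \<forall>s>0.
              ((\<lambda>R. 1 / R powr \<beta> * prob_space.expectation P (\<lambda>\<omega>. F R t \<omega> * F R s \<omega>))
                 \<longlongrightarrow> K t s) at_top) \<and>
           (\<forall>t>0. ((\<lambda>R. R powr (- \<beta>) * prob_space.variance P (F R t)) \<longlongrightarrow> K t t) at_top))"
proof -
  have "colored_noise \<kappa> P N \<nu> X"
    by (rule colored_noise.intro[OF assumption_A_correlation_kernel[OF assms(5)] assms(1)
          colored_noise_axioms.intro[OF assms(3,4,7)]])
  then have m: "mild_noise \<kappa> P N \<nu> X u"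
    by (rule mild_noise.intro[OF _ mild_noise_axioms.intro[OF assms(8)]])
  interpret mild_noise \<kappa> P N \<nu> X u by (rule m)
  \<comment> \<open>The formula for the limit differs between the two kinds of kernel; a choice
    gives one function \<open>K\<close> for both.\<close>
  define K where "K t s = (SOME k. ((\<lambda>R. R powr (- \<beta>) * window_integral (covariance t s) R) \<longlongrightarrow> k) at_top)" for t s
  have K: "((\<lambda>R. R powr (- \<beta>) * window_integral (covariance t s) R) \<longlongrightarrow> K t s) at_top" if "0 < t" "0 < s" for t s
    unfolding K_def
  proof (rule someI_ex, rule window_covariance_limit[OF assms(6) _ _ that])
    show "\<beta> = 1" if "integrable_kernel \<kappa>" by (rule assms(9)[OF that])
    show "\<beta> = \<alpha> + 1" if "0 < \<alpha>" "\<alpha> < 1" "\<kappa> = riesz_kernel (\<alpha> / 2)" for \<alpha> by (rule assms(10)[OF that])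
  qed
  have E: "expectation (\<lambda>\<omega>. F R t \<omega> * F R s \<omega>) = window_integral (covariance t s) R" if "0 < t" "0 < s" for R t s
    unfolding F_def using that by (intro spatial_integral_covariance(4)) auto
  \<comment> \<open>The spatial integral has mean 0, so its variance is its second moment and the
    limit at equal times is \<open>K t t\<close>.\<close>
  have V: "variance (F R t) = window_integral (covariance t t) R" if "0 < t" for R t
    using E[OF that that, of R] spatial_integral_covariance(5)[of t t R] that
    by (simp add: F_def power2_eq_square)
  show ?thesis
  proof (intro conjI allI impI exI[of _ K])
    fix t R :: real assume t: "0 < t"
    show "AE \<omega> in P. set_integrable lborel {- R..R} (\<lambda>x. u t x \<omega> - 1)"
      using spatial_integral_covariance(1)[of t t R] t by (simp add: set_integrable_def window_def)
    show "F R t \<in> borel_measurable P"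
      unfolding F_def using spatial_integral_covariance(2)[of t t R] t by simp
    show "integrable P (\<lambda>\<omega>. (F R t \<omega>)\<^sup>2)"
      unfolding F_def using spatial_integral_covariance(3)[of t t R] t by (simp add: power2_eq_square)
  next
    fix t s :: real assume "0 < t" "0 < s"
    then show "((\<lambda>R. 1 / R powr \<beta> * expectation (\<lambda>\<omega>. F R t \<omega> * F R s \<omega>)) \<longlongrightarrow> K t s) at_top"
      using K[of t s] by (simp add: E powr_minus_divide)
  next
    fix t :: real assume "0 < t"
    then show "((\<lambda>R. R powr (- \<beta>) * variance (F R t)) \<longlongrightarrow> K t t) at_top"
      using K[of t t] by (simp add: V)
  qed
qed

end
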